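(* Consider the system of $N$ interacting reinforced stochastic processes $(\mathbf{Z}_n)_{n\ge0}$, $\mathbf{Z}_n=(Z_{n,1},\dots,Z_{n,N})^{\top}$, described in the context, with a.s. limit $Z_\infty\mathbf{1}$. For any $j,k\in\{1,\dots,N\}$ with $j\ne k$ the following hold. (a) If $1/2<\gamma<1$, then $$n^{\gamma/2}(Z_{n,j}-Z_{n,k})\longrightarrow\mathcal{N}\big(0,\,Z_\infty(1-Z_\infty)\Sigma_{\gamma,j,k}\big)\quad\text{stably},$$ where $\Sigma_{\gamma,j,k}=[\widehat\Sigma_\gamma]_{j,j}+[\widehat\Sigma_\gamma]_{k,k}-2[\widehat\Sigma_\gamma]_{j,k}$, $\widehat\Sigma_\gamma=U\widehat S_\gamma U^{\top}$ and $[\widehat S_\gamma]_{h,l}=\dfrac{c}{2-(\lambda_h+\lambda_l)}(\mathbf{v}_h^{\top}\mathbf{v}_l)$ for $2\le h,l\le N$. (b) If $\gamma=1$ and $\mathrm{Re}(\lambda^* )<1-(2c)^{-1}$, then $$\sqrt n\,(Z_{n,j}-Z_{n,k})\longrightarrow\mathcal{N}\big(0,\,Z_\infty(1-Z_\infty)\Sigma_{1,j,k}\big)\quad\text{stably},$$ where $\Sigma_{1,j,k}=[\widehat\Sigma_1]_{j,j}+[\widehat\Sigma_1]_{k,k}-2[\widehat\Sigma_1]_{j,k}$, $\widehat\Sigma_1=U\widehat S_1U^{\top}$ and $[\widehat S_1]_{h,l}=\dfrac{c^2}{2c-c(\lambda_h+\lambda_l)-1}(\mathbf{v}_h^{\top}\mathbf{v}_l)$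 for $2\le h,l\le N$. (c) If $\gamma=1$, $\mathrm{Re}(\lambda^* )=1-(2c)^{-1}$ and $nr_n-c=O(n^{-1})$, then $$\frac{\sqrt n}{\sqrt{\ln n}}(Z_{n,j}-Z_{n,k})\longrightarrow\mathcal{N}\big(0,\,Z_\infty(1-Z_\infty)\Sigma^*_{1,j,k}\big)\quad\text{stably},$$ where $\Sigma^*_{1,j,k}=[\widehat\Sigma^*_1]_{j,j}+[\widehat\Sigma^*_1]_{k,k}-2[\widehat\Sigma^*_1]_{j,k}$, $\widehat\Sigma_1^*=U\widehat S_1^*U^{\top}$ and, for $2\le h,l\le N$, $[\widehat S_1^*]_{h,l}=c^2(\mathbf{v}_h^{\top}\mathbf{v}_l)$ if $\lambda_h+\lambda_l=2-c^{-1}$ and $[\widehat S_1^*]_{h,l}=0$ otherwise.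
   Context: Model. Let $N\ge 1$ be an integer and let $\mathbf{1}\in\mathbb{R}^N$ be the vector of all ones. Let $W=[w_{j,k}]$ be a real $N\times N$ matrix with $w_{j,k}\ge 0$ and $W^{\top}\mathbf{1}=\mathbf{1}$ (i.e. $\sum_{j=1}^N w_{j,k}=1$ for every $k$). Assume that $W$ is irreducible and diagonalizable (over $\mathbb{C}$). Let $(r_n)_{n\ge 0}$ be real constants with $0\le r_n<1$ such that $\lim_n n^{\gamma}r_n=c$ for some $c>0$ and $1/2<\gamma\le 1$. On a probability space $(\Omega,\mathcal{A},P)$ let $\mathbf{Z}_0=(Z_{0,1},\dots,Z_{0,N})^{\top}$ be a (possibly random) vector with values in $[0,1]^N$, and let $\mathbf{X}_n=(X_{n,1},\dots,X_{n,N})^{\top}$, $n\ge 1$, be $\{0,1\}^N$-valued random vectors. Put $\mathcal{F}_n=\sigma(\mathbf{Z}_0,\mathbf{X}_m: 1\le m\le n)$. For every $n\ge 0$, the variables $X_{n+1,1},\dots,X_{n+1,N}$ are conditionally independent given $\mathcal{F}_n$, with $P(X_{n+1,j}=1\mid\mathcal{F}_n)=\sum_{k=1}^N w_{k,j}Z_{n,k}$, and $\mathbf{Z}_{n+1}=(1-r_n)\mathbf{Z}_n+r_n\mathbf{X}_{n+1}$. Under these assumptions $\mathbf{Z}_n\to Z_\infty\mathbf{1}$ a.s. for a random variable $Z_\infty$ with values in $[0,1]$; this defines $Z_\infty$. Spectral notation. Let $\lambda_1=1,\lambda_2,\dots,\lambda_N$ be the eigenvalues of $W$ repeated with multiplicity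 ($1$ is a simple eigenvalue and $\mathrm{Re}(\lambda_j)<1$ for $j\ge2$). Let $\mathbf{u}_1,\dots,\mathbf{u}_N\in\mathbb{C}^N$ be a basis of left eigenvectors, $\mathbf{u}_j^{\top}W=\lambda_j\mathbf{u}_j^{\top}$, with $\|\mathbf{u}_j\|=1$ (where $\|\mathbf{v}\|^2=\overline{\mathbf{v}}^{\top}\mathbf{v}$), those corresponding to the same multiple eigenvalue being orthogonal, and $\mathbf{u}_1=N^{-1/2}\mathbf{1}$. Let $\mathbf{v}_1,\dots,\mathbf{v}_N$ be the right eigenvectors, $W\mathbf{v}_j=\lambda_j\mathbf{v}_j$, determined by $\mathbf{u}_h^{\top}\mathbf{v}_j=\delta_{h,j}$. Let $U$ be the $N\times(N-1)$ matrix with columns $\mathbf{u}_2,\dots,\mathbf{u}_N$; $(N-1)\times(N-1)$ matrices are indexed by $2\le h,l\le N$. $\lambda^*$ is an eigenvalue among $\lambda_2,\dots,\lambda_N$ with maximal real part. Stable convergence. Random variables $Y_n$ on $(\Omega,\mathcal{A},P)$ converge stably to the Gaussian kernel $\mathcal{N}(0,\Sigma)$, with $\Sigma$ a nonnegative random variable, if for every $H\in\mathcal{A}$ with $P(H)>0$ and every bounded continuous real function $f$, $E[f(Y_n)\mid H]\to E\big[\int f\,d\mathcal{N}(0,\Sigma)\,\big|\,H\big]$. *)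

theory Defs
  imports "HOL-Probability.Probability" "HOL-Library.Landau_Symbols"
begin

section \<open>Matrices\<close>

text \<open>Irreducible: no simultaneous permutation of rows and columns brings the matrix to block
  triangular form with two nonempty diagonal blocks.\<close>

definition irreducible_matrix :: "'a::zero ^ 'n ^ 'n \<Rightarrow> bool" where
  "irreducible_matrix A \<longleftrightarrow>
     \<not> (\<exists>S. S \<noteq> {} \<and> S \<noteq> UNIV \<and> (\<forall>i\<in>S. \<forall>j\<in>-S. A $ i $ j = 0))"

definition diagonalizable :: "'a::field ^ 'n ^ 'n \<Rightarrow> bool" where
  "diagonalizable A \<longleftrightarrow>
     (\<exists>P D :: 'a ^ 'n ^ 'n. invertible P \<and> (\<forall>i j. i \<noteq> j \<longrightarrow> D $ i $ j = 0) \<and> A = P ** D ** matrix_inv P)"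

abbreviation complex_matrix :: "real ^ 'n ^ 'm \<Rightarrow> complex ^ 'n ^ 'm" where
  "complex_matrix \<equiv> map_matrix complex_of_real"

text \<open>The eigenvalues and the left and right eigenvectors are enumerated by \<open>1, \<dots>, N\<close>, where
  \<open>N = CARD('n)\<close>. Note that \<^const>\<open>scalar_product\<close> is bilinear (no conjugation), whereas the
  orthogonality of eigenvectors for a common eigenvalue is Hermitian, as is \<^const>\<open>norm\<close>.\<close>

definition spectral_system ::
  "real ^ 'n ^ 'n \<Rightarrow> (nat \<Rightarrow> complex) \<Rightarrow> (nat \<Rightarrow> complex ^ 'n) \<Rightarrow> (nat \<Rightarrow> complex ^ 'n) \<Rightarrow> bool"
where
  "spectral_system W lam u v \<longleftrightarrow>
     lam 1 = 1 \<and>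
     (\<forall>x. det (mat x - complex_matrix W) = (\<Prod>j=1..CARD('n). (x - lam j))) \<and>
     inj_on u {1..CARD('n)} \<and>
     vec.independent (u ` {1..CARD('n)}) \<and>
     vec.span (u ` {1..CARD('n)}) = UNIV \<and>
     (\<forall>j\<in>{1..CARD('n)}. u j v* complex_matrix W = lam j *s u j) \<and>
     (\<forall>j\<in>{1..CARD('n)}. norm (u j) = 1) \<and>
     (\<forall>h\<in>{1..CARD('n)}. \<forall>j\<in>{1..CARD('n)}. h \<noteq> j \<and> lam h = lam j \<longrightarrow>
        (\<Sum>i\<in>UNIV. cnj (u h $ i) * u j $ i) = 0) \<and>
     u 1 = complex_of_real (1 / sqrt (real CARD('n))) *s 1 \<and>
     (\<forall>j\<in>{1..CARD('n)}. complex_matrix W *v v j = lam j *s v j) \<and>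
     (\<forall>h\<in>{1..CARD('n)}. \<forall>j\<in>{1..CARD('n)}.
        scalar_product (u h) (v j) = (if h = j then 1 else 0))"

text \<open>\<open>U S U\<^sup>T\<close>, where \<open>U\<close> has the columns \<open>u 2, \<dots>, u N\<close> and the square matrix \<open>S\<close> of size
  \<open>N - 1\<close> is given by its entries \<open>S h l\<close> for \<open>2 \<le> h, l \<le> N\<close>.\<close>

definition U_S_UT ::
  "(nat \<Rightarrow> complex ^ 'n) \<Rightarrow> (nat \<Rightarrow> nat \<Rightarrow> complex) \<Rightarrow> complex ^ 'n ^ 'n" where
  "U_S_UT u S = (\<chi> a b. \<Sum>h=2..CARD('n). \<Sum>l=2..CARD('n). u h $ a * S h l * u l $ b)"

definition S_gamma ::
  "real \<Rightarrow> (nat \<Rightarrow> complex) \<Rightarrow> (nat \<Rightarrow> complex ^ 'n) \<Rightarrow> nat \<Rightarrow> nat \<Rightarrow> complex" where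
  "S_gamma c lam v h l =
     complex_of_real c / (2 - (lam h + lam l)) * scalar_product (v h) (v l)"

definition S_one ::
  "real \<Rightarrow> (nat \<Rightarrow> complex) \<Rightarrow> (nat \<Rightarrow> complex ^ 'n) \<Rightarrow> nat \<Rightarrow> nat \<Rightarrow> complex" where
  "S_one c lam v h l =
     complex_of_real (c\<^sup>2) / (2 * complex_of_real c - complex_of_real c * (lam h + lam l) - 1)
       * scalar_product (v h) (v l)"

definition S_one_star ::
  "real \<Rightarrow> (nat \<Rightarrow> complex) \<Rightarrow> (nat \<Rightarrow> complex ^ 'n) \<Rightarrow> nat \<Rightarrow> nat \<Rightarrow> complex" where
  "S_one_star c lam v h l =
     (if lam h + lam l = 2 - 1 / complex_of_real c
      then complex_of_real (c\<^sup>2) * scalar_product (v h) (v l) else 0)"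

definition diff_var :: "complex ^ 'n ^ 'n \<Rightarrow> 'n \<Rightarrow> 'n \<Rightarrow> complex" where
  "diff_var A j k = A $ j $ j + A $ k $ k - 2 * A $ j $ k"


section \<open>Probability\<close>

text \<open>The normal law with mean 0 and variance \<open>s \<ge> 0\<close>, given as an image of the standard normal
  law so that \<open>s = 0\<close> yields the Dirac measure at 0 (for which \<^const>\<open>normal_density\<close> is unsuitable).\<close>

definition centered_normal :: "real \<Rightarrow> real measure" where
  "centered_normal s = distr std_normal_distribution borel (\<lambda>x. sqrt s * x)"

text \<open>Stable convergence of \<open>Y n\<close> to the Gaussian kernel with mean 0 and random variance \<open>S\<close>.
  Integration with respect to \<^term>\<open>uniform_measure M H\<close> is the expectation given the event \<open>H\<close>.\<close>

definition stably_converges_normal ::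
  "'w measure \<Rightarrow> (nat \<Rightarrow> 'w \<Rightarrow> real) \<Rightarrow> ('w \<Rightarrow> real) \<Rightarrow> bool" where
  "stably_converges_normal M Y S \<longleftrightarrow>
     (\<forall>n. Y n \<in> borel_measurable M) \<and>
     S \<in> borel_measurable M \<and> (\<forall>\<omega>\<in>space M. 0 \<le> S \<omega>) \<and>
     (\<forall>H\<in>sets M. measure M H > 0 \<longrightarrow>
       (\<forall>f :: real \<Rightarrow> real. continuous_on UNIV f \<and> bounded (range f) \<longrightarrow>
         (\<lambda>n. \<integral>\<omega>. f (Y n \<omega>) \<partial>uniform_measure M H)
           \<longlonglongrightarrow> (\<integral>\<omega>. (\<integral>x. f x \<partial>centered_normal (S \<omega>)) \<partial>uniform_measure M H)))"

text \<open>Taking \<open>B j = UNIV\<close> for some of the indices gives the product formula for subfamilies.\<close>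

definition cond_indep_vars :: "'w measure \<Rightarrow> 'w measure \<Rightarrow> ('n::finite \<Rightarrow> 'w \<Rightarrow> real) \<Rightarrow> bool" where
  "cond_indep_vars M G Y \<longleftrightarrow>
     (\<forall>B. (\<forall>j. B j \<in> sets borel) \<longrightarrow>
       (AE \<omega> in M.
          real_cond_exp M G (indicator {\<omega>' \<in> space M. \<forall>j. Y j \<omega>' \<in> B j}) \<omega> =
          (\<Prod>j\<in>UNIV. real_cond_exp M G (indicator {\<omega>' \<in> space M. Y j \<omega>' \<in> B j}) \<omega>)))"

definition rsp_filtration ::
  "'w measure \<Rightarrow> ('w \<Rightarrow> real ^ 'n) \<Rightarrow> (nat \<Rightarrow> 'w \<Rightarrow> real ^ 'n) \<Rightarrow> nat \<Rightarrow> 'w measure" where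
  "rsp_filtration M Z0 X n =
     sigma (space M)
       ({Z0 -` B \<inter> space M | B. B \<in> sets borel} \<union>
        {X m -` B \<inter> space M | m B. m \<in> {1..n} \<and> B \<in> sets borel})"

text \<open>The system of interacting reinforced stochastic processes; \<open>X 0\<close> plays no role.\<close>

locale interacting_rsp = prob_space M
  for M :: "'w measure" and W :: "real ^ 'n ^ 'n" and r :: "nat \<Rightarrow> real" and \<gamma> c :: real
    and X Z :: "nat \<Rightarrow> 'w \<Rightarrow> real ^ 'n" +
  assumes W_nonneg: "\<And>j k. 0 \<le> W $ j $ k"
    and W_stochastic: "transpose W *v 1 = 1"
    and W_irreducible: "irreducible_matrix W"
    and W_diagonalizable: "diagonalizable (complex_matrix W)"
    and r_range: "\<And>n. 0 \<le> r n \<and> r n < 1"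
    and gamma_range: "1/2 < \<gamma>" "\<gamma> \<le> 1"
    and c_pos: "0 < c"
    and r_limit: "(\<lambda>n. real n powr \<gamma> * r n) \<longlonglongrightarrow> c"
    and Z0_measurable: "random_variable borel (Z 0)"
    and Z0_range: "\<And>\<omega> j. \<omega> \<in> space M \<Longrightarrow> Z 0 \<omega> $ j \<in> {0..1}"
    and X_measurable: "\<And>n. 1 \<le> n \<Longrightarrow> random_variable borel (X n)"
    and X_range: "\<And>n \<omega> j. 1 \<le> n \<Longrightarrow> \<omega> \<in> space M \<Longrightarrow> X n \<omega> $ j \<in> {0, 1}"
    and X_cond_indep:
      "\<And>n. cond_indep_vars M (rsp_filtration M (Z 0) X n) (\<lambda>j \<omega>. X (Suc n) \<omega> $ j)"
    and X_cond_prob: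
      "\<And>n j. AE \<omega> in M.
         real_cond_exp M (rsp_filtration M (Z 0) X n)
           (indicator {\<omega>' \<in> space M. X (Suc n) \<omega>' $ j = 1}) \<omega>
         = (\<Sum>k\<in>UNIV. W $ k $ j * Z n \<omega> $ k)"
    and Z_step:
      "\<And>n \<omega>. \<omega> \<in> space M \<Longrightarrow> Z (Suc n) \<omega> = (1 - r n) *\<^sub>R Z n \<omega> + r n *\<^sub>R X (Suc n) \<omega>"

end

theory Submission
  imports Defs "HOL-Real_Asymp.Real_Asymp"
begin

text \<open>Diagonalising \<open>W\<close> turns the recursion for \<open>Z\<close> into scalar ones and writes
  \<open>Z n j - Z n k\<close> as a negligible initial term plus a sum of martingale differences with
  deterministic weights, the component along \<open>u 1\<close> being cancelled. The deterministic variances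
  satisfy affine recursions whose limits are the entries of the matrices \<open>S\<close>; since
  the conditional variances of the innovations tend to \<open>Zinf (1 - Zinf)\<close>, a stable central
  limit theorem for arrays applies. For the latter, \<open>exp (i t \<Sum> \<xi>)\<close> is compared with
  \<open>\<Prod> (1 + i t \<xi>) exp (- t\<^sup>2 \<Sum> \<xi>\<^sup>2 / 2)\<close>. The product is bounded and
  tends to 1 weakly in \<open>L\<^sup>2\<close>: tested against a bounded \<open>G\<close>, it only sees the increments of the
  martingale of conditional expectations of \<open>G\<close>, which are square summable.\<close>

section \<open>A stable central limit theorem for martingale arrays\<close>

text \<open>Neither truncation nor stopping is required, because the innovations are bounded by 1
  and their weights are deterministic: each row has pointwise bounds \<open>B n m\<close> whose
  squares have bounded sum and whose maximum tends to 0. The bounded sum keeps the products bounded;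
  the vanishing maximum, against square summable increments, gives the weak limit by Cauchy-Schwarz.
  Since all rows live on one filtration, the test function can be any bounded random variable.
  Taking the indicator of the conditioning event times \<open>exp (- t\<^sup>2 * S / 2)\<close> is
  what yields stable convergence, although the limit variance S is random and in general not
  determined at any finite time. On the deterministic side the products themselves are never
  estimated: sums of their squares and fourth powers satisfy one-step recursions, the former giving
  the limit covariances, the latter the smallness of the largest weight and of the initial term. In
  the critical regime with the logarithm the contraction rate of these recursions may vanish; the
  rate of convergence of \<open>n * r n\<close> to c then makes the errors summable.\<close>

lemma integral_norm_le_integral:
  fixes f :: "'a \<Rightarrow> 'b::{banach, second_countable_topology}"
  assumes "integrable M f" "integrable M g" "\<And>x. x \<in> space M \<Longrightarrow> norm (f x) \<le> g x"
  shows "norm (\<integral>x. f x \<partial>M) \<le> (\<integral>x. g x \<partial>M)"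
  using integral_norm_bound[of M f] integral_mono[OF integrable_norm[OF assms(1)] assms(2,3)]
  by linarith

section \<open>Exponential estimates for a single factor\<close>

text \<open>The squared modulus is \<open>1 + x\<^sup>2\<close>. The Gaussian form matters: in a
  product over a row the exponents add up to half the sum of the squares, which will be
  bounded.\<close>

lemma norm_one_plus_ii_le: "cmod (1 + \<i> * complex_of_real x) \<le> exp (x\<^sup>2 / 2)"
proof -
  have "(cmod (1 + \<i> * complex_of_real x))\<^sup>2 = 1 + x\<^sup>2"
    by (simp add: cmod_power2)
  also have "\<dots> \<le> exp (x\<^sup>2)" by (rule exp_ge_add_one_self)
  also have "\<dots> = (exp (x\<^sup>2 / 2))\<^sup>2" by (simp add: power2_eq_square flip: exp_add)
  finally show ?thesis by (rule power2_le_imp_le) simp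
qed

text \<open>Both terms agree with \<open>1 + \<i> * x - x\<^sup>2 / 2\<close> up to third order,
  which settles \<bar>x\<bar> \<le> 1; for larger x both have modulus at most 1, and the right side
  is at least 2.\<close>

lemma norm_iexp_minus_factor_le:
  fixes x :: real
  shows "cmod (iexp x - (1 + \<i> * x) * exp (- (x\<^sup>2) / 2)) \<le> 2 * \<bar>x\<bar> ^ 3"
proof (cases "\<bar>x\<bar> \<le> 1")
  case True
  define y where "y = x\<^sup>2 / 2"
  have y: "0 \<le> y" by (simp add: y_def)
  \<comment> \<open>Inverting the Taylor lower bound for \<open>exp y\<close> gives a second-order
    upper bound for \<open>exp (- y)\<close>; from below \<open>1 - y\<close> already
    suffices.\<close>
  have "exp (- y) \<le> 1 / (1 + y + y\<^sup>2 / 2)"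
    using exp_lower_Taylor_quadratic[OF y] y by (simp add: exp_minus inverse_eq_divide frac_le add_pos_nonneg)
  also have "\<dots> \<le> 1 - y + y\<^sup>2 / 2"
  proof -
    have "(1 - y + y\<^sup>2 / 2) * (1 + y + y\<^sup>2 / 2) = 1 + (y\<^sup>2 / 2)\<^sup>2"
      by (simp add: power2_eq_square algebra_simps)
    then show ?thesis using y by (simp add: divide_le_eq add_pos_nonneg)
  qed
  finally have y2: "\<bar>exp (- y) - (1 - y)\<bar> \<le> y\<^sup>2 / 2"
    using exp_ge_add_one_self[of "- y"] by simp
  \<comment> \<open>The middle term is the cubic left over when
    \<open>(1 + \<i> * x) * (1 - y)\<close> is multiplied out with
    \<open>y = x\<^sup>2 / 2\<close>.\<close>
  have "iexp x - (1 + \<i> * x) * exp (- y) =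
     (iexp x - (\<Sum>k\<le>2. (\<i> * x) ^ k / fact k)) + \<i> * of_real (x ^ 3 / 2) - (1 + \<i> * x) * of_real (exp (- y) - (1 - y))"
    by (simp add: y_def numeral_eq_Suc algebra_simps)
  then have "cmod (iexp x - (1 + \<i> * x) * exp (- y)) \<le>
     cmod (iexp x - (\<Sum>k\<le>2. (\<i> * x) ^ k / fact k)) + cmod (\<i> * of_real (x ^ 3 / 2)) +
     cmod ((1 + \<i> * x) * of_real (exp (- y) - (1 - y)))"
    by (metis (no_types, lifting) add_right_mono norm_triangle_ineq norm_triangle_ineq4 order_trans)
  also have "\<dots> \<le> \<bar>x\<bar> ^ 3 / 6 + \<bar>x\<bar> ^ 3 / 2 + 2 * (\<bar>x\<bar> ^ 3 / 8)"
  proof (intro add_mono)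
    show "cmod (iexp x - (\<Sum>k\<le>2. (\<i> * x) ^ k / fact k)) \<le> \<bar>x\<bar> ^ 3 / 6"
      using iexp_approx1[of x 2] by (simp add: fact_numeral numeral_3_eq_3[symmetric])
    show "cmod (\<i> * of_real (x ^ 3 / 2)) \<le> \<bar>x\<bar> ^ 3 / 2"
      by (simp add: norm_mult norm_divide norm_power power_abs flip: of_real_power)
    have "cmod (1 + \<i> * x) \<le> 1 + \<bar>x\<bar>"
      using norm_triangle_ineq[of 1 "\<i> * complex_of_real x"] by (simp add: norm_mult)
    moreover have "y\<^sup>2 / 2 \<le> \<bar>x\<bar> ^ 3 / 8"
    proof -
      have "y\<^sup>2 / 2 = \<bar>x\<bar> ^ 4 / 8" by (simp add: y_def power_divide)
      also have "\<dots> \<le> \<bar>x\<bar> ^ 3 / 8" using True power_decreasing[of 3 4 "\<bar>x\<bar>"] by simp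
      finally show ?thesis .
    qed
    ultimately show "cmod ((1 + \<i> * x) * of_real (exp (- y) - (1 - y))) \<le> 2 * (\<bar>x\<bar> ^ 3 / 8)"
      unfolding norm_mult norm_of_real using y2 True by (intro mult_mono) auto
  qed
  also have "\<dots> \<le> 2 * \<bar>x\<bar> ^ 3" by simp
  finally show ?thesis by (simp add: y_def)
next
  case False
  have "cmod ((1 + \<i> * x) * exp (- (x\<^sup>2) / 2)) \<le> exp (x\<^sup>2 / 2) * exp (- (x\<^sup>2) / 2)"
    unfolding norm_mult using norm_one_plus_ii_le[of x] by (intro mult_mono) auto
  also have "\<dots> = 1" by (simp flip: exp_add)
  finally have "cmod (iexp x - (1 + \<i> * x) * exp (- (x\<^sup>2) / 2)) \<le> 1 + 1"
    by (intro order_trans[OF norm_triangle_ineq4] add_mono) auto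
  also have "\<dots> \<le> 2 * \<bar>x\<bar> ^ 3" using False by (simp add: one_le_power)
  finally show ?thesis .
qed

lemma exp_minus_lipschitz:
  fixes x y :: real
  assumes "0 \<le> x" "0 \<le> y"
  shows "\<bar>exp (- x) - exp (- y)\<bar> \<le> \<bar>x - y\<bar>"
proof -
  have *: "exp (- a) - exp (- b) \<le> b - a" "0 \<le> exp (- a) - exp (- b)" if "0 \<le> a" "a \<le> b" for a b :: real
  proof -
    have "exp (- a) - exp (- b) = exp (- a) * (1 - exp (- (b - a)))"
      by (simp add: algebra_simps flip: exp_add)
    also have "\<dots> \<le> 1 * (b - a)"
    proof (rule mult_mono)
      show "1 - exp (- (b - a)) \<le> b - a" using exp_ge_add_one_self[of "- (b - a)"] by linarith
    qed (use that in auto)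
    finally show "exp (- a) - exp (- b) \<le> b - a" by simp
  qed (use that in auto)
  show ?thesis using *[of x y] *[of y x] assms by (cases "x \<le> y") auto
qed

lemma (in prob_space) expectation_abs_le_sqrt:
  fixes X :: "'a \<Rightarrow> real"
  assumes [measurable]: "X \<in> borel_measurable M" and bound: "\<And>\<omega>. \<omega> \<in> space M \<Longrightarrow> \<bar>X \<omega>\<bar> \<le> C"
  shows "expectation (\<lambda>\<omega>. \<bar>X \<omega>\<bar>) \<le> sqrt (expectation (\<lambda>\<omega>. (X \<omega>)\<^sup>2))"
proof (rule real_le_rsqrt)
  have i1: "integrable M (\<lambda>\<omega>. \<bar>X \<omega>\<bar>)"
    using bound by (intro integrable_const_bound[where B = C]) auto
  have "(X \<omega>)\<^sup>2 \<le> C\<^sup>2" if "\<omega> \<in> space M" for \<omega>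
    using bound[OF that] by (metis abs_ge_zero power2_abs power_mono)
  then have i2: "integrable M (\<lambda>\<omega>. \<bar>X \<omega>\<bar>\<^sup>2)"
    by (intro integrable_const_bound[where B = "C\<^sup>2"]) auto
  show "(expectation (\<lambda>\<omega>. \<bar>X \<omega>\<bar>))\<^sup>2 \<le> expectation (\<lambda>\<omega>. (X \<omega>)\<^sup>2)"
    using variance_eq[OF i1 i2] variance_positive[of "\<lambda>\<omega>. \<bar>X \<omega>\<bar>"] by simp
qed

section \<open>Conditional expectations of a bounded test function\<close>

text \<open>A conditional expectation of a function bounded by 1 lies in [-1, 1] only almost
  everywhere. Clipping selects a version with a bound at every point, as the tested martingale
  conditions below demand, and keeps it measurable for F.\<close>

definition clipped_cond_exp :: "'a measure \<Rightarrow> 'a measure \<Rightarrow> ('a \<Rightarrow> real) \<Rightarrow> 'a \<Rightarrow> real" where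
  "clipped_cond_exp M F G \<omega> = max (-1) (min 1 (real_cond_exp M F G \<omega>))"

lemma clipped_cond_exp_measurable[measurable]: "clipped_cond_exp M F G \<in> borel_measurable F"
  unfolding clipped_cond_exp_def by measurable

lemma abs_clipped_cond_exp_le: "\<bar>clipped_cond_exp M F G \<omega>\<bar> \<le> 1"
  unfolding clipped_cond_exp_def by auto

text \<open>As G is bounded by 1, clipping alters the conditional expectation only on a null set, so
  its defining property survives.\<close>

lemma (in prob_space) integral_clipped_cond_exp:
  fixes f G :: "'a \<Rightarrow> real"
  assumes sub: "subalgebra M F" and G[measurable]: "G \<in> borel_measurable M"
    and G_bound: "\<And>\<omega>. \<omega> \<in> space M \<Longrightarrow> \<bar>G \<omega>\<bar> \<le> 1"
    and f: "f \<in> borel_measurable F" and fC: "\<And>\<omega>. \<omega> \<in> space M \<Longrightarrow> \<bar>f \<omega>\<bar> \<le> C"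
  shows "expectation (\<lambda>\<omega>. f \<omega> * clipped_cond_exp M F G \<omega>) = expectation (\<lambda>\<omega>. f \<omega> * G \<omega>)"
proof -
  interpret F: finite_measure_subalgebra M F
    using sub by unfold_locales
  have iG: "integrable M G"
    using G_bound by (intro integrable_const_bound[where B = 1]) auto
  define E where "E = real_cond_exp M F G"
  have [measurable]: "E \<in> borel_measurable F" "E \<in> borel_measurable M"
    by (simp_all add: E_def)
  have "AE \<omega> in M. E \<omega> \<ge> -1"
    unfolding E_def by (rule F.real_cond_exp_ge_c[OF iG]) (use G_bound in \<open>auto simp: abs_le_iff\<close>)
  moreover have "AE \<omega> in M. E \<omega> \<le> 1"
    unfolding E_def by (rule F.real_cond_exp_le_c[OF iG]) (use G_bound in \<open>auto simp: abs_le_iff\<close>)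
  ultimately have ae: "AE \<omega> in M. max (-1) (min 1 (E \<omega>)) = E \<omega>" by eventually_elim auto
    have [measurable]: "f \<in> borel_measurable M" using measurable_from_subalg[OF sub f] .
    have "integrable M (\<lambda>\<omega>. f \<omega> * G \<omega>)"
    proof (rule integrable_const_bound[where B = C])
      show "AE \<omega> in M. norm (f \<omega> * G \<omega>) \<le> C"
      proof (rule AE_I2)
        fix \<omega> assume "\<omega> \<in> space M"
        then have "\<bar>f \<omega>\<bar> * \<bar>G \<omega>\<bar> \<le> C * 1"
          using fC G_bound by (intro mult_mono) (auto intro: order_trans[OF abs_ge_zero])
        then show "norm (f \<omega> * G \<omega>) \<le> C" by (simp add: abs_mult)
      qed
    qed simp
    from F.real_cond_exp_intg(2)[OF this f G]
    have "expectation (\<lambda>\<omega>. f \<omega> * E \<omega>) = expectation (\<lambda>\<omega>. f \<omega> * G \<omega>)"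
      by (simp add: E_def)
    moreover have "expectation (\<lambda>\<omega>. f \<omega> * clipped_cond_exp M F G \<omega>) = expectation (\<lambda>\<omega>. f \<omega> * E \<omega>)"
      unfolding clipped_cond_exp_def E_def[symmetric] by (rule integral_cong_AE) (use ae in auto)
    ultimately show ?thesis by simp
qed

section \<open>Limits of weighted sums over triangular arrays\<close>

text \<open>The head of the sum has a fixed number of terms, each at most
  \<open>\<beta> n * g m\<close>, and vanishes; the tail is small uniformly in n by Cauchy-Schwarz,
  because g is square summable.\<close>

lemma weighted_sum_tendsto_0:
  fixes B :: "nat \<Rightarrow> nat \<Rightarrow> real" and g :: "nat \<Rightarrow> real"
  assumes B0: "\<And>n m. m < n \<Longrightarrow> 0 \<le> B n m" and Bb: "\<And>n m. m < n \<Longrightarrow> B n m \<le> \<beta> n"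
    and \<beta>: "\<beta> \<longlonglongrightarrow> 0" and K: "\<And>n. (\<Sum>m<n. (B n m)\<^sup>2) \<le> K"
    and g0: "\<And>m. 0 \<le> g m" and g: "summable (\<lambda>m. (g m)\<^sup>2)"
  shows "(\<lambda>n. \<Sum>m<n. B n m * g m) \<longlonglongrightarrow> 0"
proof (rule LIMSEQ_I)
  fix e :: real assume e: "e > 0"
  have K0: "0 \<le> K" using K[of 0] by simp
  \<comment> \<open>Chosen so that Cauchy-Schwarz bounds the tail by
    \<open>sqrt K * d < e / 2\<close>; the added 1 covers \<open>K = 0\<close>.\<close>
  define d where "d = e / (2 * (sqrt K + 1))"
  have d: "d > 0" "d * sqrt K < e / 2"
  proof -
    have s: "sqrt K \<ge> 0" using K0 by simp
    from s have pos: "0 < sqrt K + 1" by linarith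
    then show "d > 0" using e by (simp add: d_def)
    have "e * sqrt K < e * (sqrt K + 1)" using e by simp
    then show "d * sqrt K < e / 2" using pos by (simp add: d_def field_simps)
  qed
  obtain p where p: "\<And>n. norm (\<Sum>m\<in>{p..<n}. (g m)\<^sup>2) < d\<^sup>2"
    using g[unfolded summable_Cauchy] d by (metis order_refl zero_less_power)
  have "(\<lambda>n. \<beta> n * (\<Sum>m<p. g m)) \<longlonglongrightarrow> 0 * (\<Sum>m<p. g m)" using \<beta> by (intro tendsto_intros)
  then have "\<forall>\<^sub>F n in sequentially. \<beta> n * (\<Sum>m<p. g m) < e / 2"
    using e by (intro order_tendstoD) auto
  then obtain n0 where n0: "\<And>n. n \<ge> n0 \<Longrightarrow> \<beta> n * (\<Sum>m<p. g m) < e / 2"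
    unfolding eventually_sequentially by blast
  have "norm ((\<Sum>m<n. B n m * g m) - 0) < e" if n: "n \<ge> max n0 p" for n
  proof -
    have nonneg: "(\<Sum>m<n. B n m * g m) \<ge> 0" using B0 g0 by (intro sum_nonneg) auto
    have "{..<n} = {..<p} \<union> {p..<n}" using n by auto
    then have "(\<Sum>m<n. B n m * g m) = (\<Sum>m<p. B n m * g m) + (\<Sum>m\<in>{p..<n}. B n m * g m)"
      by (simp add: sum.union_disjoint[symmetric] ivl_disj_int)
    also have "(\<Sum>m<p. B n m * g m) \<le> (\<Sum>m<p. \<beta> n * g m)"
      using n Bb g0 by (intro sum_mono mult_right_mono) auto
    also have "\<dots> < e / 2" using n0[of n] n by (simp add: sum_distrib_left)
    also have "(\<Sum>m\<in>{p..<n}. B n m * g m) \<le> (\<Sum>m\<in>{p..<n}. \<bar>B n m\<bar> * \<bar>g m\<bar>)"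
      by (intro sum_mono) (metis abs_ge_self abs_mult)
    also have "\<dots> \<le> L2_set (B n) {p..<n} * L2_set g {p..<n}" by (rule L2_set_mult_ineq)
    also have "\<dots> \<le> sqrt K * d"
    proof (rule mult_mono)
      have "(\<Sum>m\<in>{p..<n}. (B n m)\<^sup>2) \<le> (\<Sum>m<n. (B n m)\<^sup>2)" by (rule sum_mono2) auto
      then show "L2_set (B n) {p..<n} \<le> sqrt K" unfolding L2_set_def using K[of n] by auto
      show "L2_set g {p..<n} \<le> d"
        unfolding L2_set_def using p[of n] d by (intro real_le_lsqrt) (auto intro: sum_nonneg)
    qed (use K0 in auto)
    also have "\<dots> < e / 2" using d by (simp add: mult.commute)
    finally show ?thesis using nonneg by simp
  qed
  then show "\<exists>no. \<forall>n\<ge>no. norm ((\<Sum>m<n. B n m * g m) - 0) < e" by blast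
qed

text \<open>The same splitting, with the tail now bounded by the total weight times the supremum of
  the late values of y. It will serve to replace conditional variances by their limit.\<close>

lemma toeplitz_tendsto_0:
  fixes w :: "nat \<Rightarrow> nat \<Rightarrow> real" and y :: "nat \<Rightarrow> real"
  assumes w0: "\<And>n m. m < n \<Longrightarrow> 0 \<le> w n m" and wb: "\<And>n m. m < n \<Longrightarrow> w n m \<le> \<beta> n"
    and \<beta>: "\<beta> \<longlonglongrightarrow> 0" and K: "\<And>n. (\<Sum>m<n. w n m) \<le> K" and y: "y \<longlonglongrightarrow> 0"
  shows "(\<lambda>n. \<Sum>m<n. w n m * y m) \<longlonglongrightarrow> 0"
proof (rule LIMSEQ_I)
  fix e :: real assume e: "e > 0"
  have K0: "0 \<le> K" using K[of 0] by simp
  define d where "d = e / (2 * (K + 1))"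
  have d: "d > 0" "K * d < e / 2" using e K0 by (simp_all add: d_def field_simps)
  obtain p where p: "\<And>m. m \<ge> p \<Longrightarrow> \<bar>y m\<bar> < d"
    using LIMSEQ_D[OF y d(1)] by auto
  have "(\<lambda>n. \<beta> n * (\<Sum>m<p. \<bar>y m\<bar>)) \<longlonglongrightarrow> 0 * (\<Sum>m<p. \<bar>y m\<bar>)" using \<beta> by (intro tendsto_intros)
  then have "\<forall>\<^sub>F n in sequentially. \<beta> n * (\<Sum>m<p. \<bar>y m\<bar>) < e / 2"
    using e by (intro order_tendstoD) auto
  then obtain n0 where n0: "\<And>n. n \<ge> n0 \<Longrightarrow> \<beta> n * (\<Sum>m<p. \<bar>y m\<bar>) < e / 2"
    unfolding eventually_sequentially by blast
  have "norm ((\<Sum>m<n. w n m * y m) - 0) < e" if n: "n \<ge> max n0 p" for n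
  proof -
    have "norm ((\<Sum>m<n. w n m * y m) - 0) \<le> (\<Sum>m<n. w n m * \<bar>y m\<bar>)"
      using w0 by (auto intro!: order_trans[OF sum_abs] sum_mono simp: abs_mult)
    also have "\<dots> = (\<Sum>m<p. w n m * \<bar>y m\<bar>) + (\<Sum>m\<in>{p..<n}. w n m * \<bar>y m\<bar>)"
    proof -
      have "{..<n} = {..<p} \<union> {p..<n}" using n by auto
      then show ?thesis by (simp add: sum.union_disjoint[symmetric] ivl_disj_int)
    qed
    also have "(\<Sum>m<p. w n m * \<bar>y m\<bar>) \<le> (\<Sum>m<p. \<beta> n * \<bar>y m\<bar>)"
      using n wb by (intro sum_mono mult_right_mono) auto
    also have "\<dots> < e / 2" using n0[of n] n by (simp add: sum_distrib_left)
    also have "(\<Sum>m\<in>{p..<n}. w n m * \<bar>y m\<bar>) \<le> (\<Sum>m\<in>{p..<n}. w n m * d)"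
      using p w0 by (intro sum_mono mult_left_mono) (auto intro: less_imp_le)
    also have "\<dots> = (\<Sum>m\<in>{p..<n}. w n m) * d" by (simp add: sum_distrib_right)
    also have "\<dots> \<le> K * d"
    proof -
      have "(\<Sum>m\<in>{p..<n}. w n m) \<le> (\<Sum>m<n. w n m)" using w0 by (intro sum_mono2) auto
      then show ?thesis using K[of n] d(1) by (intro mult_right_mono) auto
    qed
    also have "\<dots> < e / 2" by (rule d)
    finally show ?thesis by simp
  qed
  then show "\<exists>no. \<forall>n\<ge>no. norm ((\<Sum>m<n. w n m * y m) - 0) < e" by blast
qed

section \<open>Characteristic functions of martingale arrays\<close>

text \<open>The martingale conditions are tested against bounded \<open>F m\<close>-measurable
  functions U, so conditional expectations and their null sets do not enter; \<open>c n m\<close>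
  stands for the conditional variance. The filtration carries no row index: one martingale of
  conditional expectations of the test function can then handle all rows at once.\<close>

locale bounded_martingale_array = prob_space M for M :: "'w measure" +
  fixes F :: "nat \<Rightarrow> 'w measure" and \<xi> c :: "nat \<Rightarrow> nat \<Rightarrow> 'w \<Rightarrow> real"
    and B :: "nat \<Rightarrow> nat \<Rightarrow> real" and \<beta> :: "nat \<Rightarrow> real" and K :: real
  assumes subalg: "\<And>m. subalgebra M (F m)"
    and F_mono: "\<And>m. sets (F m) \<subseteq> sets (F (Suc m))"
    and \<xi>_measurable: "\<And>n m. \<xi> n m \<in> borel_measurable (F (Suc m))"
    and c_measurable: "\<And>n m. c n m \<in> borel_measurable (F m)"
    and \<xi>_bound: "\<And>n m \<omega>. \<omega> \<in> space M \<Longrightarrow> \<bar>\<xi> n m \<omega>\<bar> \<le> B n m"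
    and c_range: "\<And>n m \<omega>. \<omega> \<in> space M \<Longrightarrow> c n m \<omega> \<in> {0..(B n m)\<^sup>2}"
    and \<xi>_mean: "\<And>n m U C. U \<in> borel_measurable (F m) \<Longrightarrow> (\<And>\<omega>. \<omega> \<in> space M \<Longrightarrow> \<bar>U \<omega>\<bar> \<le> C) \<Longrightarrow>
      expectation (\<lambda>\<omega>. U \<omega> * \<xi> n m \<omega>) = 0"
    and \<xi>_var: "\<And>n m U C. U \<in> borel_measurable (F m) \<Longrightarrow> (\<And>\<omega>. \<omega> \<in> space M \<Longrightarrow> \<bar>U \<omega>\<bar> \<le> C) \<Longrightarrow>
      expectation (\<lambda>\<omega>. U \<omega> * ((\<xi> n m \<omega>)\<^sup>2 - c n m \<omega>)) = 0"
    and B_sum: "\<And>n. (\<Sum>m<n. (B n m)\<^sup>2) \<le> K"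
    and B_le: "\<And>n m. m < n \<Longrightarrow> B n m \<le> \<beta> n"
    and \<beta>_tendsto: "\<beta> \<longlonglongrightarrow> 0"
begin

lemma B_nonneg: "0 \<le> B n m"
  using \<xi>_bound not_empty by (metis abs_ge_zero all_not_in_conv order_trans)

lemma F_le: "m \<le> k \<Longrightarrow> subalgebra (F k) (F m)"
proof (induction k rule: dec_induct)
  case base
  show ?case by (simp add: subalgebra_def)
next
  case (step k)
  then show ?case using F_mono[of k] subalg[of k] subalg[of "Suc k"] by (auto simp: subalgebra_def)
qed

lemma \<xi>_meas[measurable]: "\<xi> n m \<in> borel_measurable M"
  using measurable_from_subalg[OF subalg \<xi>_measurable] .

lemma c_meas[measurable]: "c n m \<in> borel_measurable M"
  using measurable_from_subalg[OF subalg c_measurable] .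

lemma \<xi>_measurable_le: "m < k \<Longrightarrow> \<xi> n m \<in> borel_measurable (F k)"
  using measurable_from_subalg[OF F_le \<xi>_measurable] by simp

lemma c_measurable_le: "m \<le> k \<Longrightarrow> c n m \<in> borel_measurable (F k)"
  using measurable_from_subalg[OF F_le c_measurable] by simp

definition increment_norm :: "('w \<Rightarrow> real) \<Rightarrow> nat \<Rightarrow> real" where
  "increment_norm G m = sqrt (expectation (\<lambda>\<omega>.
     (clipped_cond_exp M (F (Suc m)) G \<omega> - clipped_cond_exp M (F m) G \<omega>)\<^sup>2))"

lemma increment_norm_nonneg: "0 \<le> increment_norm G m"
  unfolding increment_norm_def by simp

text \<open>With \<open>h m\<close> the second moment of the clipped conditional expectation at time
  m, orthogonality of increments gives the squared norms \<open>h (Suc m) - h m\<close>, which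
  telescope, and h is at most 1. For the second part, G is replaced by its conditional expectation
  at \<open>Suc m\<close>; the one at m can be subtracted because \<open>\<xi>\<close> has mean zero
  given \<open>F m\<close>, and Cauchy-Schwarz finishes.\<close>

lemma increment_norm:
  fixes G :: "'w \<Rightarrow> real"
  assumes G[measurable]: "G \<in> borel_measurable M" and G1: "\<And>\<omega>. \<omega> \<in> space M \<Longrightarrow> \<bar>G \<omega>\<bar> \<le> 1"
  shows summable_increment_norm: "summable (\<lambda>m. (increment_norm G m)\<^sup>2)"
    and abs_expectation_mult_increment_le:
      "U \<in> borel_measurable (F m) \<Longrightarrow> (\<And>\<omega>. \<omega> \<in> space M \<Longrightarrow> \<bar>U \<omega>\<bar> \<le> D) \<Longrightarrow>
       \<bar>expectation (\<lambda>\<omega>. G \<omega> * \<xi> n m \<omega> * U \<omega>)\<bar> \<le> D * B n m * increment_norm G m"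
proof -
  define E where "E m = clipped_cond_exp M (F m) G" for m
  have EF: "E m \<in> borel_measurable (F m)" and E1: "\<bar>E m \<omega>\<bar> \<le> 1" for m \<omega>
    unfolding E_def by (auto intro: abs_clipped_cond_exp_le)
  have Ei: "expectation (\<lambda>\<omega>. f \<omega> * E m \<omega>) = expectation (\<lambda>\<omega>. f \<omega> * G \<omega>)"
    if "f \<in> borel_measurable (F m)" "\<And>\<omega>. \<omega>\<in>space M \<Longrightarrow> \<bar>f \<omega>\<bar> \<le> C" for m f C
    unfolding E_def by (rule integral_clipped_cond_exp[OF subalg G G1 that])
  have EF': "E m \<in> borel_measurable (F (Suc m))" for m
    using measurable_from_subalg[OF F_le EF] by simp
  have [measurable]: "E m \<in> borel_measurable M" for m
    using measurable_from_subalg[OF subalg EF] .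
  have int: "integrable M (\<lambda>\<omega>. E m \<omega> * E k \<omega>)" for m k
    using E1 by (intro integrable_const_bound[where B = 1]) (auto simp: abs_mult mult_le_one)
  define h where "h m = expectation (\<lambda>\<omega>. E m \<omega> * E m \<omega>)" for m
  \<comment> \<open>Both integrals equal that of \<open>E m * G\<close>, since \<open>E m\<close> is
    measurable at either time.\<close>
  have cross: "expectation (\<lambda>\<omega>. E m \<omega> * E (Suc m) \<omega>) = h m" for m
    unfolding h_def using Ei[of "E m" "Suc m", OF EF' E1] Ei[of "E m" m, OF EF E1] by simp
  define q where "q m = expectation (\<lambda>\<omega>. (E (Suc m) \<omega> - E m \<omega>)\<^sup>2)" for m
  have q: "q m = h (Suc m) - h m" for m
  proof -
    have "q m = expectation (\<lambda>\<omega>. E (Suc m) \<omega> * E (Suc m) \<omega> - 2 * (E m \<omega> * E (Suc m) \<omega>) + E m \<omega> * E m \<omega>)"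
      unfolding q_def by (rule Bochner_Integration.integral_cong) (auto simp: power2_eq_square algebra_simps)
    also have "\<dots> = h (Suc m) - 2 * h m + h m"
      using int by (simp add: cross h_def[symmetric])
    finally show ?thesis by simp
  qed
  have q0: "q m \<ge> 0" for m unfolding q_def by simp
  have h1: "h m \<le> 1" for m
  proof -
    have "E m \<omega> * E m \<omega> \<le> 1" for \<omega>
      using E1[of m \<omega>] by (metis abs_ge_zero abs_mult_self_eq mult_le_one)
    then show ?thesis unfolding h_def using integral_mono[OF int integrable_const[of 1]] by (simp add: prob_space)
  qed
  have h0: "h m \<ge> 0" for m unfolding h_def by simp
  have sq: "summable q"
  proof (rule summableI_nonneg_bounded[OF q0])
    fix n show "sum q {..<n} \<le> 1"
      unfolding q by (subst sum_lessThan_telescope) (use h0[of 0] h1[of n] in linarith)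
  qed
  have inc: "increment_norm G m = sqrt (q m)" for m
    unfolding increment_norm_def q_def E_def ..
  show "summable (\<lambda>m. (increment_norm G m)\<^sup>2)" using sq q0 by (simp add: inc)
  show "\<bar>expectation (\<lambda>\<omega>. G \<omega> * \<xi> n m \<omega> * U \<omega>)\<bar> \<le> C * B n m * increment_norm G m"
    if U: "U \<in> borel_measurable (F m)" and UC: "\<And>\<omega>. \<omega> \<in> space M \<Longrightarrow> \<bar>U \<omega>\<bar> \<le> C"
    for n m U and C :: real
  proof -
    have [measurable]: "U \<in> borel_measurable M" using measurable_from_subalg[OF subalg U] .
    have C0: "C \<ge> 0" using UC not_empty by (metis abs_ge_zero all_not_in_conv order_trans)
    have U': "U \<in> borel_measurable (F (Suc m))" using measurable_from_subalg[OF F_le U] by simp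
    have bd: "\<bar>\<xi> n m \<omega> * U \<omega>\<bar> \<le> B n m * C" if "\<omega> \<in> space M" for \<omega>
      unfolding abs_mult using that UC \<xi>_bound[OF that] B_nonneg by (intro mult_mono) auto
    have bd2: "\<bar>U \<omega> * E m \<omega>\<bar> \<le> C" if "\<omega> \<in> space M" for \<omega>
      unfolding abs_mult using mult_mono[of "\<bar>U \<omega>\<bar>" C "\<bar>E m \<omega>\<bar>" 1] that UC E1[of m \<omega>] C0 by auto
    have "(\<lambda>\<omega>. \<xi> n m \<omega> * U \<omega>) \<in> borel_measurable (F (Suc m))"
      using \<xi>_measurable U' by (rule borel_measurable_times)
    from Ei[OF this bd] have "expectation (\<lambda>\<omega>. G \<omega> * \<xi> n m \<omega> * U \<omega>) = expectation (\<lambda>\<omega>. \<xi> n m \<omega> * U \<omega> * E (Suc m) \<omega>)"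
      by (simp add: mult_ac)
    \<comment> \<open>What is subtracted is zero: \<open>U * E m\<close> is a bounded test function
      known at time m.\<close>
    also have "\<dots> = expectation (\<lambda>\<omega>. \<xi> n m \<omega> * U \<omega> * E (Suc m) \<omega>) - expectation (\<lambda>\<omega>. U \<omega> * E m \<omega> * \<xi> n m \<omega>)"
      using \<xi>_mean[OF borel_measurable_times[OF U EF] bd2] by simp
    also have "\<dots> = expectation (\<lambda>\<omega>. \<xi> n m \<omega> * U \<omega> * (E (Suc m) \<omega> - E m \<omega>))"
    proof -
      have "integrable M (\<lambda>\<omega>. \<xi> n m \<omega> * U \<omega> * E k \<omega>)" for k
      proof (rule integrable_const_bound[where B = "B n m * C"])
        show "AE \<omega> in M. norm (\<xi> n m \<omega> * U \<omega> * E k \<omega>) \<le> B n m * C"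
        proof (rule AE_I2)
          fix \<omega> assume w: "\<omega> \<in> space M"
          have "\<bar>\<xi> n m \<omega> * U \<omega>\<bar> * \<bar>E k \<omega>\<bar> \<le> B n m * C * 1"
            using bd[OF w] E1 C0 B_nonneg by (intro mult_mono) auto
          then show "norm (\<xi> n m \<omega> * U \<omega> * E k \<omega>) \<le> B n m * C" by (simp add: abs_mult)
        qed
      qed simp
      then show ?thesis by (subst Bochner_Integration.integral_diff[symmetric]) (auto simp: algebra_simps)
    qed
    finally have eq: "expectation (\<lambda>\<omega>. G \<omega> * \<xi> n m \<omega> * U \<omega>) = expectation (\<lambda>\<omega>. \<xi> n m \<omega> * U \<omega> * (E (Suc m) \<omega> - E m \<omega>))" .
    have E2: "\<bar>E (Suc m) \<omega> - E m \<omega>\<bar> \<le> 2" for \<omega> using E1[of m \<omega>] E1[of "Suc m" \<omega>] by linarith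
    have pw: "\<bar>\<xi> n m \<omega> * U \<omega> * (E (Suc m) \<omega> - E m \<omega>)\<bar> \<le> B n m * C * \<bar>E (Suc m) \<omega> - E m \<omega>\<bar>"
      if "\<omega> \<in> space M" for \<omega>
      using bd[OF that] by (simp add: abs_mult mult_right_mono)
    have "\<bar>expectation (\<lambda>\<omega>. \<xi> n m \<omega> * U \<omega> * (E (Suc m) \<omega> - E m \<omega>))\<bar>
      \<le> expectation (\<lambda>\<omega>. \<bar>\<xi> n m \<omega> * U \<omega> * (E (Suc m) \<omega> - E m \<omega>)\<bar>)" by (rule integral_abs_bound)
    also have "\<dots> \<le> expectation (\<lambda>\<omega>. B n m * C * \<bar>E (Suc m) \<omega> - E m \<omega>\<bar>)"
    proof (rule integral_mono_AE')
      show "integrable M (\<lambda>\<omega>. B n m * C * \<bar>E (Suc m) \<omega> - E m \<omega>\<bar>)"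
        using E2 by (intro integrable_mult_right integrable_const_bound[where B = 2]) auto
    qed (use pw B_nonneg C0 in auto)
    also have "\<dots> = B n m * C * expectation (\<lambda>\<omega>. \<bar>E (Suc m) \<omega> - E m \<omega>\<bar>)" by simp
    also have "\<dots> \<le> B n m * C * sqrt (q m)"
      unfolding q_def using E2 B_nonneg C0 by (intro mult_left_mono expectation_abs_le_sqrt) auto
    finally show ?thesis
      unfolding eq inc by (simp add: mult_ac)
  qed
qed

text \<open>The discrete stochastic exponential of the row. The number k of factors is kept apart
  from the row n, since the partial products, known at time k, become test functions in a
  telescoping sum.\<close>

definition char_prod :: "real \<Rightarrow> nat \<Rightarrow> nat \<Rightarrow> 'w \<Rightarrow> complex" where
  "char_prod t n k \<omega> = (\<Prod>m<k. 1 + \<i> * complex_of_real (t * \<xi> n m \<omega>))"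

definition quad_var :: "nat \<Rightarrow> 'w \<Rightarrow> real" where
  "quad_var n \<omega> = (\<Sum>m<n. (\<xi> n m \<omega>)\<^sup>2)"

definition cond_var :: "nat \<Rightarrow> 'w \<Rightarrow> real" where
  "cond_var n \<omega> = (\<Sum>m<n. c n m \<omega>)"

lemma char_prod_measurable_F: "char_prod t n k \<in> borel_measurable (F k)"
  unfolding char_prod_def by (intro borel_measurable_prod borel_measurable_add borel_measurable_times
      borel_measurable_const measurable_compose[OF _ borel_measurable_of_real] \<xi>_measurable_le) auto

lemma char_prod_meas[measurable]: "char_prod t n k \<in> borel_measurable M"
  using measurable_from_subalg[OF subalg char_prod_measurable_F] .

lemma quad_var_meas[measurable]: "quad_var n \<in> borel_measurable M"
  unfolding quad_var_def by measurable

lemma cond_var_meas[measurable]: "cond_var n \<in> borel_measurable M"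
  unfolding cond_var_def by measurable

lemma quad_var_nonneg: "0 \<le> quad_var n \<omega>"
  unfolding quad_var_def by (intro sum_nonneg) auto

lemma cond_var_nonneg: "\<omega> \<in> space M \<Longrightarrow> 0 \<le> cond_var n \<omega>"
  unfolding cond_var_def using c_range by (intro sum_nonneg) auto

text \<open>The bound is deterministic and uniform over rows and partial products:
  \<open>\<xi>\<close> is dominated pointwise by B, whose squares sum to at most K along a
  row.\<close>

lemma char_prod_bound:
  assumes "\<omega> \<in> space M" "k \<le> n"
  shows "cmod (char_prod t n k \<omega>) \<le> exp (t\<^sup>2 * K / 2)"
proof -
  have "cmod (char_prod t n k \<omega>) \<le> (\<Prod>m<k. exp ((t * \<xi> n m \<omega>)\<^sup>2 / 2))"
    unfolding char_prod_def prod_norm[symmetric] using norm_one_plus_ii_le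
    by (intro prod_mono) (auto simp del: of_real_mult)
  also have "\<dots> = exp (\<Sum>m<k. (t * \<xi> n m \<omega>)\<^sup>2 / 2)" by (simp add: exp_sum)
  also have "(\<Sum>m<k. (t * \<xi> n m \<omega>)\<^sup>2 / 2) \<le> (\<Sum>m<n. (t * B n m)\<^sup>2 / 2)"
  proof (rule order_trans)
    show "(\<Sum>m<k. (t * \<xi> n m \<omega>)\<^sup>2 / 2) \<le> (\<Sum>m<k. (t * B n m)\<^sup>2 / 2)"
      using \<xi>_bound[OF assms(1)] by (intro sum_mono divide_right_mono)
        (auto simp: power_mult_distrib intro!: mult_left_mono abs_le_square_iff[THEN iffD1] intro: order_trans[OF _ abs_ge_self])
    show "(\<Sum>m<k. (t * B n m)\<^sup>2 / 2) \<le> (\<Sum>m<n. (t * B n m)\<^sup>2 / 2)"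
      using assms(2) by (intro sum_mono2) auto
  qed
  also have "\<dots> = t\<^sup>2 * (\<Sum>m<n. (B n m)\<^sup>2) / 2"
    by (simp add: power_mult_distrib sum_distrib_left sum_divide_distrib)
  also have "\<dots> \<le> t\<^sup>2 * K / 2" using B_sum[of n] by (intro divide_right_mono mult_left_mono) auto
  finally show ?thesis by simp
qed

lemma char_prod_weak:
  fixes G :: "'w \<Rightarrow> real"
  assumes G[measurable]: "G \<in> borel_measurable M" and G1: "\<And>\<omega>. \<omega> \<in> space M \<Longrightarrow> \<bar>G \<omega>\<bar> \<le> 1"
  shows "(\<lambda>n. \<integral>\<omega>. of_real (G \<omega>) * (char_prod t n n \<omega> - 1) \<partial>M) \<longlonglongrightarrow> 0"
proof -
  let ?g = "increment_norm G"
  have g: "\<bar>expectation (\<lambda>\<omega>. G \<omega> * \<xi> n m \<omega> * U \<omega>)\<bar> \<le> D * B n m * ?g m"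
    if "U \<in> borel_measurable (F m)" "\<And>\<omega>. \<omega> \<in> space M \<Longrightarrow> \<bar>U \<omega>\<bar> \<le> D" for n m U D
    by (rule increment_norm(2)[OF G G1 that])
  have gs: "summable (\<lambda>m. (?g m)\<^sup>2)"
    by (rule increment_norm(1)[OF G G1])
  define D where "D = exp (t\<^sup>2 * K / 2)"
  have D0: "D > 0" by (simp add: D_def)
  have bound: "norm (\<integral>\<omega>. of_real (G \<omega>) * (char_prod t n n \<omega> - 1) \<partial>M) \<le> 2 * \<bar>t\<bar> * D * (\<Sum>m<n. B n m * ?g m)" for n
  proof -
    \<comment> \<open>Consecutive partial products differ by \<open>\<i> * t * \<xi> n m\<close>
      times the earlier one, which is known at time m and may therefore take the place of U.\<close>
    have tel: "char_prod t n k \<omega> - 1 = (\<Sum>m<k. \<i> * of_real t * (of_real (\<xi> n m \<omega>) * char_prod t n m \<omega>))" for k \<omega>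
      by (induction k) (simp_all add: char_prod_def algebra_simps)
    have int: "integrable M (\<lambda>\<omega>. of_real (G \<omega>) * of_real (\<xi> n m \<omega>) * char_prod t n m \<omega>)" if "m < n" for m
    proof (rule integrable_const_bound[where B = "1 * B n m * D"])
      show "AE \<omega> in M. cmod (of_real (G \<omega>) * of_real (\<xi> n m \<omega>) * char_prod t n m \<omega>) \<le> 1 * B n m * D"
      proof (rule AE_I2)
        fix \<omega> assume "\<omega> \<in> space M"
        then show "cmod (of_real (G \<omega>) * of_real (\<xi> n m \<omega>) * char_prod t n m \<omega>) \<le> 1 * B n m * D"
          unfolding norm_mult norm_of_real D_def using G1 \<xi>_bound char_prod_bound[of \<omega> m n t] that B_nonneg
          by (intro mult_mono mult_nonneg_nonneg) auto
      qed
    qed simp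
    have "(\<integral>\<omega>. of_real (G \<omega>) * (char_prod t n n \<omega> - 1) \<partial>M) =
      (\<integral>\<omega>. (\<Sum>m<n. \<i> * of_real t * (of_real (G \<omega>) * of_real (\<xi> n m \<omega>) * char_prod t n m \<omega>)) \<partial>M)"
      unfolding tel by (simp add: sum_distrib_left mult_ac)
    also have "\<dots> = (\<Sum>m<n. \<i> * of_real t * (\<integral>\<omega>. of_real (G \<omega>) * of_real (\<xi> n m \<omega>) * char_prod t n m \<omega> \<partial>M))"
      using int by (subst Bochner_Integration.integral_sum) auto
    also have "norm \<dots> \<le> (\<Sum>m<n. norm (\<i> * of_real t * (\<integral>\<omega>. of_real (G \<omega>) * of_real (\<xi> n m \<omega>) * char_prod t n m \<omega> \<partial>M)))"
      by (rule norm_sum)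
    also have "\<dots> \<le> (\<Sum>m<n. \<bar>t\<bar> * (2 * D * B n m * ?g m))"
    proof (rule sum_mono)
      fix m assume "m \<in> {..<n}"
      then have m: "m < n" by simp
      \<comment> \<open>The tested estimate is for real U, so real and imaginary parts are treated
        separately; hence the factor 2.\<close>
      have U: "(\<lambda>\<omega>. Re (char_prod t n m \<omega>)) \<in> borel_measurable (F m)" "(\<lambda>\<omega>. Im (char_prod t n m \<omega>)) \<in> borel_measurable (F m)"
        using char_prod_measurable_F by (auto intro: borel_measurable_Re borel_measurable_Im measurable_compose)
      let ?I = "\<integral>\<omega>. of_real (G \<omega>) * of_real (\<xi> n m \<omega>) * char_prod t n m \<omega> \<partial>M"
      have "\<bar>Re ?I\<bar> \<le> D * B n m * ?g m"
        using g[OF U(1), of D n] char_prod_bound[of _ m n t] m abs_Re_le_cmod int[OF m]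
        by (subst integral_Re[symmetric]) (auto simp: D_def mult_ac intro: order_trans)
      moreover have "\<bar>Im ?I\<bar> \<le> D * B n m * ?g m"
        using g[OF U(2), of D n] char_prod_bound[of _ m n t] m abs_Im_le_cmod int[OF m]
        by (subst integral_Im[symmetric]) (auto simp: D_def mult_ac intro: order_trans)
      ultimately have "cmod ?I \<le> 2 * D * B n m * ?g m"
        using cmod_le[of ?I] by linarith
      then show "norm (\<i> * of_real t * ?I) \<le> \<bar>t\<bar> * (2 * D * B n m * ?g m)"
        by (simp add: norm_mult mult_left_mono)
    qed
    also have "\<dots> = 2 * \<bar>t\<bar> * D * (\<Sum>m<n. B n m * ?g m)"
      by (simp add: sum_distrib_left mult_ac)
    finally show ?thesis .
  qed
  have "(\<lambda>n. 2 * \<bar>t\<bar> * D * (\<Sum>m<n. B n m * ?g m)) \<longlonglongrightarrow> 2 * \<bar>t\<bar> * D * 0"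
    by (intro tendsto_mult_left weighted_sum_tendsto_0[OF _ B_le \<beta>_tendsto B_sum
        increment_norm_nonneg gs] B_nonneg)
  then show ?thesis using bound by (intro Lim_null_comparison[OF eventuallyI[OF bound]]) simp
qed

text \<open>All but two factors are bounded by the row maximum, which tends to 0. The absolute value
  covers a negative \<open>\<beta> n\<close> in the empty row.\<close>

lemma B_power_sum_tendsto_0:
  assumes "p > 2"
  shows "(\<lambda>n. \<Sum>m<n. (B n m) ^ p) \<longlonglongrightarrow> 0"
proof (rule Lim_null_comparison)
  show "\<forall>\<^sub>F n in sequentially. norm (\<Sum>m<n. (B n m) ^ p) \<le> \<bar>\<beta> n\<bar> ^ (p - 2) * K"
  proof (rule eventuallyI)
    fix n
    have "norm (\<Sum>m<n. (B n m) ^ p) = (\<Sum>m<n. (B n m) ^ p)"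
      using B_nonneg by (simp add: sum_nonneg)
    also have "\<dots> \<le> (\<Sum>m<n. \<bar>\<beta> n\<bar> ^ (p - 2) * (B n m)\<^sup>2)"
    proof (rule sum_mono)
      fix m assume "m \<in> {..<n}"
      then have "B n m \<le> \<bar>\<beta> n\<bar>" using B_le[of m n] by simp
      then have "B n m ^ (p - 2) * (B n m)\<^sup>2 \<le> \<bar>\<beta> n\<bar> ^ (p - 2) * (B n m)\<^sup>2"
        using B_nonneg by (intro mult_right_mono power_mono) auto
      moreover have "B n m ^ p = B n m ^ (p - 2) * (B n m)\<^sup>2"
        using assms by (metis le_add_diff_inverse2 less_imp_le power_add)
      ultimately show "B n m ^ p \<le> \<bar>\<beta> n\<bar> ^ (p - 2) * (B n m)\<^sup>2" by simp
    qed
    also have "\<dots> \<le> \<bar>\<beta> n\<bar> ^ (p - 2) * K"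
      using B_sum[of n] by (simp add: sum_distrib_left[symmetric] mult_left_mono)
    finally show "norm (\<Sum>m<n. (B n m) ^ p) \<le> \<bar>\<beta> n\<bar> ^ (p - 2) * K" .
  qed
  have "(\<lambda>n. \<bar>\<beta> n\<bar> ^ (p - 2) * K) \<longlonglongrightarrow> \<bar>0\<bar> ^ (p - 2) * K"
    using \<beta>_tendsto by (intro tendsto_intros)
  then show "(\<lambda>n. \<bar>\<beta> n\<bar> ^ (p - 2) * K) \<longlonglongrightarrow> 0" using assms by (simp add: power_0_left)
qed

text \<open>The differences \<open>(\<xi> n m)\<^sup>2 - c n m\<close> are orthogonal and bounded by
  \<open>(B n m)\<^sup>2\<close>, so the second moment of their sum is at most the row sum of the
  fourth powers of B, which vanishes.\<close>

lemma quad_var_minus_cond_var_L1: "(\<lambda>n. expectation (\<lambda>\<omega>. \<bar>quad_var n \<omega> - cond_var n \<omega>\<bar>)) \<longlonglongrightarrow> 0"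
proof -
  define \<eta> where "\<eta> n m \<omega> = (\<xi> n m \<omega>)\<^sup>2 - c n m \<omega>" for n m \<omega>
  have [measurable]: "\<eta> n m \<in> borel_measurable M" for n m unfolding \<eta>_def by measurable
  \<comment> \<open>Both terms of the difference lie between 0 and \<open>(B n m)\<^sup>2\<close>,
    hence no factor 2.\<close>
  have \<eta>_bound: "\<bar>\<eta> n m \<omega>\<bar> \<le> (B n m)\<^sup>2" if "\<omega> \<in> space M" for n m \<omega>
  proof -
    have "(\<xi> n m \<omega>)\<^sup>2 \<le> (B n m)\<^sup>2"
      using \<xi>_bound[OF that, of n m] B_nonneg[of n m] by (simp add: abs_le_square_iff[symmetric])
    then show ?thesis using c_range[OF that, of n m] zero_le_power2[of "\<xi> n m \<omega>"] unfolding \<eta>_def abs_le_iff atLeastAtMost_iff by linarith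
  qed
  define R where "R n k \<omega> = (\<Sum>m<k. \<eta> n m \<omega>)" for n k \<omega>
  have [measurable]: "R n k \<in> borel_measurable M" for n k unfolding R_def by measurable
  have R_F: "R n k \<in> borel_measurable (F k)" for n k
    unfolding R_def \<eta>_def
    by (intro borel_measurable_sum borel_measurable_diff borel_measurable_power \<xi>_measurable_le c_measurable_le) auto
  have R_bound: "\<bar>R n k \<omega>\<bar> \<le> (\<Sum>m<k. (B n m)\<^sup>2)" if "\<omega> \<in> space M" for n k \<omega>
    unfolding R_def by (rule order_trans[OF sum_abs]) (intro sum_mono \<eta>_bound that)
  have int: "integrable M f" if "f \<in> borel_measurable M" "\<And>\<omega>. \<omega> \<in> space M \<Longrightarrow> \<bar>f \<omega>\<bar> \<le> D" for f :: "'w \<Rightarrow> real" and D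
    using that by (intro integrable_const_bound[where B = D]) auto
  have sq: "expectation (\<lambda>\<omega>. (R n k \<omega>)\<^sup>2) \<le> (\<Sum>m<k. (B n m) ^ 4)" for n k
  proof (induction k)
    case (Suc k)
    define D where "D = (\<Sum>m<k. (B n m)\<^sup>2)"
    have D0: "D \<ge> 0" unfolding D_def by (intro sum_nonneg) auto
    have R2: "integrable M (\<lambda>\<omega>. (R n k \<omega>)\<^sup>2)"
      using R_bound[of _ n k] D0 by (intro int[of _ "D\<^sup>2"]) (auto simp: D_def abs_le_square_iff[symmetric])
    have e2: "\<bar>(\<eta> n k \<omega>)\<^sup>2\<bar> \<le> ((B n k)\<^sup>2)\<^sup>2" if "\<omega> \<in> space M" for \<omega>
      using power_mono[OF \<eta>_bound[OF that, of n k] abs_ge_zero, of 2] by simp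
    have E2: "integrable M (\<lambda>\<omega>. (\<eta> n k \<omega>)\<^sup>2)"
      using e2 by (intro int[of _ "((B n k)\<^sup>2)\<^sup>2"]) auto
    have RE: "integrable M (\<lambda>\<omega>. R n k \<omega> * \<eta> n k \<omega>)"
      using R_bound[of _ n k] \<eta>_bound[of _ n k] D0 
      by (intro int[of _ "D * (B n k)\<^sup>2"]) (auto simp: D_def abs_mult intro!: mult_mono)
    have "expectation (\<lambda>\<omega>. (R n (Suc k) \<omega>)\<^sup>2) = expectation (\<lambda>\<omega>. (R n k \<omega>)\<^sup>2 + 2 * (R n k \<omega> * \<eta> n k \<omega>) + (\<eta> n k \<omega>)\<^sup>2)"
      by (simp add: R_def power2_eq_square algebra_simps)
    also have "\<dots> = expectation (\<lambda>\<omega>. (R n k \<omega>)\<^sup>2) + 2 * expectation (\<lambda>\<omega>. R n k \<omega> * \<eta> n k \<omega>) + expectation (\<lambda>\<omega>. (\<eta> n k \<omega>)\<^sup>2)"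
      using R2 E2 RE by simp
    also have "expectation (\<lambda>\<omega>. R n k \<omega> * \<eta> n k \<omega>) = 0"
      unfolding \<eta>_def using R_bound by (intro \<xi>_var[OF R_F]) auto
    also have "expectation (\<lambda>\<omega>. (\<eta> n k \<omega>)\<^sup>2) \<le> expectation (\<lambda>\<omega>. ((B n k)\<^sup>2)\<^sup>2)"
      using e2 by (intro integral_mono_AE E2) auto
    also have "\<dots> = (B n k) ^ 4" by (simp add: prob_space)
    finally show ?case using Suc by simp
  qed (simp add: R_def)
  have VC: "quad_var n \<omega> - cond_var n \<omega> = R n n \<omega>" for n \<omega>
    by (simp add: quad_var_def cond_var_def R_def \<eta>_def sum_subtractf)
  have "(\<lambda>n. sqrt (\<Sum>m<n. (B n m) ^ 4)) \<longlonglongrightarrow> sqrt 0"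
    by (intro tendsto_intros B_power_sum_tendsto_0) simp
  then have lim: "(\<lambda>n. sqrt (\<Sum>m<n. (B n m) ^ 4)) \<longlonglongrightarrow> 0" by simp
  show ?thesis
  proof (rule Lim_null_comparison[OF eventuallyI lim])
    fix n
    have "expectation (\<lambda>\<omega>. \<bar>R n n \<omega>\<bar>) \<le> sqrt (expectation (\<lambda>\<omega>. (R n n \<omega>)\<^sup>2))"
      by (rule expectation_abs_le_sqrt[OF _ R_bound]) auto
    also have "\<dots> \<le> sqrt (\<Sum>m<n. (B n m) ^ 4)" using sq by simp
    finally show "norm (expectation (\<lambda>\<omega>. \<bar>quad_var n \<omega> - cond_var n \<omega>\<bar>)) \<le> sqrt (\<Sum>m<n. (B n m) ^ 4)"
      by (simp add: VC)
  qed
qed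

text \<open>Each factor \<open>(1 + \<i> * x) * exp (- x\<^sup>2 / 2)\<close>, like
  \<open>iexp x\<close>, has modulus at most 1; the difference of the two products is therefore at
  most the sum of the differences of the factors, each cubic in B.\<close>

lemma norm_iexp_minus_char_prod_le:
  assumes "\<omega> \<in> space M"
  shows "cmod (iexp (t * (\<Sum>m<n. \<xi> n m \<omega>)) - char_prod t n n \<omega> * of_real (exp (- (t\<^sup>2) * quad_var n \<omega> / 2)))
    \<le> 2 * \<bar>t\<bar> ^ 3 * (\<Sum>m<n. (B n m) ^ 3)"
proof -
  let ?x = "\<lambda>m. t * \<xi> n m \<omega>"
  let ?w = "\<lambda>m. (1 + \<i> * complex_of_real (?x m)) * of_real (exp (- ((?x m)\<^sup>2) / 2))"
  have e: "iexp (t * (\<Sum>m<n. \<xi> n m \<omega>)) = (\<Prod>m<n. iexp (?x m))"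
    by (simp add: exp_sum[symmetric] sum_distrib_left)
  have w: "char_prod t n n \<omega> * of_real (exp (- (t\<^sup>2) * quad_var n \<omega> / 2)) = (\<Prod>m<n. ?w m)"
  proof -
    have "- (t\<^sup>2) * quad_var n \<omega> / 2 = (\<Sum>m<n. - ((?x m)\<^sup>2) / 2)"
      by (simp add: quad_var_def sum_distrib_left sum_divide_distrib power_mult_distrib sum_negf)
    then have "exp (- (t\<^sup>2) * quad_var n \<omega> / 2) = (\<Prod>m<n. exp (- ((?x m)\<^sup>2) / 2))"
      by (simp only: exp_sum finite_lessThan)
    then show ?thesis unfolding char_prod_def prod.distrib by (simp only: of_real_prod)
  qed
  have "norm (?w m) \<le> exp ((?x m)\<^sup>2 / 2) * exp (- ((?x m)\<^sup>2) / 2)" for m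
    unfolding norm_mult using norm_one_plus_ii_le[of "?x m"] by (intro mult_mono) auto
  then have w1: "norm (?w m) \<le> 1" for m by (simp flip: exp_add)
  have "cmod (iexp (t * (\<Sum>m<n. \<xi> n m \<omega>)) - char_prod t n n \<omega> * of_real (exp (- (t\<^sup>2) * quad_var n \<omega> / 2)))
     \<le> (\<Sum>m<n. norm (iexp (?x m) - ?w m))"
    unfolding e w by (rule norm_prod_diff) (use w1 in auto)
  also have "\<dots> \<le> (\<Sum>m<n. 2 * \<bar>t\<bar> ^ 3 * (B n m) ^ 3)"
  proof (rule sum_mono)
    fix m
    have "norm (iexp (?x m) - ?w m) \<le> 2 * \<bar>?x m\<bar> ^ 3"
      using norm_iexp_minus_factor_le[of "?x m"] by (simp add: exp_of_real[symmetric])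
    also have "\<dots> = 2 * \<bar>t\<bar> ^ 3 * \<bar>\<xi> n m \<omega>\<bar> ^ 3" by (simp add: abs_mult power_mult_distrib)
    also have "\<dots> \<le> 2 * \<bar>t\<bar> ^ 3 * (B n m) ^ 3"
      using \<xi>_bound[OF assms] by (intro mult_left_mono power_mono) auto
    finally show "norm (iexp (?x m) - ?w m) \<le> 2 * \<bar>t\<bar> ^ 3 * (B n m) ^ 3" .
  qed
  finally show ?thesis by (simp add: sum_distrib_left)
qed

text \<open>Three replacements under the integral: the exponential by the product times a Gaussian
  correction in the quadratic variation, the quadratic variation by the conditional variance, and
  that by S. What remains is the product tested against
  \<open>G * exp (- t\<^sup>2 * S / 2)\<close>. The arbitrary bounded test functions of
  \<open>char_prod_weak\<close> pay off here, as S need not be measurable at any finite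
  time.\<close>

lemma char_tendsto:
  fixes G S :: "'w \<Rightarrow> real"
  assumes G[measurable]: "G \<in> borel_measurable M" and G1: "\<And>\<omega>. \<omega> \<in> space M \<Longrightarrow> \<bar>G \<omega>\<bar> \<le> 1"
    and S[measurable]: "S \<in> borel_measurable M" and S0: "\<And>\<omega>. \<omega> \<in> space M \<Longrightarrow> 0 \<le> S \<omega>"
    and lim: "AE \<omega> in M. (\<lambda>n. cond_var n \<omega>) \<longlonglongrightarrow> S \<omega>"
  shows "(\<lambda>n. \<integral>\<omega>. of_real (G \<omega>) * iexp (t * (\<Sum>m<n. \<xi> n m \<omega>)) \<partial>M)
     \<longlonglongrightarrow> (\<integral>\<omega>. of_real (G \<omega> * exp (- (t\<^sup>2) * S \<omega> / 2)) \<partial>M)"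
proof -
  define D where "D = exp (t\<^sup>2 * K / 2)"
  define e where "e x = exp (- (t\<^sup>2) * x / 2)" for x :: real
  have [measurable]: "e \<in> borel_measurable borel" unfolding e_def by measurable
  have e1: "0 < e x" "x \<ge> 0 \<Longrightarrow> e x \<le> 1" for x unfolding e_def by auto
  have e_diff: "\<bar>e x - e y\<bar> \<le> 1" if "0 \<le> x" "0 \<le> y" for x y
    using e1(1)[of x] e1(1)[of y] e1(2)[OF that(1)] e1(2)[OF that(2)] by linarith
  have e_lip: "\<bar>e x - e y\<bar> \<le> t\<^sup>2 / 2 * \<bar>x - y\<bar>" if "0 \<le> x" "0 \<le> y" for x y
    using exp_minus_lipschitz[of "t\<^sup>2 * x / 2" "t\<^sup>2 * y / 2"] that
    by (simp add: e_def abs_mult flip: right_diff_distrib diff_divide_distrib)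
  have VC_int: "integrable M (quad_var n)" "integrable M (cond_var n)" for n
  proof -
    have "\<bar>quad_var n \<omega>\<bar> \<le> K" if "\<omega> \<in> space M" for \<omega>
    proof -
      have "quad_var n \<omega> \<le> (\<Sum>m<n. (B n m)\<^sup>2)" unfolding quad_var_def
        using \<xi>_bound[OF that] B_nonneg by (intro sum_mono) (simp add: abs_le_square_iff[symmetric])
      then show ?thesis using B_sum[of n] quad_var_nonneg[of n \<omega>] by simp
    qed
    then show "integrable M (quad_var n)" by (intro integrable_const_bound[where B = K]) auto
    have "\<bar>cond_var n \<omega>\<bar> \<le> K" if "\<omega> \<in> space M" for \<omega>
    proof -
      have "cond_var n \<omega> \<le> (\<Sum>m<n. (B n m)\<^sup>2)" unfolding cond_var_def
        using c_range[OF that] by (intro sum_mono) auto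
      then show ?thesis using B_sum[of n] cond_var_nonneg[OF that, of n] by simp
    qed
    then show "integrable M (cond_var n)" by (intro integrable_const_bound[where B = K]) auto
  qed
  \<comment> \<open>Pointwise majorant of the replacement errors: the cubic sum, then the bound D of
    the product times the two errors in the Gaussian correction.\<close>
  define P where "P n \<omega> = 2 * \<bar>t\<bar> ^ 3 * (\<Sum>m<n. (B n m) ^ 3) + D * (t\<^sup>2 / 2 * \<bar>quad_var n \<omega> - cond_var n \<omega>\<bar> + \<bar>e (cond_var n \<omega>) - e (S \<omega>)\<bar>)" for n \<omega>
  have D0: "D > 0" by (simp add: D_def)
  have eCS_int: "integrable M (\<lambda>\<omega>. \<bar>e (cond_var n \<omega>) - e (S \<omega>)\<bar>)" for n
    using e_diff S0 cond_var_nonneg by (intro integrable_const_bound[where B = 1] AE_I2) auto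
  have P_int: "integrable M (P n)" for n
    unfolding P_def using VC_int[of n] eCS_int[of n] by auto
  have eq1: "(\<lambda>n. expectation (\<lambda>\<omega>. \<bar>e (cond_var n \<omega>) - e (S \<omega>)\<bar>)) \<longlonglongrightarrow> expectation (\<lambda>\<omega>. 0)"
  proof (rule integral_dominated_convergence[where w = "\<lambda>_. 1"])
    show "AE \<omega> in M. (\<lambda>n. \<bar>e (cond_var n \<omega>) - e (S \<omega>)\<bar>) \<longlonglongrightarrow> 0"
      using lim
    proof eventually_elim
      case (elim \<omega>)
      have "(\<lambda>n. \<bar>e (cond_var n \<omega>) - e (S \<omega>)\<bar>) \<longlonglongrightarrow> \<bar>e (S \<omega>) - e (S \<omega>)\<bar>"
        unfolding e_def by (intro tendsto_intros elim) simp
      then show ?case by simp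
    qed
    show "AE \<omega> in M. norm \<bar>e (cond_var n \<omega>) - e (S \<omega>)\<bar> \<le> 1" for n
      using e_diff S0 cond_var_nonneg by (intro AE_I2) auto
  qed auto
  have P_lim: "(\<lambda>n. expectation (P n)) \<longlonglongrightarrow> 0"
  proof -
    have "expectation (P n) = 2 * \<bar>t\<bar> ^ 3 * (\<Sum>m<n. (B n m) ^ 3) +
        D * (t\<^sup>2 / 2 * expectation (\<lambda>\<omega>. \<bar>quad_var n \<omega> - cond_var n \<omega>\<bar>) + expectation (\<lambda>\<omega>. \<bar>e (cond_var n \<omega>) - e (S \<omega>)\<bar>))" for n
      unfolding P_def using VC_int[of n] eCS_int[of n] by (simp add: prob_space)
    moreover have "(\<lambda>n. 2 * \<bar>t\<bar> ^ 3 * (\<Sum>m<n. (B n m) ^ 3) +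
        D * (t\<^sup>2 / 2 * expectation (\<lambda>\<omega>. \<bar>quad_var n \<omega> - cond_var n \<omega>\<bar>) + expectation (\<lambda>\<omega>. \<bar>e (cond_var n \<omega>) - e (S \<omega>)\<bar>)))
      \<longlonglongrightarrow> 2 * \<bar>t\<bar> ^ 3 * 0 + D * (t\<^sup>2 / 2 * 0 + expectation (\<lambda>\<omega>. 0))"
      by (intro tendsto_intros eq1 quad_var_minus_cond_var_L1 B_power_sum_tendsto_0) simp
    ultimately show ?thesis by simp
  qed
  let ?Y = "\<lambda>n \<omega>. iexp (t * (\<Sum>m<n. \<xi> n m \<omega>))"
  have pw: "cmod (of_real (G \<omega>) * ?Y n \<omega> - of_real (G \<omega> * e (S \<omega>)) * char_prod t n n \<omega>) \<le> P n \<omega>" if \<omega>: "\<omega> \<in> space M" for n \<omega>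
  proof -
    have "of_real (G \<omega>) * ?Y n \<omega> - of_real (G \<omega> * e (S \<omega>)) * char_prod t n n \<omega> =
       of_real (G \<omega>) * ((?Y n \<omega> - char_prod t n n \<omega> * of_real (e (quad_var n \<omega>))) + char_prod t n n \<omega> * of_real ((e (quad_var n \<omega>) - e (cond_var n \<omega>)) + (e (cond_var n \<omega>) - e (S \<omega>))))"
      by (simp add: algebra_simps)
    also have "cmod \<dots> \<le> 1 * (2 * \<bar>t\<bar> ^ 3 * (\<Sum>m<n. (B n m) ^ 3) + D * (t\<^sup>2 / 2 * \<bar>quad_var n \<omega> - cond_var n \<omega>\<bar> + \<bar>e (cond_var n \<omega>) - e (S \<omega>)\<bar>))"
      unfolding norm_mult
    proof (intro mult_mono order_trans[OF norm_triangle_ineq] add_mono)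
      show "cmod (?Y n \<omega> - char_prod t n n \<omega> * of_real (e (quad_var n \<omega>))) \<le> 2 * \<bar>t\<bar> ^ 3 * (\<Sum>m<n. (B n m) ^ 3)"
        unfolding e_def by (rule norm_iexp_minus_char_prod_le[OF \<omega>])
      show "cmod (char_prod t n n \<omega> * of_real ((e (quad_var n \<omega>) - e (cond_var n \<omega>)) + (e (cond_var n \<omega>) - e (S \<omega>))))
        \<le> D * (t\<^sup>2 / 2 * \<bar>quad_var n \<omega> - cond_var n \<omega>\<bar> + \<bar>e (cond_var n \<omega>) - e (S \<omega>)\<bar>)"
        unfolding norm_mult norm_of_real
      proof (intro mult_mono order_trans[OF abs_triangle_ineq] add_mono)
        show "\<bar>e (quad_var n \<omega>) - e (cond_var n \<omega>)\<bar> \<le> t\<^sup>2 / 2 * \<bar>quad_var n \<omega> - cond_var n \<omega>\<bar>"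
          by (rule e_lip[OF quad_var_nonneg cond_var_nonneg[OF \<omega>]])
      qed (use char_prod_bound[OF \<omega>] in \<open>auto simp: D_def\<close>)
    qed (use G1[OF \<omega>] in auto)
    finally show ?thesis by (simp add: P_def)
  qed
  have bd1: "integrable M (\<lambda>\<omega>. of_real (G \<omega>) * ?Y n \<omega>)" for n
    using G1 by (intro integrable_const_bound[where B = 1]) (auto simp: norm_mult)
  have Ge: "\<bar>G \<omega> * e (S \<omega>)\<bar> \<le> 1" if "\<omega> \<in> space M" for \<omega>
    using G1[OF that] e1(2)[OF S0[OF that]] e1(1)[of "S \<omega>"] by (simp add: abs_mult mult_le_one)
  have GeT: "integrable M (\<lambda>\<omega>. of_real (G \<omega> * e (S \<omega>)) * char_prod t n n \<omega>)" for n
  proof (rule integrable_const_bound[where B = "1 * D"])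
    show "AE \<omega> in M. cmod (of_real (G \<omega> * e (S \<omega>)) * char_prod t n n \<omega>) \<le> 1 * D"
      unfolding norm_mult[of "of_real _"] norm_of_real using Ge char_prod_bound D0
      by (intro AE_I2 mult_mono) (auto simp: D_def)
  qed simp
  have GeI: "integrable M (\<lambda>\<omega>. complex_of_real (G \<omega> * e (S \<omega>)))"
    using Ge by (intro integrable_const_bound[where B = 1]) (auto simp del: of_real_mult)
  let ?L = "\<integral>\<omega>. complex_of_real (G \<omega> * e (S \<omega>)) \<partial>M"
  have d1: "(\<lambda>n. (\<integral>\<omega>. of_real (G \<omega>) * ?Y n \<omega> \<partial>M) - (\<integral>\<omega>. of_real (G \<omega> * e (S \<omega>)) * char_prod t n n \<omega> \<partial>M)) \<longlonglongrightarrow> 0"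
  proof (rule Lim_null_comparison[OF eventuallyI P_lim])
    fix n
    have "(\<integral>\<omega>. of_real (G \<omega>) * ?Y n \<omega> \<partial>M) - (\<integral>\<omega>. of_real (G \<omega> * e (S \<omega>)) * char_prod t n n \<omega> \<partial>M) =
      (\<integral>\<omega>. of_real (G \<omega>) * ?Y n \<omega> - of_real (G \<omega> * e (S \<omega>)) * char_prod t n n \<omega> \<partial>M)"
      using bd1 GeT by (rule Bochner_Integration.integral_diff[symmetric])
    also have "norm \<dots> \<le> expectation (P n)"
      using pw by (intro integral_norm_le_integral P_int Bochner_Integration.integrable_diff bd1 GeT) auto
    finally show "norm ((\<integral>\<omega>. of_real (G \<omega>) * ?Y n \<omega> \<partial>M) - (\<integral>\<omega>. of_real (G \<omega> * e (S \<omega>)) * char_prod t n n \<omega> \<partial>M)) \<le> expectation (P n)" .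
  qed
  have d2: "(\<lambda>n. (\<integral>\<omega>. of_real (G \<omega> * e (S \<omega>)) * char_prod t n n \<omega> \<partial>M) - ?L) \<longlonglongrightarrow> 0"
  proof -
    have "(\<integral>\<omega>. of_real (G \<omega> * e (S \<omega>)) * char_prod t n n \<omega> \<partial>M) - ?L = (\<integral>\<omega>. of_real (G \<omega> * e (S \<omega>)) * (char_prod t n n \<omega> - 1) \<partial>M)" for n
      by (subst Bochner_Integration.integral_diff[symmetric, OF GeT GeI]) (simp add: algebra_simps)
    then show ?thesis using char_prod_weak[of "\<lambda>\<omega>. G \<omega> * e (S \<omega>)" t] Ge by simp
  qed
  have "(\<lambda>n. (\<integral>\<omega>. of_real (G \<omega>) * ?Y n \<omega> \<partial>M) - ?L) \<longlonglongrightarrow> 0"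
    using tendsto_add[OF d1 d2] by simp
  then show ?thesis unfolding e_def by (rule LIM_zero_cancel)
qed

end

section \<open>From characteristic functions to stable convergence\<close>

text \<open>The measure \<open>\<mu>\<close> is the law of \<open>sqrt S\<close> times an
  independent standard normal variable. It turns the random kernel into one distribution on the
  reals, to which Levy's theorem applies; its characteristic function and integrals follow by
  Fubini.\<close>

lemma char_normal_mixture:
  fixes S :: "'a \<Rightarrow> real" and f :: "real \<Rightarrow> real"
  assumes "prob_space N" and S[measurable]: "S \<in> borel_measurable N"
    and S0: "\<And>\<omega>. \<omega> \<in> space N \<Longrightarrow> 0 \<le> S \<omega>"
  defines "\<mu> \<equiv> distr (N \<Otimes>\<^sub>M std_normal_distribution) borel (\<lambda>(\<omega>, x). sqrt (S \<omega>) * x)"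
  shows "real_distribution \<mu>"
    and "char \<mu> t = (\<integral>\<omega>. of_real (exp (- (t\<^sup>2) * S \<omega> / 2)) \<partial>N)"
    and "continuous_on UNIV f \<Longrightarrow> (\<And>x. \<bar>f x\<bar> \<le> b) \<Longrightarrow>
      (\<integral>x. f x \<partial>\<mu>) = (\<integral>\<omega>. (\<integral>x. f x \<partial>centered_normal (S \<omega>)) \<partial>N)"
proof -
  interpret N: prob_space N by fact
  interpret sn: prob_space std_normal_distribution by (rule prob_space_normal_density) simp
  interpret pair: pair_prob_space N std_normal_distribution ..
  have [measurable]: "(\<lambda>(\<omega>, x). sqrt (S \<omega>) * x) \<in> borel_measurable (N \<Otimes>\<^sub>M std_normal_distribution)"
    by measurable
  show "real_distribution \<mu>"
    unfolding \<mu>_def real_distribution_def real_distribution_axioms_def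
    by (auto intro: pair.prob_space_distr)
  have fub: "(\<integral>x. g x \<partial>\<mu>) = (\<integral>\<omega>. (\<integral>x. g (sqrt (S \<omega>) * x) \<partial>std_normal_distribution) \<partial>N)"
    if g[measurable]: "g \<in> borel_measurable borel" and b: "\<And>x. norm (g x) \<le> b" 
    for g :: "real \<Rightarrow> 'b :: {banach, second_countable_topology}" and b
  proof -
    have "(\<integral>x. g x \<partial>\<mu>) = (\<integral>p. g (case p of (\<omega>, x) \<Rightarrow> sqrt (S \<omega>) * x) \<partial>(N \<Otimes>\<^sub>M std_normal_distribution))"
      unfolding \<mu>_def by (rule integral_distr) auto
    also have "\<dots> = (\<integral>\<omega>. (\<integral>x. g (case (\<omega>, x) of (\<omega>, x) \<Rightarrow> sqrt (S \<omega>) * x) \<partial>std_normal_distribution) \<partial>N)"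
      by (rule pair.integral_fst'[symmetric]) (intro pair.integrable_const_bound[where B = b], use b in auto)
    finally show ?thesis by simp
  qed
  have "char \<mu> t = (\<integral>\<omega>. (\<integral>x. iexp (t * (sqrt (S \<omega>) * x)) \<partial>std_normal_distribution) \<partial>N)"
    unfolding char_def by (rule fub[of _ 1]) auto
  also have "\<dots> = (\<integral>\<omega>. char std_normal_distribution (t * sqrt (S \<omega>)) \<partial>N)"
    unfolding char_def by (simp add: mult_ac)
  also have "\<dots> = (\<integral>\<omega>. of_real (exp (- (t\<^sup>2) * S \<omega> / 2)) \<partial>N)"
    using S0 by (intro Bochner_Integration.integral_cong) (auto simp: char_std_normal_distribution power_mult_distrib)
  finally show "char \<mu> t = (\<integral>\<omega>. of_real (exp (- (t\<^sup>2) * S \<omega> / 2)) \<partial>N)" .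
  show "(\<integral>x. f x \<partial>\<mu>) = (\<integral>\<omega>. (\<integral>x. f x \<partial>centered_normal (S \<omega>)) \<partial>N)"
    if f: "continuous_on UNIV f" and b: "\<And>x. \<bar>f x\<bar> \<le> b"
  proof -
    have [measurable]: "f \<in> borel_measurable borel" using f by (rule borel_measurable_continuous_onI)
    show ?thesis
      unfolding centered_normal_def using fub[of f b] b by (simp add: integral_distr)
  qed
qed

lemma integral_uniform_measure:
  fixes f :: "'a \<Rightarrow> 'b :: {banach, second_countable_topology}"
  assumes [measurable]: "H \<in> sets M" "f \<in> borel_measurable M" and "emeasure M H \<noteq> 0" "emeasure M H \<noteq> \<infinity>"
  shows "(\<integral>\<omega>. f \<omega> \<partial>uniform_measure M H) = (\<integral>\<omega>. indicator H \<omega> *\<^sub>R f \<omega> \<partial>M) /\<^sub>R measure M H"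
proof -
  have e: "emeasure M H = ennreal (measure M H)" and pos: "measure M H > 0"
    using assms by (simp_all add: emeasure_eq_ennreal_measure zero_less_measure_iff)
  have "uniform_measure M H = density M (\<lambda>\<omega>. ennreal (indicator H \<omega> / measure M H))"
    unfolding uniform_measure_def e using pos
    by (intro density_cong) (auto simp: divide_ennreal[symmetric] indicator_def)
  then have "(\<integral>\<omega>. f \<omega> \<partial>uniform_measure M H) = (\<integral>\<omega>. (indicator H \<omega> / measure M H) *\<^sub>R f \<omega> \<partial>M)"
    by (simp add: integral_density)
  also have "\<dots> = (\<integral>\<omega>. inverse (measure M H) *\<^sub>R (indicator H \<omega> *\<^sub>R f \<omega>) \<partial>M)"
    by (simp add: divide_inverse mult.commute)
  also have "\<dots> = inverse (measure M H) *\<^sub>R (\<integral>\<omega>. indicator H \<omega> *\<^sub>R f \<omega> \<partial>M)"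
    by (rule integral_scaleR_right)
  finally show ?thesis .
qed

text \<open>Once H is fixed, the claim is ordinary weak convergence of the laws under the measure
  conditioned on H, towards a normal variance mixture, and Levy's continuity theorem concludes.
  Normalising by the probability of H only divides by a positive constant.\<close>

lemma (in prob_space) stably_converges_normalI:
  assumes Y[measurable]: "\<And>n. Y n \<in> borel_measurable M" and S[measurable]: "S \<in> borel_measurable M"
    and S0: "\<And>\<omega>. \<omega> \<in> space M \<Longrightarrow> 0 \<le> S \<omega>"
    and char: "\<And>H t. H \<in> sets M \<Longrightarrow> (\<lambda>n. \<integral>\<omega>. of_real (indicator H \<omega>) * iexp (t * Y n \<omega>) \<partial>M)
     \<longlonglongrightarrow> (\<integral>\<omega>. of_real (indicator H \<omega> * exp (- (t\<^sup>2) * S \<omega> / 2)) \<partial>M)"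
  shows "stably_converges_normal M Y S"
  unfolding stably_converges_normal_def
proof (intro conjI allI ballI impI)
  fix H f assume H[measurable]: "H \<in> sets M" and pos: "0 < measure M H"
    and f: "continuous_on UNIV f \<and> bounded (range (f :: real \<Rightarrow> real))"
  from f obtain b where b: "\<And>x. \<bar>f x\<bar> \<le> b" by (auto simp: bounded_iff)
  have fc: "continuous_on UNIV f" and fc': "isCont f x" for x
    using f by (auto simp: continuous_on_eq_continuous_at)
  have [measurable]: "f \<in> borel_measurable borel" using fc by (rule borel_measurable_continuous_onI)
  have em: "emeasure M H \<noteq> 0" "emeasure M H \<noteq> \<infinity>" using pos by (auto simp: measure_def)
  let ?N = "uniform_measure M H"
  have N: "prob_space ?N" using em by (intro prob_space_uniform_measure) auto
  interpret N: prob_space ?N by fact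
  define \<mu> where "\<mu> n = distr ?N borel (Y n)" for n
  define \<nu> where "\<nu> = distr (?N \<Otimes>\<^sub>M std_normal_distribution) borel (\<lambda>(\<omega>, x). sqrt (S \<omega>) * x)"
  have SN: "S \<in> borel_measurable ?N" "\<And>\<omega>. \<omega> \<in> space ?N \<Longrightarrow> 0 \<le> S \<omega>" using S0 by auto
  have mix1: "real_distribution \<nu>"
    unfolding \<nu>_def by (rule char_normal_mixture(1)[OF N SN])
  have mix2: "char \<nu> t = (\<integral>\<omega>. of_real (exp (- (t\<^sup>2) * S \<omega> / 2)) \<partial>?N)" for t
    unfolding \<nu>_def by (rule char_normal_mixture(2)[OF N SN])
  have mix3: "(\<integral>x. f x \<partial>\<nu>) = (\<integral>\<omega>. (\<integral>x. f x \<partial>centered_normal (S \<omega>)) \<partial>?N)"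
    unfolding \<nu>_def by (rule char_normal_mixture(3)[OF N SN fc b])
  have \<mu>: "real_distribution (\<mu> n)" for n
    unfolding \<mu>_def real_distribution_def real_distribution_axioms_def
    by (auto intro!: N.prob_space_distr)
  have "(\<lambda>n. char (\<mu> n) t) \<longlonglongrightarrow> char \<nu> t" for t
  proof -
    have 1: "char (\<mu> n) t = (\<integral>\<omega>. of_real (indicator H \<omega>) * iexp (t * Y n \<omega>) \<partial>M) /\<^sub>R measure M H" for n
      unfolding char_def \<mu>_def using em
      by (simp add: integral_distr integral_uniform_measure scaleR_conv_of_real)
    have 2: "char \<nu> t = (\<integral>\<omega>. of_real (indicator H \<omega> * exp (- (t\<^sup>2) * S \<omega> / 2)) \<partial>M) /\<^sub>R measure M H"
      unfolding mix2 using em by (simp add: integral_uniform_measure scaleR_conv_of_real flip: of_real_mult, simp)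
    show ?thesis unfolding 1 2 by (intro tendsto_intros char H)
  qed
  then have "weak_conv_m \<mu> \<nu>" by (rule levy_continuity[OF \<mu> mix1])
  then have "(\<lambda>n. \<integral>x. f x \<partial>\<mu> n) \<longlonglongrightarrow> (\<integral>x. f x \<partial>\<nu>)"
    using \<mu> mix1 fc' b by (intro weak_conv_imp_integral_bdd_continuous_conv) auto
  then show "(\<lambda>n. \<integral>\<omega>. f (Y n \<omega>) \<partial>?N) \<longlonglongrightarrow> (\<integral>\<omega>. (\<integral>x. f x \<partial>centered_normal (S \<omega>)) \<partial>?N)"
    unfolding mix3 by (simp add: \<mu>_def integral_distr)
qed (use S0 in auto)

text \<open>A remainder with a deterministic bound tending to 0 changes the characteristic function
  by at most \<open>\<bar>t\<bar> * \<rho> n\<close>, as \<open>iexp\<close> is 1-Lipschitz. In the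
  application the remainder is the influence of the initial state.\<close>

theorem (in bounded_martingale_array) stable_clt:
  fixes Y :: "nat \<Rightarrow> 'w \<Rightarrow> real"
  assumes Y[measurable]: "\<And>n. Y n \<in> borel_measurable M"
    and Y_le: "\<And>n \<omega>. \<omega> \<in> space M \<Longrightarrow> \<bar>Y n \<omega> - (\<Sum>m<n. \<xi> n m \<omega>)\<bar> \<le> \<rho> n" and \<rho>: "\<rho> \<longlonglongrightarrow> 0"
    and S[measurable]: "S \<in> borel_measurable M" and S0: "\<And>\<omega>. \<omega> \<in> space M \<Longrightarrow> 0 \<le> S \<omega>"
    and lim: "AE \<omega> in M. (\<lambda>n. \<Sum>m<n. c n m \<omega>) \<longlonglongrightarrow> S \<omega>"
  shows "stably_converges_normal M Y S"
proof (rule stably_converges_normalI[OF Y S S0])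
  fix H t assume H[measurable]: "H \<in> sets M"
  let ?M = "\<lambda>n \<omega>. \<Sum>m<n. \<xi> n m \<omega>"
  let ?I = "\<lambda>\<omega>. complex_of_real (indicator H \<omega>)"
  have main: "(\<lambda>n. \<integral>\<omega>. ?I \<omega> * iexp (t * ?M n \<omega>) \<partial>M)
     \<longlonglongrightarrow> (\<integral>\<omega>. of_real (indicator H \<omega> * exp (- (t\<^sup>2) * S \<omega> / 2)) \<partial>M)"
    by (rule char_tendsto) (use lim in \<open>auto simp: cond_var_def S0\<close>)
  have int: "integrable M (\<lambda>\<omega>. ?I \<omega> * iexp (t * f \<omega>))" if [measurable]: "f \<in> borel_measurable M" for f
    by (intro integrable_const_bound[where B = 1]) (auto simp: norm_mult indicator_def)
  have iexp_diff: "cmod (iexp x - iexp y) \<le> \<bar>x - y\<bar>" for x y :: real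
  proof -
    have "iexp x - iexp y = iexp y * (iexp (x - y) - 1)" by (simp add: algebra_simps flip: exp_add)
    then show ?thesis using iexp_approx1[of "x - y" 0] by (simp add: norm_mult)
  qed
  have "(\<lambda>n. (\<integral>\<omega>. ?I \<omega> * iexp (t * Y n \<omega>) \<partial>M) - (\<integral>\<omega>. ?I \<omega> * iexp (t * ?M n \<omega>) \<partial>M)) \<longlonglongrightarrow> 0"
  proof (rule Lim_null_comparison[OF eventuallyI])
    show "(\<lambda>n. \<bar>t\<bar> * \<rho> n) \<longlonglongrightarrow> 0" using tendsto_mult_left[OF \<rho>, of "\<bar>t\<bar>"] by simp
    fix n
    have "(\<integral>\<omega>. ?I \<omega> * iexp (t * Y n \<omega>) \<partial>M) - (\<integral>\<omega>. ?I \<omega> * iexp (t * ?M n \<omega>) \<partial>M) =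
      (\<integral>\<omega>. ?I \<omega> * iexp (t * Y n \<omega>) - ?I \<omega> * iexp (t * ?M n \<omega>) \<partial>M)"
      by (rule Bochner_Integration.integral_diff[symmetric]) (intro int; measurable)+
    also have "norm \<dots> \<le> (\<integral>\<omega>. \<bar>t\<bar> * \<rho> n \<partial>M)"
    proof (rule integral_norm_le_integral)
      fix \<omega> assume w: "\<omega> \<in> space M"
      have "norm (?I \<omega> * (iexp (t * Y n \<omega>) - iexp (t * ?M n \<omega>))) \<le> 1 * \<bar>t * Y n \<omega> - t * ?M n \<omega>\<bar>"
        unfolding norm_mult by (intro mult_mono iexp_diff) (auto simp: indicator_def)
      also have "\<dots> = \<bar>t\<bar> * \<bar>Y n \<omega> - ?M n \<omega>\<bar>" by (simp add: abs_mult flip: right_diff_distrib)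
      also have "\<dots> \<le> \<bar>t\<bar> * \<rho> n" using Y_le[OF w] by (intro mult_left_mono) auto
      finally show "norm (?I \<omega> * iexp (t * Y n \<omega>) - ?I \<omega> * iexp (t * ?M n \<omega>)) \<le> \<bar>t\<bar> * \<rho> n"
        by (simp add: right_diff_distrib)
    qed (intro Bochner_Integration.integrable_diff int integrable_const; measurable)+
    also have "\<dots> = \<bar>t\<bar> * \<rho> n" by (simp add: prob_space)
    finally show "norm ((\<integral>\<omega>. ?I \<omega> * iexp (t * Y n \<omega>) \<partial>M) - (\<integral>\<omega>. ?I \<omega> * iexp (t * ?M n \<omega>) \<partial>M)) \<le> \<bar>t\<bar> * \<rho> n" .
  qed
  from tendsto_add[OF this main]
  show "(\<lambda>n. \<integral>\<omega>. ?I \<omega> * iexp (t * Y n \<omega>) \<partial>M)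
     \<longlonglongrightarrow> (\<integral>\<omega>. of_real (indicator H \<omega> * exp (- (t\<^sup>2) * S \<omega> / 2)) \<partial>M)" by simp
qed

section \<open>Affine recursions and weighted sums of products\<close>

text \<open>The excess of x over \<open>e / 2\<close> is damped by
  \<open>1 - a n \<le> exp (- a n)\<close> at each late step, and the exponents add up to
  infinity.\<close>

lemma contraction_tendsto_0:
  fixes x a \<eta> :: "nat \<Rightarrow> real"
  assumes step: "\<forall>\<^sub>F n in sequentially. x (Suc n) \<le> (1 - a n) * x n + a n * \<eta> n"
    and x0: "\<And>n. 0 \<le> x n" and a: "\<forall>\<^sub>F n in sequentially. 0 \<le> a n \<and> a n \<le> 1"
    and a_div: "\<not> summable a" and \<eta>: "\<eta> \<longlonglongrightarrow> 0"
  shows "x \<longlonglongrightarrow> 0"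
proof (rule LIMSEQ_I)
  fix e :: real assume e: "0 < e"
  have "\<forall>\<^sub>F n in sequentially. \<eta> n < e / 2"
    using e \<eta> by (intro order_tendstoD) auto
  then have "\<forall>\<^sub>F n in sequentially. x (Suc n) \<le> (1 - a n) * x n + a n * \<eta> n \<and> (0 \<le> a n \<and> a n \<le> 1) \<and> \<eta> n < e / 2"
    using step a by eventually_elim auto
  then obtain N where N: "\<And>n. n \<ge> N \<Longrightarrow> x (Suc n) \<le> (1 - a n) * x n + a n * \<eta> n"
     "\<And>n. n \<ge> N \<Longrightarrow> 0 \<le> a n" "\<And>n. n \<ge> N \<Longrightarrow> a n \<le> 1" "\<And>n. n \<ge> N \<Longrightarrow> \<eta> n < e / 2"
    unfolding eventually_sequentially by blast
  define y where "y k = max 0 (x (N + k) - e / 2)" for k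
  have y0: "y k \<ge> 0" for k unfolding y_def by simp
  have y_step: "y (Suc k) \<le> exp (- a (N + k)) * y k" for k
  proof -
    have "x (Suc (N + k)) - e / 2 \<le> (1 - a (N + k)) * (x (N + k) - e / 2)"
      using N(1)[of "N + k"] mult_left_mono[OF less_imp_le[OF N(4)[of "N + k"]] N(2)[of "N + k"]]
      by (simp add: algebra_simps)
    also have "\<dots> \<le> (1 - a (N + k)) * y k"
      using N(3)[of "N + k"] by (intro mult_left_mono) (auto simp: y_def)
    also have "\<dots> \<le> exp (- a (N + k)) * y k"
      using exp_ge_add_one_self[of "- a (N + k)"] y0 by (intro mult_right_mono) auto
    finally show ?thesis using y0[of k] by (simp add: y_def)
  qed
  have y_le: "y k \<le> exp (- (\<Sum>i<k. a (N + i))) * y 0" for k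
  proof (induction k)
    case (Suc k)
    have "y (Suc k) \<le> exp (- a (N + k)) * y k" by (rule y_step)
    also have "\<dots> \<le> exp (- a (N + k)) * (exp (- (\<Sum>i<k. a (N + i))) * y 0)"
      using Suc by (intro mult_left_mono) auto
    also have "\<dots> = exp (- (\<Sum>i<Suc k. a (N + i))) * y 0"
      by (simp add: mult.assoc[symmetric] exp_add[symmetric])
    finally show ?case .
  qed simp
  \<comment> \<open>With \<open>exp (- R) \<le> 1 / R\<close>, this value brings \<open>y k\<close>
    down to at most \<open>e * y 0 / (2 * y 0 + 1)\<close>; the added 1 makes this strictly less
    than \<open>e / 2\<close> and keeps R positive when \<open>y 0 = 0\<close>.\<close>
  define R where "R = (2 * y 0 + 1) / e"
  have "\<exists>k. R < (\<Sum>i<k. a (N + i))"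
  proof (rule ccontr)
    assume "\<not> ?thesis"
    then have "summable (\<lambda>i. a (N + i))"
      by (intro summableI_nonneg_bounded[where x = R]) (auto simp: not_less N)
    then show False using a_div summable_iff_shift[of a N] by (simp add: add.commute)
  qed
  then obtain K where K: "R < (\<Sum>i<K. a (N + i))" ..
  show "\<exists>no. \<forall>n\<ge>no. norm (x n - 0) < e"
  proof (intro exI allI impI)
    fix n assume n: "N + K \<le> n"
    define k where "k = n - N"
    have k: "n = N + k" "k \<ge> K" using n by (auto simp: k_def)
    have "(\<Sum>i<K. a (N + i)) \<le> (\<Sum>i<k. a (N + i))" using k N(2) by (intro sum_mono2) auto
    then have S: "R < (\<Sum>i<k. a (N + i))" using K by simp
    have R0: "R > 0" using e y0[of 0] by (simp add: R_def add_nonneg_pos)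
    have "exp (- (\<Sum>i<k. a (N + i))) \<le> inverse (exp R)" using S by (simp add: exp_minus)
    also have "\<dots> \<le> inverse R"
      using exp_ge_add_one_self[of R] R0 by (intro le_imp_inverse_le) linarith+
    also have "\<dots> = e / (2 * y 0 + 1)" by (simp add: R_def)
    finally have "y k \<le> e / (2 * y 0 + 1) * y 0"
      using y_le[of k] mult_right_mono[OF _ y0[of 0]] by (meson order_trans)
    also have "\<dots> < e / 2" using e y0[of 0] by (simp add: field_simps add_nonneg_pos)
    finally have "x n < e" unfolding y_def k by linarith
    then show "norm (x n - 0) < e" using x0[of n] by simp
  qed
qed

text \<open>With time step \<open>\<epsilon> n\<close> this is a discretisation of the equation
  \<open>y' = \<delta> - \<kappa> * y\<close>, run for infinite total time, with equilibrium
  \<open>\<delta> / \<kappa>\<close>. The distance to it contracts at a rate proportional to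
  \<open>\<epsilon> n * Re \<kappa>\<close>, up to an inhomogeneity of smaller order than
  \<open>\<epsilon> n\<close>.\<close>

lemma affine_recursion_tendsto:
  fixes y A D :: "nat \<Rightarrow> complex" and \<epsilon> :: "nat \<Rightarrow> real"
  assumes step: "\<forall>\<^sub>F n in sequentially. y (Suc n) = A n * y n + D n"
    and \<epsilon>_pos: "\<forall>\<^sub>F n in sequentially. 0 < \<epsilon> n" and \<epsilon>: "\<epsilon> \<longlonglongrightarrow> 0" and \<epsilon>_div: "\<not> summable \<epsilon>"
    and A: "(\<lambda>n. (1 - A n) / of_real (\<epsilon> n)) \<longlonglongrightarrow> \<kappa>" and \<kappa>: "0 < Re \<kappa>"
    and D: "(\<lambda>n. D n / of_real (\<epsilon> n)) \<longlonglongrightarrow> \<delta>"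
  shows "y \<longlonglongrightarrow> \<delta> / \<kappa>"
proof -
  define L where "L = \<delta> / \<kappa>"
  have \<kappa>0: "\<kappa> \<noteq> 0" using \<kappa> by auto
  define k where "k n = (1 - A n) / of_real (\<epsilon> n)" for n
  define d where "d n = D n / of_real (\<epsilon> n)" for n
  \<comment> \<open>The squared modulus of \<open>A n\<close> is about
    \<open>1 - 2 * \<epsilon> n * Re \<kappa>\<close>. Keeping
    \<open>1 - \<epsilon> n * Re \<kappa>\<close> leaves room for the errors, and the square root
    halves the rate once more.\<close>
  define a where "a n = \<epsilon> n * (Re \<kappa> / 2)" for n
  define \<eta> where "\<eta> n = cmod (d n - k n * L) / (Re \<kappa> / 2)" for n
  have k: "k \<longlonglongrightarrow> \<kappa>" and d: "d \<longlonglongrightarrow> \<delta>" using A D by (simp_all add: k_def[abs_def] d_def[abs_def])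
  have "(\<lambda>n. cmod (y n - L)) \<longlonglongrightarrow> 0"
  proof (rule contraction_tendsto_0[where a = a and \<eta> = \<eta>])
    have "(\<lambda>n. a n) \<longlonglongrightarrow> 0 * (Re \<kappa> / 2)" unfolding a_def by (intro tendsto_intros \<epsilon>)
    then have "\<forall>\<^sub>F n in sequentially. a n < 1" by (intro order_tendstoD) auto
    then show a01: "\<forall>\<^sub>F n in sequentially. 0 \<le> a n \<and> a n \<le> 1"
      using \<epsilon>_pos by eventually_elim (use \<kappa> in \<open>auto simp: a_def\<close>)
    show "\<not> summable a" unfolding a_def using \<epsilon>_div \<kappa> by (simp add: summable_cmult_iff mult.commute)
    have "\<eta> \<longlonglongrightarrow> cmod (\<delta> - \<kappa> * L) / (Re \<kappa> / 2)"
      unfolding \<eta>_def using \<kappa> by (intro tendsto_intros k d) auto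
    then show "\<eta> \<longlonglongrightarrow> 0" using \<kappa>0 by (simp add: L_def)
    have "(\<lambda>n. 2 * Re (k n) - \<epsilon> n * (cmod (k n))\<^sup>2) \<longlonglongrightarrow> 2 * Re \<kappa> - 0 * (cmod \<kappa>)\<^sup>2"
      by (intro tendsto_intros k \<epsilon>)
    then have "\<forall>\<^sub>F n in sequentially. Re \<kappa> < 2 * Re (k n) - \<epsilon> n * (cmod (k n))\<^sup>2"
      using \<kappa> by (intro order_tendstoD) auto
    then show "\<forall>\<^sub>F n in sequentially. cmod (y (Suc n) - L) \<le> (1 - a n) * cmod (y n - L) + a n * \<eta> n"
      using \<epsilon>_pos step a01
    proof eventually_elim
      case (elim n)
      have A: "A n = 1 - of_real (\<epsilon> n) * k n" using elim(2) by (simp add: k_def)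
      have "(cmod (A n))\<^sup>2 = 1 - \<epsilon> n * (2 * Re (k n) - \<epsilon> n * (cmod (k n))\<^sup>2)"
        unfolding A cmod_power2 by (simp add: power2_eq_square algebra_simps)
      also have "\<dots> \<le> 1 - \<epsilon> n * Re \<kappa>"
        using elim(1,2) by (intro diff_left_mono mult_left_mono) auto
      also have "\<dots> \<le> (1 - a n)\<^sup>2"
        using zero_le_power2[of "a n"] by (simp add: a_def power2_eq_square algebra_simps)
      finally have nA: "cmod (A n) \<le> 1 - a n" using elim(4) by (auto intro: power2_le_imp_le)
      have "y (Suc n) - L = A n * (y n - L) + of_real (\<epsilon> n) * (d n - k n * L)"
        using elim(2,3) by (simp add: A d_def algebra_simps)
      also have "cmod \<dots> \<le> cmod (A n) * cmod (y n - L) + \<epsilon> n * cmod (d n - k n * L)"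
        using elim(2) by (intro order_trans[OF norm_triangle_ineq]) (auto simp: norm_mult)
      also have "\<epsilon> n * cmod (d n - k n * L) = a n * \<eta> n" using \<kappa> by (simp add: a_def \<eta>_def)
      also have "cmod (A n) * cmod (y n - L) \<le> (1 - a n) * cmod (y n - L)"
        using nA by (intro mult_right_mono) auto
      finally show ?case by simp
    qed
  qed auto
  then show ?thesis unfolding L_def by (simp add: tendsto_norm_zero_iff LIM_zero_iff)
qed

text \<open>A discrete Gronwall argument: adding 1 to the norm absorbs the inhomogeneous term, so
  \<open>1 + norm (e n)\<close> grows by at most a factor \<open>exp (s n)\<close> per step.\<close>

lemma perturbed_recursion_Bseq:
  fixes e :: "nat \<Rightarrow> 'a::real_normed_vector" and s :: "nat \<Rightarrow> real"
  assumes step: "\<forall>\<^sub>F n in sequentially. norm (e (Suc n)) \<le> (1 + s n) * norm (e n) + s n"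
    and s0: "\<And>n. 0 \<le> s n" and s: "summable s"
  shows "Bseq e"
proof -
  from step obtain N where N: "\<And>n. n \<ge> N \<Longrightarrow> norm (e (Suc n)) \<le> (1 + s n) * norm (e n) + s n"
    unfolding eventually_sequentially by blast
  have le: "1 + norm (e (N + k)) \<le> exp (\<Sum>i<N+k. s i) * (1 + norm (e N))" for k
  proof (induction k)
    case 0
    have "1 * (1 + norm (e N)) \<le> exp (\<Sum>i<N. s i) * (1 + norm (e N))"
      using s0 by (intro mult_right_mono) (auto intro: sum_nonneg)
    then show ?case by simp
  next
    case (Suc k)
    have "1 + norm (e (N + Suc k)) \<le> (1 + s (N + k)) * (1 + norm (e (N + k)))"
      using N[of "N + k"] by (simp add: algebra_simps)
    also have "\<dots> \<le> exp (s (N + k)) * (exp (\<Sum>i<N+k. s i) * (1 + norm (e N)))"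
      using Suc exp_ge_add_one_self[of "s (N + k)"] s0 by (intro mult_mono) auto
    also have "\<dots> = exp (\<Sum>i<N+Suc k. s i) * (1 + norm (e N))"
      by (simp add: mult.assoc[symmetric] exp_add[symmetric] add.commute)
    finally show ?case .
  qed
  have "norm (e (n + N)) \<le> exp (suminf s) * (1 + norm (e N))" for n
  proof -
    have "exp (\<Sum>i<N+n. s i) * (1 + norm (e N)) \<le> exp (suminf s) * (1 + norm (e N))"
      using sum_le_suminf[OF s, of "{..<N+n}"] s0 by (intro mult_right_mono) auto
    then show ?thesis using le[of n] by (simp add: add.commute)
  qed
  then have "Bseq (\<lambda>n. e (n + N))" by (intro BseqI') 
  then show ?thesis by (rule Bseq_offset)
qed

section \<open>Sums of squares and fourth powers of propagated steps\<close>

text \<open>For \<open>\<alpha> = 1 - lam h\<close> this is the factor by which the steps m to n - 1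
  multiply the component along \<open>u h\<close>: each step acts there as
  \<open>1 - r l + r l * lam h\<close>.\<close>

definition recursion_prod :: "(nat \<Rightarrow> real) \<Rightarrow> complex \<Rightarrow> nat \<Rightarrow> nat \<Rightarrow> complex" where
  "recursion_prod r \<alpha> m n = (\<Prod>l=m..<n. 1 - of_real (r l) * \<alpha>)"

lemma recursion_prod_same[simp]: "recursion_prod r \<alpha> n n = 1"
  by (simp add: recursion_prod_def)

lemma recursion_prod_Suc:
  "m \<le> n \<Longrightarrow> recursion_prod r \<alpha> m (Suc n) = (1 - of_real (r n) * \<alpha>) * recursion_prod r \<alpha> m n"
  by (simp add: recursion_prod_def prod.atLeastLessThan_Suc)

text \<open>The covariance of two spectral components under unit noise. It is bilinear, without
  conjugation, since it arises from squaring a real sum expanded in the complex eigenbasis. The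
  noise of step m enters with the explicit factor \<open>r m\<close> and is propagated only from
  \<open>Suc m\<close> on.\<close>

definition prod_sum2 :: "(nat \<Rightarrow> real) \<Rightarrow> complex \<Rightarrow> complex \<Rightarrow> nat \<Rightarrow> complex" where
  "prod_sum2 r \<alpha> \<beta> n =
     (\<Sum>m<n. of_real ((r m)\<^sup>2) * (recursion_prod r \<alpha> (Suc m) n * recursion_prod r \<beta> (Suc m) n))"

text \<open>The first summand accounts for the initial condition \<open>Z 0\<close> of the system.\<close>

definition prod_sum4 :: "(nat \<Rightarrow> real) \<Rightarrow> complex \<Rightarrow> nat \<Rightarrow> real" where
  "prod_sum4 r \<alpha> n = (cmod (recursion_prod r \<alpha> 0 n)) ^ 4 +
     (\<Sum>m<n. (r m * cmod (recursion_prod r \<alpha> (Suc m) n)) ^ 4)"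

lemma prod_sum2_Suc:
  "prod_sum2 r \<alpha> \<beta> (Suc n) =
     (1 - of_real (r n) * \<alpha>) * (1 - of_real (r n) * \<beta>) * prod_sum2 r \<alpha> \<beta> n + of_real ((r n)\<^sup>2)"
  unfolding prod_sum2_def sum.lessThan_Suc sum_distrib_left
  by (auto simp: recursion_prod_Suc Suc_le_eq algebra_simps intro!: sum.cong)

lemma prod_sum4_Suc:
  "prod_sum4 r \<alpha> (Suc n) = (cmod (1 - of_real (r n) * \<alpha>)) ^ 4 * prod_sum4 r \<alpha> n + (r n) ^ 4"
proof -
  have "(\<Sum>m<n. (r m * cmod (recursion_prod r \<alpha> (Suc m) (Suc n))) ^ 4) =
    (cmod (1 - of_real (r n) * \<alpha>)) ^ 4 * (\<Sum>m<n. (r m * cmod (recursion_prod r \<alpha> (Suc m) n)) ^ 4)"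
    unfolding sum_distrib_left
    by (intro sum.cong) (auto simp: recursion_prod_Suc Suc_le_eq norm_mult power_mult_distrib)
  then show ?thesis
    unfolding prod_sum4_def by (simp add: recursion_prod_Suc norm_mult power_mult_distrib distrib_left)
qed

lemma prod_sum4_nonneg: "0 \<le> prod_sum4 r \<alpha> n"
  unfolding prod_sum4_def by (intro add_nonneg_nonneg sum_nonneg) auto

lemma of_real_cmod4: "complex_of_real ((cmod z) ^ 4) = (z * cnj z)\<^sup>2"
  by (simp add: complex_norm_square[symmetric])

text \<open>Multiplying by \<open>n powr \<gamma>\<close> turns the one-step recursion into an
  affine one with \<open>\<epsilon> n = n powr (- \<gamma>)\<close>. The step factors contribute
  \<open>c * (\<alpha> + \<beta>)\<close> to \<open>\<kappa>\<close>; the growth of the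
  normalisation subtracts \<open>\<zeta>\<close>, which is 1 for \<open>\<gamma> = 1\<close> and 0
  below. For fourth powers \<open>\<kappa>\<close> doubles, while the inhomogeneity has order
  \<open>(\<epsilon> n)\<^sup>2\<close>, so the limit is 0.\<close>

lemma
  fixes \<alpha> \<beta> :: complex
  assumes \<gamma>: "0 < \<gamma>" "\<gamma> \<le> 1" and r: "(\<lambda>n. real n powr \<gamma> * r n) \<longlonglongrightarrow> c"
  defines "\<zeta> \<equiv> if \<gamma> = 1 then 1 else 0 :: real"
  shows prod_sum2_tendsto:
      "\<zeta> < c * Re (\<alpha> + \<beta>) \<Longrightarrow>
       (\<lambda>n. of_real (real n powr \<gamma>) * prod_sum2 r \<alpha> \<beta> n) \<longlonglongrightarrow> of_real (c\<^sup>2) / (of_real c * (\<alpha> + \<beta>) - of_real \<zeta>)"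
    and prod_sum4_tendsto_0:
      "\<zeta> < 2 * c * Re \<alpha> \<Longrightarrow> (\<lambda>n. (real n powr \<gamma>)\<^sup>2 * prod_sum4 r \<alpha> n) \<longlonglongrightarrow> 0"
proof -
  define \<epsilon> where "\<epsilon> n = real n powr (- \<gamma>)" for n
  define R where "R n = real n powr \<gamma> * r n" for n
  define \<rho> where "\<rho> n = real (Suc n) powr \<gamma> / real n powr \<gamma>" for n
  define z where "z n = (\<rho> n - 1) / \<epsilon> n" for n
  have \<epsilon>: "\<epsilon> \<longlonglongrightarrow> 0" unfolding \<epsilon>_def using \<gamma> by real_asymp
  have \<epsilon>_pos: "\<forall>\<^sub>F n in sequentially. 0 < \<epsilon> n"
    using eventually_gt_at_top[of 0] by eventually_elim (simp add: \<epsilon>_def)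
  have \<epsilon>_div: "\<not> summable \<epsilon>"
    unfolding \<epsilon>_def using summable_real_powr_iff[of "- \<gamma>"] \<gamma> by simp
  have z: "z \<longlonglongrightarrow> \<zeta>"
  proof (cases "\<gamma> = 1")
    case True
    have "\<forall>\<^sub>F n in sequentially. z n = 1"
      using eventually_gt_at_top[of 0]
      by eventually_elim (simp add: z_def \<rho>_def \<epsilon>_def True powr_minus field_simps)
    then show ?thesis using True by (simp add: \<zeta>_def tendsto_eventually)
  next
    case False
    then have "\<gamma> < 1" using \<gamma> by simp
    then show ?thesis using \<gamma> unfolding z_def \<rho>_def \<epsilon>_def \<zeta>_def by (simp, real_asymp)
  qed
  have R: "R \<longlonglongrightarrow> c" using r by (simp add: R_def[abs_def])
  have \<rho>: "\<rho> \<longlonglongrightarrow> 1" unfolding \<rho>_def using \<gamma> by real_asymp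
  have rel: "\<forall>\<^sub>F n in sequentially. r n = \<epsilon> n * R n \<and> \<rho> n = 1 + \<epsilon> n * z n \<and>
      real (Suc n) powr \<gamma> = \<rho> n * real n powr \<gamma> \<and> real n powr \<gamma> * \<epsilon> n = 1 \<and> \<epsilon> n > 0"
    using eventually_gt_at_top[of 0] \<epsilon>_pos
    by eventually_elim (auto simp: R_def \<epsilon>_def \<rho>_def z_def powr_minus)
  define A where "A \<alpha> \<beta> n = of_real (\<rho> n) * ((1 - of_real (r n) * \<alpha>) * (1 - of_real (r n) * \<beta>))"
    for \<alpha> \<beta> :: complex and n
  have A: "(\<lambda>n. (1 - A \<alpha> \<beta> n) / of_real (\<epsilon> n)) \<longlonglongrightarrow> of_real c * (\<alpha> + \<beta>) - of_real \<zeta>" for \<alpha> \<beta>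
  proof -
    \<comment> \<open>The two step factors multiply to \<open>1 - \<epsilon> n * k n\<close>, and
      \<open>\<rho> n\<close> is \<open>1 + \<epsilon> n * z n\<close>; multiplying these out gives
      the quotient below.\<close>
    define k where "k n = of_real (R n) * (\<alpha> + \<beta>) - of_real (\<epsilon> n * (R n)\<^sup>2) * \<alpha> * \<beta>" for n
    have k: "k \<longlonglongrightarrow> of_real c * (\<alpha> + \<beta>) - of_real (0 * c\<^sup>2) * \<alpha> * \<beta>"
      unfolding k_def by (intro tendsto_intros \<epsilon> R)
    have lim: "(\<lambda>n. k n - of_real (z n) + of_real (\<epsilon> n * z n) * k n) \<longlonglongrightarrow>
      (of_real c * (\<alpha> + \<beta>) - of_real (0 * c\<^sup>2) * \<alpha> * \<beta>) - of_real \<zeta> + of_real (0 * \<zeta>) * (of_real c * (\<alpha> + \<beta>) - of_real (0 * c\<^sup>2) * \<alpha> * \<beta>)"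
      by (intro tendsto_intros \<epsilon> z k)
    have "\<forall>\<^sub>F n in sequentially. k n - of_real (z n) + of_real (\<epsilon> n * z n) * k n = (1 - A \<alpha> \<beta> n) / of_real (\<epsilon> n)"
      using rel
    proof eventually_elim
      case (elim n)
      then have "of_real (\<epsilon> n) * (k n - of_real (z n) + of_real (\<epsilon> n * z n) * k n) = 1 - A \<alpha> \<beta> n"
        by (simp add: A_def k_def power2_eq_square algebra_simps)
      then show ?case using elim by (simp add: field_simps)
    qed
    from Lim_transform_eventually[OF lim this] show ?thesis by simp
  qed
  show "(\<lambda>n. of_real (real n powr \<gamma>) * prod_sum2 r \<alpha> \<beta> n) \<longlonglongrightarrow> of_real (c\<^sup>2) / (of_real c * (\<alpha> + \<beta>) - of_real \<zeta>)"
    if "\<zeta> < c * Re (\<alpha> + \<beta>)"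
  proof (rule affine_recursion_tendsto[OF _ \<epsilon>_pos \<epsilon> \<epsilon>_div A])
    let ?D = "\<lambda>n. complex_of_real (real (Suc n) powr \<gamma> * (r n)\<^sup>2)"
    show "\<forall>\<^sub>F n in sequentially. of_real (real (Suc n) powr \<gamma>) * prod_sum2 r \<alpha> \<beta> (Suc n) =
      A \<alpha> \<beta> n * (of_real (real n powr \<gamma>) * prod_sum2 r \<alpha> \<beta> n) + ?D n"
      using rel
    proof eventually_elim
      case (elim n)
      then have e: "real (Suc n) powr \<gamma> = \<rho> n * real n powr \<gamma>" by simp
      show ?case unfolding prod_sum2_Suc A_def e by (simp add: algebra_simps)
    qed
    have "\<forall>\<^sub>F n in sequentially. of_real (\<rho> n * (R n)\<^sup>2) = ?D n / of_real (\<epsilon> n)"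
      using rel
    proof eventually_elim
      case (elim n)
      then have e: "real (Suc n) powr \<gamma> = \<rho> n * real n powr \<gamma>" and r: "r n = \<epsilon> n * R n"
        and q: "real n powr \<gamma> * \<epsilon> n = 1" "\<epsilon> n \<noteq> 0" by auto
      have "real (Suc n) powr \<gamma> * (r n)\<^sup>2 = \<rho> n * (R n)\<^sup>2 * \<epsilon> n * (real n powr \<gamma> * \<epsilon> n)"
        unfolding e r by (simp only: power2_eq_square mult_ac)
      then have "real (Suc n) powr \<gamma> * (r n)\<^sup>2 / \<epsilon> n = \<rho> n * (R n)\<^sup>2"
        by (simp only: q mult_1_right nonzero_mult_div_cancel_right simp_thms)
      then show ?case by (simp only: of_real_divide[symmetric])
    qed
    moreover have "(\<lambda>n. complex_of_real (\<rho> n * (R n)\<^sup>2)) \<longlonglongrightarrow> of_real (1 * c\<^sup>2)"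
      by (intro tendsto_intros \<rho> R)
    ultimately show "(\<lambda>n. ?D n / of_real (\<epsilon> n)) \<longlonglongrightarrow> of_real (c\<^sup>2)"
      using Lim_transform_eventually by fastforce
    show "0 < Re (of_real c * (\<alpha> + \<beta>) - of_real \<zeta>)" using that by simp
  qed
  show "(\<lambda>n. (real n powr \<gamma>)\<^sup>2 * prod_sum4 r \<alpha> n) \<longlonglongrightarrow> 0" if *: "\<zeta> < 2 * c * Re \<alpha>"
  proof -
    let ?\<kappa> = "of_real c * (\<alpha> + cnj \<alpha>) - of_real \<zeta>"
    have "(\<lambda>n. complex_of_real ((real n powr \<gamma>)\<^sup>2 * prod_sum4 r \<alpha> n)) \<longlonglongrightarrow> 0 / (?\<kappa> * (1 + 1))"
    proof (rule affine_recursion_tendsto[OF _ \<epsilon>_pos \<epsilon> \<epsilon>_div])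
      let ?A = "\<lambda>n. (A \<alpha> (cnj \<alpha>) n)\<^sup>2"
      let ?D = "\<lambda>n. complex_of_real ((real (Suc n) powr \<gamma>)\<^sup>2 * (r n) ^ 4)"
      have "(\<lambda>n. of_real (\<rho> n) * ((1 - of_real (\<epsilon> n * R n) * \<alpha>) * (1 - of_real (\<epsilon> n * R n) * cnj \<alpha>)))
         \<longlonglongrightarrow> of_real 1 * ((1 - of_real (0 * c) * \<alpha>) * (1 - of_real (0 * c) * cnj \<alpha>))"
        by (intro tendsto_intros \<rho> \<epsilon> R)
      moreover have "\<forall>\<^sub>F n in sequentially. of_real (\<rho> n) * ((1 - of_real (\<epsilon> n * R n) * \<alpha>) * (1 - of_real (\<epsilon> n * R n) * cnj \<alpha>)) = A \<alpha> (cnj \<alpha>) n"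
        using rel by eventually_elim (simp add: A_def)
      ultimately have A1: "(\<lambda>n. A \<alpha> (cnj \<alpha>) n) \<longlonglongrightarrow> 1"
        using Lim_transform_eventually by fastforce
      \<comment> \<open>The coefficient for fourth powers is the square of the one for
        \<open>\<beta> = cnj \<alpha>\<close>; factoring \<open>1 - A\<^sup>2\<close> and using that
        A tends to 1 doubles the rate.\<close>
      have "(\<lambda>n. (1 - A \<alpha> (cnj \<alpha>) n) / of_real (\<epsilon> n) * (1 + A \<alpha> (cnj \<alpha>) n)) \<longlonglongrightarrow> ?\<kappa> * (1 + 1)"
        by (intro tendsto_intros A A1)
      then show "(\<lambda>n. (1 - ?A n) / of_real (\<epsilon> n)) \<longlonglongrightarrow> ?\<kappa> * (1 + 1)"
        by (simp add: power2_eq_square algebra_simps)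
      show "0 < Re (?\<kappa> * (1 + 1))" using * by simp
      show "\<forall>\<^sub>F n in sequentially. complex_of_real ((real (Suc n) powr \<gamma>)\<^sup>2 * prod_sum4 r \<alpha> (Suc n)) =
        ?A n * complex_of_real ((real n powr \<gamma>)\<^sup>2 * prod_sum4 r \<alpha> n) + ?D n"
        using rel
      proof eventually_elim
        case (elim n)
        then have e: "real (Suc n) powr \<gamma> = \<rho> n * real n powr \<gamma>" by simp
        have "?A n = of_real ((\<rho> n)\<^sup>2 * (cmod (1 - of_real (r n) * \<alpha>)) ^ 4)"
          unfolding of_real_mult of_real_cmod4 A_def by (simp add: power_mult_distrib)
        then show ?case unfolding prod_sum4_Suc e by (simp add: power_mult_distrib algebra_simps flip: of_real_mult of_real_add of_real_power)
      qed
      have "\<forall>\<^sub>F n in sequentially. of_real ((\<rho> n)\<^sup>2 * (R n) ^ 4 * \<epsilon> n) = ?D n / of_real (\<epsilon> n)"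
        using rel
      proof eventually_elim
        case (elim n)
        then have e: "real (Suc n) powr \<gamma> = \<rho> n * real n powr \<gamma>" and r: "r n = \<epsilon> n * R n"
        and q: "real n powr \<gamma> * \<epsilon> n = 1" "\<epsilon> n \<noteq> 0" by auto
        have "(real (Suc n) powr \<gamma>)\<^sup>2 * (r n) ^ 4 = (\<rho> n)\<^sup>2 * (R n) ^ 4 * \<epsilon> n * \<epsilon> n * (real n powr \<gamma> * \<epsilon> n)\<^sup>2"
          unfolding e r by (simp only: power2_eq_square power4_eq_xxxx mult_ac)
        then have "(real (Suc n) powr \<gamma>)\<^sup>2 * (r n) ^ 4 / \<epsilon> n = (\<rho> n)\<^sup>2 * (R n) ^ 4 * \<epsilon> n"
          by (simp only: q power_one mult_1_right nonzero_mult_div_cancel_right simp_thms)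
        then show ?case by (simp only: of_real_divide[symmetric])
      qed
      moreover have "(\<lambda>n. complex_of_real ((\<rho> n)\<^sup>2 * (R n) ^ 4 * \<epsilon> n)) \<longlonglongrightarrow> of_real (1\<^sup>2 * c ^ 4 * 0)"
        by (intro tendsto_intros \<rho> R \<epsilon>)
      ultimately show "(\<lambda>n. ?D n / of_real (\<epsilon> n)) \<longlonglongrightarrow> 0"
        using Lim_transform_eventually by fastforce
    qed
    then have "(\<lambda>n. complex_of_real ((real n powr \<gamma>)\<^sup>2 * prod_sum4 r \<alpha> n)) \<longlonglongrightarrow> of_real 0" by simp
    then show ?thesis by (rule tendsto_of_real_iff[THEN iffD1])
  qed
qed

lemma Bseq_mult_null:
  fixes x :: "nat \<Rightarrow> 'a::real_normed_vector" and g :: "nat \<Rightarrow> real"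
  assumes "Bseq x" "g \<longlonglongrightarrow> 0"
  shows "(\<lambda>n. g n *\<^sub>R x n) \<longlonglongrightarrow> 0"
proof -
  obtain K where K: "\<And>n. norm (x n) \<le> K" using assms(1) by (auto simp: Bseq_def)
  have "(\<lambda>n. \<bar>g n\<bar> * K) \<longlonglongrightarrow> \<bar>0\<bar> * K" by (intro tendsto_intros assms)
  then have lim: "(\<lambda>n. \<bar>g n\<bar> * K) \<longlonglongrightarrow> 0" by simp
  show ?thesis
    by (rule Lim_null_comparison[OF eventuallyI lim]) (simp add: mult_left_mono K)
qed

section \<open>The critical case with logarithmic normalisation\<close>

lemma
  fixes c :: real and r :: "nat \<Rightarrow> real"
  assumes r: "(\<lambda>n. real n * r n - c) \<in> O(\<lambda>n. 1 / real n)"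
  shows prod_sum2_log_tendsto: "1 \<le> c * Re (\<alpha> + \<beta>) \<Longrightarrow>
      (\<lambda>n. of_real (real n / ln (real n)) * prod_sum2 r \<alpha> \<beta> n) \<longlonglongrightarrow>
      (if of_real c * (\<alpha> + \<beta>) = 1 then of_real (c\<^sup>2) else 0)"
    and prod_sum4_log_tendsto_0: "1 \<le> 2 * c * Re \<alpha> \<Longrightarrow>
      (\<lambda>n. (real n / ln (real n))\<^sup>2 * prod_sum4 r \<alpha> n) \<longlonglongrightarrow> 0"
proof -
  from landau_o.bigE[OF r] obtain C where C: "0 < C"
      and rC: "\<forall>\<^sub>F n in sequentially. norm (real n * r n - c) \<le> C * norm (1 / real n)" by blast
  define S where "S = \<bar>c\<bar> + C"
  have S: "0 \<le> S" "C \<le> S" "\<bar>c\<bar> \<le> S" using C by (auto simp: S_def)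
  define h where "h n = 1 / real n" for n
  define s where "s n = real n * r n" for n
  have basic: "\<forall>\<^sub>F n in sequentially. 0 < n \<and> 0 < h n \<and> h n \<le> 1 \<and> r n = s n * h n \<and>
      \<bar>s n - c\<bar> \<le> C * h n \<and> \<bar>s n\<bar> \<le> S \<and> real (Suc n) = (1 + h n) * real n \<and> real n * h n = 1"
    using rC eventually_gt_at_top[of 0]
  proof eventually_elim
    case (elim n)
    have h1: "0 < h n" "h n \<le> 1" using elim by (auto simp: h_def)
    have d: "\<bar>s n - c\<bar> \<le> C * h n" using elim by (simp add: s_def h_def)
    also have "\<dots> \<le> C * 1" using C h1 by (intro mult_left_mono) auto
    finally have "\<bar>s n\<bar> \<le> S" unfolding S_def by linarith
    then show ?case using d h1 elim by (auto simp: s_def h_def field_simps)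
  qed
  define A where "A \<alpha> \<beta> n = of_real (1 + h n) * ((1 - of_real (r n) * \<alpha>) * (1 - of_real (r n) * \<beta>))"
    for \<alpha> \<beta> :: complex and n
  \<comment> \<open>The first summand comes from replacing \<open>n * r n\<close> by c, the bracket
    from the terms of second and third order in \<open>h n\<close>.\<close>
  define KA where "KA \<alpha> \<beta> = C * cmod (\<alpha> + \<beta>) + (S\<^sup>2 * cmod (\<alpha> * \<beta>) + S * cmod (\<alpha> + \<beta>) + S\<^sup>2 * cmod (\<alpha> * \<beta>))"
    for \<alpha> \<beta>
  have KA0: "0 \<le> KA \<alpha> \<beta>" for \<alpha> \<beta> using C S by (simp add: KA_def)
  have A: "\<forall>\<^sub>F n in sequentially. cmod (A \<alpha> \<beta> n - (1 - (of_real c * (\<alpha> + \<beta>) - 1) * of_real (h n))) \<le> KA \<alpha> \<beta> * (h n)\<^sup>2"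
    for \<alpha> \<beta>
    using basic
  proof eventually_elim
    case (elim n)
    let ?\<sigma> = "\<alpha> + \<beta>" and ?\<pi> = "\<alpha> * \<beta>"
    let ?h = "complex_of_real (h n)" and ?s = "complex_of_real (s n)"
    have "A \<alpha> \<beta> n - (1 - (of_real c * ?\<sigma> - 1) * ?h) =
      - (of_real ((s n - c) * h n) * ?\<sigma>) + of_real ((h n)\<^sup>2) * (of_real ((s n)\<^sup>2) * ?\<pi> - of_real (s n) * ?\<sigma> + of_real (h n * (s n)\<^sup>2) * ?\<pi>)"
      using elim by (simp add: A_def algebra_simps power2_eq_square)
    also have "cmod \<dots> \<le> C * h n * h n * cmod ?\<sigma> + (h n)\<^sup>2 * (S\<^sup>2 * cmod ?\<pi> + S * cmod ?\<sigma> + S\<^sup>2 * cmod ?\<pi>)"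
    proof (intro order_trans[OF norm_triangle_ineq] add_mono)
      show "cmod (- (of_real ((s n - c) * h n) * ?\<sigma>)) \<le> C * h n * h n * cmod ?\<sigma>"
        unfolding norm_minus_cancel norm_mult norm_of_real abs_mult using elim
        by (intro mult_right_mono mult_mono) auto
      have s2: "\<bar>(s n)\<^sup>2\<bar> \<le> S\<^sup>2" using elim S(1) by (simp add: abs_le_square_iff[symmetric])
      have "cmod (of_real ((s n)\<^sup>2) * ?\<pi> - of_real (s n) * ?\<sigma> + of_real (h n * (s n)\<^sup>2) * ?\<pi>)
        \<le> S\<^sup>2 * cmod ?\<pi> + S * cmod ?\<sigma> + S\<^sup>2 * cmod ?\<pi>"
      proof (intro order_trans[OF norm_triangle_ineq] order_trans[OF norm_triangle_ineq4] add_mono)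
        show "cmod (of_real ((s n)\<^sup>2) * ?\<pi>) \<le> S\<^sup>2 * cmod ?\<pi>"
          unfolding norm_mult norm_of_real using s2 by (intro mult_right_mono) auto
        show "cmod (of_real (s n) * ?\<sigma>) \<le> S * cmod ?\<sigma>"
          unfolding norm_mult norm_of_real using elim by (intro mult_right_mono) auto
        have "\<bar>h n * (s n)\<^sup>2\<bar> \<le> 1 * S\<^sup>2" unfolding abs_mult using s2 elim by (intro mult_mono) auto
        then show "cmod (of_real (h n * (s n)\<^sup>2) * ?\<pi>) \<le> S\<^sup>2 * cmod ?\<pi>"
          unfolding norm_mult[of "of_real (h n * (s n)\<^sup>2)"] norm_of_real by (intro mult_right_mono) auto
      qed
      then show "cmod (of_real ((h n)\<^sup>2) * (of_real ((s n)\<^sup>2) * ?\<pi> - of_real (s n) * ?\<sigma> + of_real (h n * (s n)\<^sup>2) * ?\<pi>))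
        \<le> (h n)\<^sup>2 * (S\<^sup>2 * cmod ?\<pi> + S * cmod ?\<sigma> + S\<^sup>2 * cmod ?\<pi>)"
        unfolding norm_mult[of "of_real ((h n)\<^sup>2)"] norm_of_real abs_power2 by (intro mult_left_mono) auto
    qed
    also have "\<dots> = KA \<alpha> \<beta> * (h n)\<^sup>2" by (simp add: KA_def algebra_simps power2_eq_square)
    finally show ?case .
  qed
  \<comment> \<open>With \<open>Re \<tau> \<ge> 0\<close> the first-order term in the squared
    modulus of \<open>1 - \<tau> * h n\<close> is not positive, leaving only the squared modulus of
    \<open>\<tau>\<close>.\<close>
  define KN where "KN \<alpha> \<beta> = KA \<alpha> \<beta> + (cmod (of_real c * (\<alpha> + \<beta>) - 1))\<^sup>2" for \<alpha> \<beta>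
  have KN0: "0 \<le> KN \<alpha> \<beta>" for \<alpha> \<beta> using KA0 by (simp add: KN_def)
  have norm_A: "\<forall>\<^sub>F n in sequentially. cmod (A \<alpha> \<beta> n) \<le> 1 + KN \<alpha> \<beta> * (h n)\<^sup>2"
    if "1 \<le> c * Re (\<alpha> + \<beta>)" for \<alpha> \<beta>
    using A[of \<alpha> \<beta>] basic
  proof eventually_elim
    case (elim n)
    define \<tau> where "\<tau> = of_real c * (\<alpha> + \<beta>) - 1"
    have \<tau>: "0 \<le> Re \<tau>" using that by (simp add: \<tau>_def)
    have "(cmod (1 - \<tau> * of_real (h n)))\<^sup>2 = 1 - 2 * h n * Re \<tau> + (h n)\<^sup>2 * (cmod \<tau>)\<^sup>2"
      unfolding cmod_power2 by (simp add: power2_eq_square algebra_simps)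
    also have "\<dots> \<le> 1 + (h n)\<^sup>2 * (cmod \<tau>)\<^sup>2" using elim \<tau> by simp
    also have "\<dots> \<le> (1 + (h n)\<^sup>2 * (cmod \<tau>)\<^sup>2)\<^sup>2"
      by (rule self_le_power) auto
    finally have 1: "cmod (1 - \<tau> * of_real (h n)) \<le> 1 + (h n)\<^sup>2 * (cmod \<tau>)\<^sup>2"
      by (rule power2_le_imp_le) simp
    have "cmod (A \<alpha> \<beta> n) \<le> cmod (A \<alpha> \<beta> n - (1 - \<tau> * of_real (h n))) + cmod (1 - \<tau> * of_real (h n))"
      using norm_triangle_ineq[of "A \<alpha> \<beta> n - (1 - \<tau> * of_real (h n))" "1 - \<tau> * of_real (h n)"] by simp
    then show ?case using 1 elim(1) by (simp add: KN_def \<tau>_def algebra_simps)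
  qed
  define D where "D n = real (Suc n) * (r n)\<^sup>2" for n
  \<comment> \<open>One summand for \<open>(s n)\<^sup>2 - c\<^sup>2\<close>, one for the excess of
    \<open>Suc n\<close> over n.\<close>
  define KD where "KD = C * (2 * S) + S\<^sup>2"
  have KD0: "0 \<le> KD" using C S by (simp add: KD_def)
  have D: "\<forall>\<^sub>F n in sequentially. \<bar>D n - c\<^sup>2 * h n\<bar> \<le> KD * (h n)\<^sup>2"
    using basic
  proof eventually_elim
    case (elim n)
    have s2: "(s n)\<^sup>2 \<le> S\<^sup>2" using elim S by (simp add: abs_le_square_iff[symmetric])
    have "D n = (1 + h n) * (s n)\<^sup>2 * h n * (real n * h n)"
      unfolding D_def using elim by (simp add: power2_eq_square)
    then have "D n - c\<^sup>2 * h n = (s n - c) * (s n + c) * h n + (s n)\<^sup>2 * (h n)\<^sup>2"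
      using elim by (simp add: power2_eq_square algebra_simps)
    also have "\<bar>\<dots>\<bar> \<le> C * h n * (2 * S) * h n + S\<^sup>2 * (h n)\<^sup>2"
    proof (intro order_trans[OF abs_triangle_ineq] add_mono)
      have "\<bar>s n + c\<bar> \<le> 2 * S" using elim S(3) by linarith
      then show "\<bar>(s n - c) * (s n + c) * h n\<bar> \<le> C * h n * (2 * S) * h n"
        unfolding abs_mult using elim C by (intro mult_mono) auto
      show "\<bar>(s n)\<^sup>2 * (h n)\<^sup>2\<bar> \<le> S\<^sup>2 * (h n)\<^sup>2"
        using s2 by (simp add: abs_mult mult_right_mono)
    qed
    also have "\<dots> = KD * (h n)\<^sup>2" by (simp add: KD_def power2_eq_square algebra_simps)
    finally show ?case .
  qed
  \<comment> \<open>A single summable majorant, up to a constant, of \<open>1 / n\<^sup>2\<close>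
    and \<open>ln n / n\<^sup>2\<close>, the latter through
    \<open>ln n \<le> 2 * sqrt n\<close>.\<close>
  define p where "p n = real n powr (- 3 / 2)" for n
  have p0: "0 \<le> p n" for n by (simp add: p_def)
  have p_sum: "summable p" unfolding p_def by (subst summable_real_powr_iff) simp
  have hp: "\<forall>\<^sub>F n in sequentially. (h n)\<^sup>2 \<le> p n \<and> (h n)\<^sup>2 * ln (real n) \<le> 2 * p n \<and> 0 \<le> ln (real n)"
    using eventually_gt_at_top[of 0]
  proof eventually_elim
    case (elim n)
    have h2: "(h n)\<^sup>2 = real n powr (-2)" using elim
      by (simp add: h_def powr_minus powr_numeral power_divide divide_inverse power_inverse)
    have "ln (real n) = 2 * ln (sqrt (real n))" using elim by (simp add: ln_sqrt)
    also have "\<dots> \<le> 2 * sqrt (real n)" using elim less_imp_le[OF ln_less_self[of "sqrt (real n)"]] by simp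
    finally have "(h n)\<^sup>2 * ln (real n) \<le> (h n)\<^sup>2 * (2 * sqrt (real n))" by (intro mult_left_mono) auto
    also have "\<dots> = 2 * (real n powr (-2) * real n powr (1/2))" using elim by (simp add: h2 powr_half_sqrt)
    also have "\<dots> = 2 * p n" by (simp add: p_def powr_add[symmetric])
    finally have "(h n)\<^sup>2 * ln (real n) \<le> 2 * p n" .
    moreover have "(h n)\<^sup>2 \<le> p n" unfolding h2 p_def using elim by (intro powr_mono) auto
    ultimately show ?case using elim by simp
  qed
  have ln0: "(\<lambda>n. 1 / ln (real n)) \<longlonglongrightarrow> 0" by real_asymp
  have ln0': "(\<lambda>n. 1 / (ln (real n))\<^sup>2) \<longlonglongrightarrow> 0" by real_asymp
  define x where "x \<alpha> \<beta> n = of_real (real n) * prod_sum2 r \<alpha> \<beta> n" for \<alpha> \<beta> n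
  have x_Suc: "\<forall>\<^sub>F n in sequentially. x \<alpha> \<beta> (Suc n) = A \<alpha> \<beta> n * x \<alpha> \<beta> n + of_real (D n)" for \<alpha> \<beta>
    using basic
  proof eventually_elim
    case (elim n)
    then have e: "real (Suc n) = (1 + h n) * real n" by simp
    show ?case unfolding x_def prod_sum2_Suc D_def A_def e by (simp add: algebra_simps)
  qed
  show "(\<lambda>n. of_real (real n / ln (real n)) * prod_sum2 r \<alpha> \<beta> n) \<longlonglongrightarrow>
      (if of_real c * (\<alpha> + \<beta>) = 1 then of_real (c\<^sup>2) else 0)" if *: "1 \<le> c * Re (\<alpha> + \<beta>)"
  proof (cases "of_real c * (\<alpha> + \<beta>) = 1")
    case True
    \<comment> \<open>Without linear drift each step adds about \<open>c\<^sup>2 / n\<close>, so x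
      follows the harmonic sum.\<close>
    define e where "e n = x \<alpha> \<beta> n - of_real (c\<^sup>2 * ln (real n))" for n
    define K where "K = KN \<alpha> \<beta> + 2 * KA \<alpha> \<beta> * c\<^sup>2 + KD + c\<^sup>2"
    have "Bseq e"
    proof (rule perturbed_recursion_Bseq[where s = "\<lambda>n. K * p n"])
      show "\<forall>\<^sub>F n in sequentially. cmod (e (Suc n)) \<le> (1 + K * p n) * cmod (e n) + K * p n"
        using A[of \<alpha> \<beta>] norm_A[OF *] D hp x_Suc[of \<alpha> \<beta>] basic
      proof eventually_elim
        case (elim n)
        have h: "0 < h n" "h n \<le> 1" "0 < n" "real (Suc n) = (1 + h n) * real n" using elim(6) by auto
        \<comment> \<open>The comparison function grows by \<open>c\<^sup>2 * h n\<close> up to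
          second order, matching \<open>D n\<close>; the error of A is multiplied by
          \<open>ln n\<close>, which p was chosen to absorb.\<close>
        have "ln (real (Suc n)) = ln (1 + h n) + ln (real n)"
          unfolding h(4) using h by (intro ln_mult_pos) auto
        then have "e (Suc n) = A \<alpha> \<beta> n * e n + (A \<alpha> \<beta> n - 1) * of_real (c\<^sup>2 * ln (real n))
            + of_real ((D n - c\<^sup>2 * h n) - c\<^sup>2 * (ln (1 + h n) - h n))"
          unfolding e_def elim(5) by (simp add: algebra_simps)
        also have "cmod \<dots> \<le> (1 + KN \<alpha> \<beta> * p n) * cmod (e n) + 2 * KA \<alpha> \<beta> * c\<^sup>2 * p n + (KD * p n + c\<^sup>2 * p n)"
        proof (intro order_trans[OF norm_triangle_ineq] add_mono)
          have "KN \<alpha> \<beta> * (h n)\<^sup>2 \<le> KN \<alpha> \<beta> * p n" using elim(4) KN0 by (intro mult_left_mono) auto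
          then show "cmod (A \<alpha> \<beta> n * e n) \<le> (1 + KN \<alpha> \<beta> * p n) * cmod (e n)"
            unfolding norm_mult using elim(2) by (intro mult_right_mono) auto
          have "cmod (A \<alpha> \<beta> n - 1) * (c\<^sup>2 * ln (real n)) \<le> KA \<alpha> \<beta> * (h n)\<^sup>2 * (c\<^sup>2 * ln (real n))"
            using elim(1,4) True by (intro mult_right_mono) auto
          also have "\<dots> = KA \<alpha> \<beta> * c\<^sup>2 * ((h n)\<^sup>2 * ln (real n))" by simp
          also have "\<dots> \<le> KA \<alpha> \<beta> * c\<^sup>2 * (2 * p n)" using elim(4) KA0 by (intro mult_left_mono) auto
          finally show "cmod ((A \<alpha> \<beta> n - 1) * of_real (c\<^sup>2 * ln (real n))) \<le> 2 * KA \<alpha> \<beta> * c\<^sup>2 * p n"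
            unfolding norm_mult[of "A \<alpha> \<beta> n - 1"] norm_of_real using elim(4) by (simp add: abs_mult)
          have "\<bar>ln (1 + h n) - h n\<bar> \<le> (h n)\<^sup>2" using h by (intro abs_ln_one_plus_x_minus_x_bound_nonneg) auto
          then have l: "\<bar>ln (1 + h n) - h n\<bar> \<le> p n" using elim(4) by simp
          have "KD * (h n)\<^sup>2 \<le> KD * p n" using elim(4) KD0 by (intro mult_left_mono) auto
          then have "\<bar>D n - c\<^sup>2 * h n\<bar> \<le> KD * p n" using elim(3) by linarith
          moreover have "\<bar>c\<^sup>2 * (ln (1 + h n) - h n)\<bar> \<le> c\<^sup>2 * p n"
            unfolding abs_mult abs_power2 using l by (intro mult_left_mono) auto
          ultimately have "\<bar>(D n - c\<^sup>2 * h n) - c\<^sup>2 * (ln (1 + h n) - h n)\<bar> \<le> KD * p n + c\<^sup>2 * p n"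
            by linarith
          then show "cmod (of_real ((D n - c\<^sup>2 * h n) - c\<^sup>2 * (ln (1 + h n) - h n))) \<le> KD * p n + c\<^sup>2 * p n"
            unfolding norm_of_real .
        qed
        also have "\<dots> \<le> (1 + K * p n) * cmod (e n) + K * p n"
        proof -
          have 1: "KN \<alpha> \<beta> \<le> K" using KA0 KD0 by (simp add: K_def)
          have "2 * KA \<alpha> \<beta> * c\<^sup>2 + KD + c\<^sup>2 \<le> K" using KN0 by (simp add: K_def)
          from mult_right_mono[OF this p0[of n]] mult_right_mono[OF mult_right_mono[OF 1 p0[of n]] norm_ge_zero[of "e n"]]
          show ?thesis by (simp add: algebra_simps)
        qed
        finally show ?case .
      qed
      show "0 \<le> K * p n" for n using KN0 KA0 KD0 p0 by (simp add: K_def)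
    qed (intro summable_mult p_sum)
    from Bseq_mult_null[OF this ln0]
    have 0: "(\<lambda>n. of_real (c\<^sup>2) + (1 / ln (real n)) *\<^sub>R e n) \<longlonglongrightarrow> of_real (c\<^sup>2) + 0"
      by (intro tendsto_intros)
    have "\<forall>\<^sub>F n in sequentially. of_real (c\<^sup>2) + (1 / ln (real n)) *\<^sub>R e n = of_real (real n / ln (real n)) * prod_sum2 r \<alpha> \<beta> n"
      using eventually_gt_at_top[of 1]
      by eventually_elim (simp add: e_def x_def scaleR_conv_of_real field_simps)
    from Lim_transform_eventually[OF 0 this] show ?thesis using True by simp
  next
    case False
    define \<tau> where "\<tau> = of_real c * (\<alpha> + \<beta>) - 1"
    \<comment> \<open>At this value the drift \<open>- \<tau> * h n * L\<close> cancels the gain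
      \<open>c\<^sup>2 * h n\<close>.\<close>
    define L where "L = of_real (c\<^sup>2) / \<tau>"
    define e where "e n = x \<alpha> \<beta> n - L" for n
    have \<tau>0: "\<tau> \<noteq> 0" using False by (simp add: \<tau>_def)
    define K where "K = KN \<alpha> \<beta> + KA \<alpha> \<beta> * cmod L + KD"
    have "Bseq e"
    proof (rule perturbed_recursion_Bseq[where s = "\<lambda>n. K * p n"])
      show "\<forall>\<^sub>F n in sequentially. cmod (e (Suc n)) \<le> (1 + K * p n) * cmod (e n) + K * p n"
        using A[of \<alpha> \<beta>, folded \<tau>_def] norm_A[OF *] D hp x_Suc[of \<alpha> \<beta>]
      proof eventually_elim
        case (elim n)
        have "\<tau> * L = of_real (c\<^sup>2)" using \<tau>0 by (simp add: L_def)
        then have "e (Suc n) = A \<alpha> \<beta> n * e n + (A \<alpha> \<beta> n - (1 - \<tau> * of_real (h n))) * L + of_real (D n - c\<^sup>2 * h n)"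
          unfolding e_def elim(5) by (simp add: algebra_simps)
        also have "cmod \<dots> \<le> (1 + KN \<alpha> \<beta> * p n) * cmod (e n) + KA \<alpha> \<beta> * p n * cmod L + KD * p n"
        proof (intro order_trans[OF norm_triangle_ineq] add_mono)
          have "KN \<alpha> \<beta> * (h n)\<^sup>2 \<le> KN \<alpha> \<beta> * p n" using elim(4) KN0 by (intro mult_left_mono) auto
          then show "cmod (A \<alpha> \<beta> n * e n) \<le> (1 + KN \<alpha> \<beta> * p n) * cmod (e n)"
            unfolding norm_mult using elim(2) by (intro mult_right_mono) auto
          have "KA \<alpha> \<beta> * (h n)\<^sup>2 \<le> KA \<alpha> \<beta> * p n" using elim(4) KA0 by (intro mult_left_mono) auto
          then show "cmod ((A \<alpha> \<beta> n - (1 - \<tau> * of_real (h n))) * L) \<le> KA \<alpha> \<beta> * p n * cmod L"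
            unfolding norm_mult[of _ L] using elim(1) by (intro mult_right_mono) auto
          have "KD * (h n)\<^sup>2 \<le> KD * p n" using elim(4) KD0 by (intro mult_left_mono) auto
          then show "cmod (of_real (D n - c\<^sup>2 * h n)) \<le> KD * p n"
            unfolding norm_of_real using elim(3) by linarith
        qed
        also have "\<dots> \<le> (1 + K * p n) * cmod (e n) + K * p n"
        proof -
          have 1: "KN \<alpha> \<beta> \<le> K" using KA0 KD0 by (simp add: K_def)
          have "KA \<alpha> \<beta> * cmod L + KD \<le> K" using KN0 by (simp add: K_def)
          from mult_right_mono[OF this p0[of n]] mult_right_mono[OF mult_right_mono[OF 1 p0[of n]] norm_ge_zero[of "e n"]]
          show ?thesis by (simp add: algebra_simps)
        qed
        finally show ?case .
      qed
      show "0 \<le> K * p n" for n using KN0 KA0 KD0 p0 by (simp add: K_def)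
    qed (intro summable_mult p_sum)
    from Bseq_mult_null[OF this ln0]
    have "(\<lambda>n. of_real (1 / ln (real n)) * L + (1 / ln (real n)) *\<^sub>R e n) \<longlonglongrightarrow> of_real 0 * L + 0"
      by (intro tendsto_intros ln0)
    moreover have "of_real (1 / ln (real n)) * L + (1 / ln (real n)) *\<^sub>R e n = of_real (real n / ln (real n)) * prod_sum2 r \<alpha> \<beta> n" for n
      by (simp add: e_def x_def scaleR_conv_of_real algebra_simps)
    ultimately show ?thesis using False by simp
  qed
  show "(\<lambda>n. (real n / ln (real n))\<^sup>2 * prod_sum4 r \<alpha> n) \<longlonglongrightarrow> 0" if "1 \<le> 2 * c * Re \<alpha>"
  proof -
    have *: "1 \<le> c * Re (\<alpha> + cnj \<alpha>)" using that by simp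
    define K where "K = KN \<alpha> (cnj \<alpha>)"
    define y where "y n = (real n)\<^sup>2 * prod_sum4 r \<alpha> n" for n
    have y0: "0 \<le> y n" for n by (simp add: y_def prod_sum4_nonneg)
    \<comment> \<open>Squaring \<open>1 + K * (h n)\<^sup>2\<close> with \<open>h n \<le> 1\<close>
      accounts for \<open>2 * K + K\<^sup>2\<close>; the rest is
      \<open>(1 + h n)\<^sup>2 \<le> 4\<close> times the bound \<open>S ^ 4\<close>.\<close>
    define K' where "K' = 2 * K + K\<^sup>2 + 4 * S ^ 4"
    have K0: "0 \<le> K" unfolding K_def by (rule KN0)
    have "Bseq y"
    proof (rule perturbed_recursion_Bseq[where s = "\<lambda>n. K' * p n"])
      show "\<forall>\<^sub>F n in sequentially. norm (y (Suc n)) \<le> (1 + K' * p n) * norm (y n) + K' * p n"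
        using norm_A[OF *] hp basic
      proof eventually_elim
        case (elim n)
        have h: "0 < h n" "h n \<le> 1" and e: "real (Suc n) = (1 + h n) * real n" "r n = s n * h n" "real n * h n = 1"
          and s: "\<bar>s n\<bar> \<le> S" using elim(3) by auto
        have "((1 + h n) * (cmod (1 - of_real (r n) * \<alpha>))\<^sup>2) = cmod (A \<alpha> (cnj \<alpha>) n)"
        proof -
          have "(1 - of_real (r n) * \<alpha>) * (1 - of_real (r n) * cnj \<alpha>) = of_real ((cmod (1 - of_real (r n) * \<alpha>))\<^sup>2)"
            unfolding complex_norm_square by simp
          then have "A \<alpha> (cnj \<alpha>) n = of_real ((1 + h n) * (cmod (1 - of_real (r n) * \<alpha>))\<^sup>2)"
            unfolding A_def by simp
          then show ?thesis using h by (simp only: norm_of_real) (simp add: abs_mult)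
        qed
        then have "(1 + h n) * (cmod (1 - of_real (r n) * \<alpha>))\<^sup>2 \<le> 1 + K * (h n)\<^sup>2"
          using elim(1) by (simp add: K_def)
        then have "((1 + h n) * (cmod (1 - of_real (r n) * \<alpha>))\<^sup>2)\<^sup>2 \<le> (1 + K * (h n)\<^sup>2)\<^sup>2"
          using h by (intro power_mono) auto
        also have "\<dots> = 1 + (2 * K + K\<^sup>2 * (h n)\<^sup>2) * (h n)\<^sup>2" by (simp add: power2_eq_square algebra_simps)
        also have "\<dots> \<le> 1 + (2 * K + K\<^sup>2 * 1) * p n"
          using h elim(2) K0 by (intro add_left_mono mult_mono power_le_one) auto
        also have "\<dots> \<le> 1 + K' * p n" using p0[of n] by (simp add: K'_def mult_right_mono)
        finally have 1: "((1 + h n) * (cmod (1 - of_real (r n) * \<alpha>))\<^sup>2)\<^sup>2 \<le> 1 + K' * p n" .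
        have "(real (Suc n))\<^sup>2 * (r n) ^ 4 = (1 + h n)\<^sup>2 * (s n) ^ 4 * (h n)\<^sup>2 * (real n * h n)\<^sup>2"
          unfolding e(1,2) by (simp only: power2_eq_square power4_eq_xxxx mult_ac)
        also have "\<dots> = (1 + h n)\<^sup>2 * \<bar>s n\<bar> ^ 4 * (h n)\<^sup>2" by (simp add: e)
        also have "\<dots> \<le> 2\<^sup>2 * S ^ 4 * p n"
          using h s elim(2) by (intro mult_mono power_mono) auto
        also have "\<dots> \<le> K' * p n" using K0 p0 by (intro mult_right_mono) (auto simp: K'_def)
        finally have 2: "(real (Suc n))\<^sup>2 * (r n) ^ 4 \<le> K' * p n" .
        have "y (Suc n) = ((1 + h n) * (cmod (1 - of_real (r n) * \<alpha>))\<^sup>2)\<^sup>2 * y n + (real (Suc n))\<^sup>2 * (r n) ^ 4"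
          unfolding y_def prod_sum4_Suc e(1) by (simp add: power_mult_distrib distrib_left)
        also have "\<dots> \<le> (1 + K' * p n) * y n + K' * p n"
          using 1 2 y0 by (intro add_mono mult_right_mono) auto
        finally show ?case using y0 by simp
      qed
      show "0 \<le> K' * p n" for n using p0 K0 by (simp add: K'_def)
    qed (intro summable_mult p_sum)
    from Bseq_mult_null[OF this ln0'] show ?thesis by (simp add: y_def power_divide)
  qed
qed

section \<open>Spectral decomposition\<close>

text \<open>The entry (a, i) of the product of the step matrices
  \<open>(1 - r l) I + r l W\<^sup>T\<close> for l from m to n - 1, written in the
  eigenbasis.\<close>

definition kern :: "(nat \<Rightarrow> real) \<Rightarrow> (nat \<Rightarrow> complex) \<Rightarrow> (nat \<Rightarrow> complex ^ 'n) \<Rightarrow> (nat \<Rightarrow> complex ^ 'n) \<Rightarrow>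
    nat \<Rightarrow> nat \<Rightarrow> 'n \<Rightarrow> 'n \<Rightarrow> complex" where
  "kern r lam u v m n a i = (\<Sum>h=1..CARD('n). u h $ a * recursion_prod r (1 - lam h) m n * v h $ i)"

context
  fixes W :: "real ^ 'n ^ 'n" and lam :: "nat \<Rightarrow> complex" and u v :: "nat \<Rightarrow> complex ^ 'n"
  assumes spectral: "spectral_system W lam u v"
begin

lemma left_eigenvector:
  assumes "h \<in> {1..CARD('n)}"
  shows "(\<Sum>b\<in>UNIV. u h $ b * of_real (W $ b $ a)) = lam h * u h $ a"
proof -
  have "u h v* complex_matrix W = lam h *s u h"
    using spectral assms unfolding spectral_system_def by blast
  then have "(u h v* complex_matrix W) $ a = (lam h *s u h) $ a" by simp
  then show ?thesis by (simp add: vector_matrix_mult_def map_matrix_def mult.commute)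
qed

lemma scalar_product_eigenvectors:
  assumes "h \<in> {1..CARD('n)}" "l \<in> {1..CARD('n)}"
  shows "scalar_product (u h) (v l) = (if h = l then 1 else 0)"
  using spectral assms unfolding spectral_system_def by blast

lemma left_eigenvector_1: "u 1 $ a = u 1 $ b"
  using spectral unfolding spectral_system_def by simp

text \<open>Biorthogonality makes the v a one-sided inverse of the u; this is the other side.
  Expanding a unit vector in the spanning family u and pairing it with \<open>v l\<close> identifies
  the coefficients as \<open>v l $ i\<close>.\<close>

lemma resolution_of_identity:
  "(\<Sum>h=1..CARD('n). u h $ a * v h $ i) = (if a = i then 1 else 0)"
proof -
  let ?N = "{1..CARD('n)}"
  have inj: "inj_on u ?N" and span: "vec.span (u ` ?N) = UNIV"
    using spectral unfolding spectral_system_def by blast+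
  have "axis i 1 \<in> vec.span (u ` ?N)" using span by simp
  then obtain f where "axis i 1 = (\<Sum>w\<in>u ` ?N. f w *s w)"
    by (subst (asm) vec.span_finite) auto
  then have f: "axis i 1 = (\<Sum>h\<in>?N. f (u h) *s u h)" by (simp only: sum.reindex[OF inj] o_def)
  have "v l $ i = f (u l)" if l: "l \<in> ?N" for l
  proof -
    have "v l $ i = scalar_product (axis i 1) (v l)"
      by (simp add: scalar_product_def axis_def if_distrib[where f = "\<lambda>x. x * _"] cong: if_cong)
    also have "\<dots> = (\<Sum>h\<in>?N. f (u h) * scalar_product (u h) (v l))"
      unfolding f scalar_product_def
      by (simp add: sum_distrib_left sum_distrib_right mult.assoc) (rule sum.swap)
    also have "\<dots> = (\<Sum>h\<in>?N. if h = l then f (u h) else 0)"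
      using l by (intro sum.cong) (auto simp: scalar_product_eigenvectors)
    also have "\<dots> = f (u l)" using l by simp
    finally show ?thesis .
  qed
  then have "(\<Sum>h\<in>?N. u h $ a * v h $ i) = (\<Sum>h\<in>?N. f (u h) *s u h) $ a"
    by (simp add: mult.commute)
  also have "\<dots> = (if a = i then 1 else 0)" unfolding f[symmetric] by (simp add: axis_def)
  finally show ?thesis .
qed

lemma kern_same: "kern r lam u v n n a i = (if a = i then 1 else 0)"
  unfolding kern_def by (simp add: resolution_of_identity del: One_nat_def)

text \<open>The eigenvalues are absorbed by \<open>left_eigenvector\<close>, so the spectral sum
  obeys the real matrix recursion. Reality of the kernel and the decomposition of Z rest on
  this.\<close>

lemma kern_Suc:
  assumes "m \<le> n"
  shows "kern r lam u v m (Suc n) a i = of_real (1 - r n) * kern r lam u v m n a i +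
     of_real (r n) * (\<Sum>b\<in>UNIV. of_real (W $ b $ a) * kern r lam u v m n b i)"
proof -
  let ?q = "\<lambda>h. recursion_prod r (1 - lam h) m n"
  have "(\<Sum>b\<in>UNIV. of_real (W $ b $ a) * kern r lam u v m n b i) =
     (\<Sum>h=1..CARD('n). \<Sum>b\<in>UNIV. (u h $ b * of_real (W $ b $ a)) * (?q h * v h $ i))"
    unfolding kern_def sum_distrib_left by (subst sum.swap) (simp add: mult_ac)
  also have "\<dots> = (\<Sum>h=1..CARD('n). lam h * (u h $ a * ?q h * v h $ i))"
    by (intro sum.cong refl, simp only: sum_distrib_right[symmetric] left_eigenvector) (simp add: mult_ac)
  finally show ?thesis
    using assms unfolding kern_def
    by (simp add: recursion_prod_Suc sum_distrib_left sum.distrib[symmetric] algebra_simps)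
qed

text \<open>Eigenvalues and eigenvectors are complex, but the kernel starts as the identity matrix
  and evolves by a recursion with real coefficients.\<close>

lemma kern_real: "m \<le> n \<Longrightarrow> kern r lam u v m n a i \<in> \<real>"
proof (induction n arbitrary: a rule: dec_induct)
  case base
  then show ?case by (simp add: kern_same)
next
  case (step n)
  then show ?case by (simp only: kern_Suc) (intro Reals_add Reals_mult sum_in_Reals Reals_of_real)
qed

text \<open>All entries of \<open>u 1\<close> agree. The component so removed belongs to
  \<open>lam 1 = 1\<close>; its products are identically 1 and would not decay.\<close>

lemma kern_diff:
  "kern r lam u v m n a i - kern r lam u v m n b i =
     (\<Sum>h=2..CARD('n). (u h $ a - u h $ b) * recursion_prod r (1 - lam h) m n * v h $ i)"
proof -
  let ?f = "\<lambda>h. (u h $ a - u h $ b) * recursion_prod r (1 - lam h) m n * v h $ i"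
  have "1 \<le> CARD('n)" using zero_less_card_finite[where 'a = 'n] by linarith
  then have "(\<Sum>h=1..CARD('n). ?f h) = ?f 1 + (\<Sum>h=2..CARD('n). ?f h)"
    by (subst sum.atLeast_Suc_atMost) (simp_all add: numeral_2_eq_2)
  also have "?f 1 = 0" using left_eigenvector_1[of a b] by simp
  finally show ?thesis
    by (simp add: kern_def sum_subtractf left_diff_distrib del: One_nat_def)
qed

text \<open>A Perron-Frobenius argument. Unit column sums give modulus at most 1, so a real part of
  at least 1 would force the eigenvalue 1 exactly. The real and imaginary parts of
  \<open>u h\<close> would then be invariant vectors, constant by a maximum principle based on
  irreducibility, and \<open>u h\<close> would be parallel to \<open>u 1\<close>, against
  biorthogonality.\<close>

lemma Re_eigenvalue_less_1:
  assumes W0: "\<And>j k. 0 \<le> W $ j $ k" and W1: "\<And>k. (\<Sum>j\<in>UNIV. W $ j $ k) = 1"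
    and irr: "irreducible_matrix W" and h: "h \<in> {2..CARD('n)}"
  shows "Re (lam h) < 1"
proof (rule ccontr)
  assume not: "\<not> Re (lam h) < 1"
  have hN: "h \<in> {1..CARD('n)}" and h1: "h \<noteq> 1" using h by auto
  have u0: "u h \<noteq> 0"
  proof
    assume "u h = 0"
    then have "scalar_product (u h) (v h) = 0" by (simp add: scalar_product_def)
    then show False using scalar_product_eigenvectors[OF hN hN] by simp
  qed
  have "cmod (lam h) \<le> 1"
  proof -
    obtain a where a: "\<And>b. cmod (u h $ b) \<le> cmod (u h $ a)"
    proof -
      have "Max (range (\<lambda>b. cmod (u h $ b))) \<in> range (\<lambda>b. cmod (u h $ b))" by (intro Max_in) auto
      then obtain a where a: "Max (range (\<lambda>b. cmod (u h $ b))) = cmod (u h $ a)" by (rule rangeE)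
      have "cmod (u h $ b) \<le> Max (range (\<lambda>b. cmod (u h $ b)))" for b by (intro Max_ge) auto
      then show ?thesis unfolding a by (rule that)
    qed
    have "cmod (lam h) * cmod (u h $ a) = cmod (\<Sum>b\<in>UNIV. u h $ b * of_real (W $ b $ a))"
      unfolding left_eigenvector[OF hN] by (simp add: norm_mult)
    also have "\<dots> \<le> (\<Sum>b\<in>UNIV. cmod (u h $ b) * W $ b $ a)"
      by (rule order_trans[OF norm_sum]) (simp add: norm_mult W0)
    also have "\<dots> \<le> (\<Sum>b\<in>UNIV. cmod (u h $ a) * W $ b $ a)"
      by (intro sum_mono mult_right_mono a W0)
    also have "\<dots> = 1 * cmod (u h $ a)" by (simp add: sum_distrib_left[symmetric] W1)
    finally have "cmod (lam h) * cmod (u h $ a) \<le> 1 * cmod (u h $ a)" .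
    moreover have "cmod (u h $ a) > 0"
    proof (rule ccontr)
      assume "\<not> ?thesis"
      then have "u h $ b = 0" for b using a[of b] by simp
      then show False using u0 by (simp add: vec_eq_iff)
    qed
    ultimately show ?thesis by (simp only: mult_le_cancel_right)
  qed
  have lam1: "lam h = 1"
  proof -
    have re: "Re (lam h) = 1" using not abs_Re_le_cmod[of "lam h"] \<open>cmod (lam h) \<le> 1\<close> by linarith
    have "(cmod (lam h))\<^sup>2 \<le> 1" using \<open>cmod (lam h) \<le> 1\<close> by (simp add: power_le_one)
    then have "(Im (lam h))\<^sup>2 \<le> 0" unfolding cmod_power2 re by simp
    then show ?thesis using re by (simp add: complex_eq_iff)
  qed
  have const: "x a = x b"
    if x: "\<And>a. (\<Sum>b\<in>UNIV. x b * W $ b $ a) = x a" for x :: "'n \<Rightarrow> real" and a b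
  proof -
    define m where "m = Max (range x)"
    have xm: "x a \<le> m" for a unfolding m_def by (intro Max_ge) auto
    \<comment> \<open>Where the maximum m is attained, it is an average of values of x weighted by
      that column, so only maximisers carry weight. Irreducibility leaves S empty or full, and S
      misses a maximiser.\<close>
    define S where "S = {a. x a \<noteq> m}"
    have "W $ i $ j = 0" if i: "i \<in> S" and j: "j \<in> - S" for i j
    proof -
      have "(\<Sum>b\<in>UNIV. (m - x b) * W $ b $ j) = m * (\<Sum>b\<in>UNIV. W $ b $ j) - (\<Sum>b\<in>UNIV. x b * W $ b $ j)"
        by (simp add: left_diff_distrib sum_subtractf sum_distrib_left)
      also have "\<dots> = 0" using j by (simp add: x W1 S_def)
      finally have "\<forall>b\<in>UNIV. (m - x b) * W $ b $ j = 0"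
        using xm W0 by (subst (asm) sum_nonneg_eq_0_iff) auto
      then show ?thesis using i by (auto simp: S_def)
    qed
    moreover have "S \<noteq> UNIV"
    proof -
      have "m \<in> range x" unfolding m_def by (intro Max_in) auto
      then show ?thesis by (auto simp: S_def)
    qed
    ultimately have "S = {}" using irr unfolding irreducible_matrix_def by blast
    then show ?thesis by (auto simp: S_def)
  qed
  have "u h $ a = u h $ b" for a b
  proof (rule complex_eqI)
    show "Re (u h $ a) = Re (u h $ b)"
      by (rule const) (use arg_cong[OF left_eigenvector[OF hN], of Re] in \<open>simp add: lam1\<close>)
    show "Im (u h $ a) = Im (u h $ b)"
      by (rule const) (use arg_cong[OF left_eigenvector[OF hN], of Im] in \<open>simp add: lam1\<close>)
  qed
  then obtain z where z: "\<And>a. u h $ a = z" by metis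
  have one: "1 \<in> {1..CARD('n)}" using h by simp
  obtain w where w: "\<And>a. u 1 $ a = w" using left_eigenvector_1 by metis
  \<comment> \<open>Both sides are \<open>z * w\<close> times the sum of the entries of
    \<open>v h\<close>; biorthogonality makes the left side w and the right side 0.\<close>
  have "scalar_product (u h) (v h) * w = z * scalar_product (u 1) (v h)"
    unfolding scalar_product_def by (simp add: z w sum_distrib_left sum_distrib_right mult_ac del: One_nat_def)
  then have "w = 0" using scalar_product_eigenvectors[OF hN hN] scalar_product_eigenvectors[OF one hN] h1 by simp
  then have "scalar_product (u 1) (v 1) = 0" unfolding scalar_product_def by (simp add: w del: One_nat_def)
  then show False using scalar_product_eigenvectors[OF one one] by simp
qed

end

section \<open>The reinforced processes\<close>

context interacting_rsp
begin

section \<open>Filtration, measurability and ranges\<close>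

definition history :: "nat \<Rightarrow> 'w measure" where
  "history n = rsp_filtration M (Z 0) X n"

definition success_prob :: "nat \<Rightarrow> 'w \<Rightarrow> 'n \<Rightarrow> real" where
  "success_prob n \<omega> a = (\<Sum>b\<in>UNIV. W $ b $ a * Z n \<omega> $ b)"

definition innovation :: "nat \<Rightarrow> 'w \<Rightarrow> 'n \<Rightarrow> real" where
  "innovation n \<omega> a = X (Suc n) \<omega> $ a - success_prob n \<omega> a"

lemma history_gen:
  "{Z 0 -` B \<inter> space M | B. B \<in> sets borel} \<union>
        {X m -` B \<inter> space M | m B. m \<in> {1..n} \<and> B \<in> sets borel} \<subseteq> sets M"
  using measurable_sets[OF Z0_measurable] measurable_sets[OF X_measurable] by auto

lemma space_history[simp]: "space (history n) = space M"
  unfolding history_def rsp_filtration_def by (intro space_measure_of) auto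

lemma sets_history: "sets (history n) = sigma_sets (space M) ({Z 0 -` B \<inter> space M | B. B \<in> sets borel} \<union>
        {X m -` B \<inter> space M | m B. m \<in> {1..n} \<and> B \<in> sets borel})"
  unfolding history_def rsp_filtration_def by (intro sets_measure_of) auto

lemma subalgebra_history: "subalgebra M (history n)"
  unfolding subalgebra_def using sets.sigma_sets_subset[OF history_gen] by (simp add: sets_history)

lemma history_mono: "sets (history n) \<subseteq> sets (history (Suc n))"
proof -
  have "m \<in> {1..n} \<Longrightarrow> m \<in> {1..Suc n}" for m by simp
  then show ?thesis unfolding sets_history by (intro sigma_sets_mono' Un_mono) blast+
qed

lemma history_le: "m \<le> n \<Longrightarrow> subalgebra (history n) (history m)"
  using lift_Suc_mono_le[of "\<lambda>n. sets (history n)"] history_mono by (auto simp: subalgebra_def)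

lemma Z0_history: "Z 0 \<in> borel_measurable (history n)"
  by (rule measurableI) (auto simp: sets_history intro!: sigma_sets.Basic)

lemma X_history: "m \<in> {1..n} \<Longrightarrow> X m \<in> borel_measurable (history n)"
  by (rule measurableI) (auto simp: sets_history intro!: sigma_sets.Basic)

lemma nth_measurable: "f \<in> borel_measurable N \<Longrightarrow> (\<lambda>\<omega>. f \<omega> $ a) \<in> borel_measurable N"
  for f :: "'w \<Rightarrow> real ^ 'n"
  by (rule borel_measurable_continuous_on[where f = "\<lambda>x. x $ a"]) (auto intro: continuous_intros)

lemma Z_nth_history: "(\<lambda>\<omega>. Z n \<omega> $ a) \<in> borel_measurable (history n)"
proof (induction n)
  case 0
  show ?case by (rule nth_measurable[OF Z0_history])
next
  case (Suc n)
  have [measurable]: "(\<lambda>\<omega>. Z n \<omega> $ a) \<in> borel_measurable (history (Suc n))"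
    using measurable_from_subalg[OF history_le Suc] by simp
  have [measurable]: "(\<lambda>\<omega>. X (Suc n) \<omega> $ a) \<in> borel_measurable (history (Suc n))"
    by (rule nth_measurable[OF X_history]) simp
  have "(\<lambda>\<omega>. (1 - r n) * Z n \<omega> $ a + r n * X (Suc n) \<omega> $ a) \<in> borel_measurable (history (Suc n))"
    by measurable
  then show ?case by (subst measurable_cong) (auto simp: Z_step)
qed

lemma success_prob_history: "(\<lambda>\<omega>. success_prob n \<omega> a) \<in> borel_measurable (history n)"
  unfolding success_prob_def by (intro borel_measurable_sum borel_measurable_times borel_measurable_const Z_nth_history)

lemma innovation_history: "(\<lambda>\<omega>. innovation n \<omega> a) \<in> borel_measurable (history (Suc n))"
  unfolding innovation_def using measurable_from_subalg[OF history_le success_prob_history]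
  by (intro borel_measurable_diff nth_measurable X_history) auto

lemma Z_nth_meas[measurable]: "(\<lambda>\<omega>. Z n \<omega> $ a) \<in> borel_measurable M"
  using measurable_from_subalg[OF subalgebra_history Z_nth_history] .

lemma success_prob_meas[measurable]: "(\<lambda>\<omega>. success_prob n \<omega> a) \<in> borel_measurable M"
  using measurable_from_subalg[OF subalgebra_history success_prob_history] .

lemma X_nth_meas[measurable]: "(\<lambda>\<omega>. X (Suc n) \<omega> $ a) \<in> borel_measurable M"
  by (intro nth_measurable X_measurable) simp

lemma Z_range: "\<omega> \<in> space M \<Longrightarrow> Z n \<omega> $ a \<in> {0..1}"
proof (induction n)
  case 0
  then show ?case by (rule Z0_range)
next
  case (Suc n)
  have r: "0 \<le> r n" "r n < 1" using r_range by auto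
  have z: "0 \<le> Z n \<omega> $ a" "Z n \<omega> $ a \<le> 1" using Suc by auto
  have x: "0 \<le> X (Suc n) \<omega> $ a" "X (Suc n) \<omega> $ a \<le> 1" using X_range[of "Suc n" \<omega> a] Suc.prems by auto
  have "Z (Suc n) \<omega> $ a = (1 - r n) * Z n \<omega> $ a + r n * X (Suc n) \<omega> $ a"
    using Suc.prems by (simp add: Z_step)
  moreover have "\<dots> \<le> (1 - r n) * 1 + r n * 1"
    using r z x by (intro add_mono mult_left_mono) auto
  moreover have "0 \<le> (1 - r n) * Z n \<omega> $ a + r n * X (Suc n) \<omega> $ a"
    using r z x by (intro add_nonneg_nonneg mult_nonneg_nonneg) auto
  ultimately show ?case by simp
qed

lemma W_column_sum: "(\<Sum>b\<in>UNIV. W $ b $ a) = 1"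
  using arg_cong[OF W_stochastic, of "\<lambda>x. x $ a"]
  by (simp add: matrix_vector_mult_def vector_matrix_mult_def transpose_def)

lemma success_prob_range: "\<omega> \<in> space M \<Longrightarrow> success_prob n \<omega> a \<in> {0..1}"
proof -
  assume w: "\<omega> \<in> space M"
  have "success_prob n \<omega> a \<le> (\<Sum>b\<in>UNIV. W $ b $ a * 1)"
    unfolding success_prob_def using Z_range[OF w] W_nonneg by (intro sum_mono mult_left_mono) auto
  moreover have "0 \<le> success_prob n \<omega> a"
    unfolding success_prob_def using Z_range[OF w] W_nonneg by (intro sum_nonneg mult_nonneg_nonneg) auto
  ultimately show ?thesis by (simp add: W_column_sum)
qed

lemma X_01: "\<omega> \<in> space M \<Longrightarrow> X (Suc n) \<omega> $ a = 0 \<or> X (Suc n) \<omega> $ a = 1"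
  using X_range[of "Suc n" \<omega> a] by simp

lemma innovation_bound: "\<omega> \<in> space M \<Longrightarrow> \<bar>innovation n \<omega> a\<bar> \<le> 1"
  using X_01[of \<omega> n a] success_prob_range[of \<omega> n a] unfolding innovation_def by auto

section \<open>Conditional moments of the innovations\<close>

text \<open>Trades an almost everywhere identity between conditional probabilities for an integral
  identity against bounded functions of the history, the form in which the array conditions are
  stated.\<close>

lemma expectation_cond:
  assumes U: "U \<in> borel_measurable (history n)" and UC: "\<And>\<omega>. \<omega> \<in> space M \<Longrightarrow> \<bar>U \<omega>\<bar> \<le> (C :: real)"
    and A: "A \<in> sets M" and p: "AE \<omega> in M. real_cond_exp M (history n) (indicator A) \<omega> = p \<omega>"
    and p_meas[measurable]: "p \<in> borel_measurable M"
  shows "expectation (\<lambda>\<omega>. U \<omega> * indicator A \<omega>) = expectation (\<lambda>\<omega>. U \<omega> * p \<omega>)"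
proof -
  interpret F: finite_measure_subalgebra M "history n"
    using subalgebra_history by unfold_locales
  have [measurable]: "U \<in> borel_measurable M" using measurable_from_subalg[OF subalgebra_history U] .
  note [measurable] = A
  have "integrable M (\<lambda>\<omega>. U \<omega> * indicator A \<omega>)"
    using UC by (intro integrable_const_bound[where B = C] AE_I2)
      (auto simp: indicator_def intro: order_trans[OF abs_ge_zero])
  from F.real_cond_exp_intg(2)[OF this U]
  have "expectation (\<lambda>\<omega>. U \<omega> * indicator A \<omega>) = expectation (\<lambda>\<omega>. U \<omega> * real_cond_exp M (history n) (indicator A) \<omega>)"
    by simp
  also have "\<dots> = expectation (\<lambda>\<omega>. U \<omega> * p \<omega>)"
    by (rule integral_cong_AE) (use p in auto)
  finally show ?thesis .
qed

lemma expectation_X: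
  assumes U: "U \<in> borel_measurable (history n)" and UC: "\<And>\<omega>. \<omega> \<in> space M \<Longrightarrow> \<bar>U \<omega>\<bar> \<le> (C :: real)"
  shows "expectation (\<lambda>\<omega>. U \<omega> * X (Suc n) \<omega> $ a) = expectation (\<lambda>\<omega>. U \<omega> * success_prob n \<omega> a)"
proof -
  let ?A = "{\<omega>' \<in> space M. X (Suc n) \<omega>' $ a = 1}"
  have "expectation (\<lambda>\<omega>. U \<omega> * X (Suc n) \<omega> $ a) = expectation (\<lambda>\<omega>. U \<omega> * indicator ?A \<omega>)"
    by (rule Bochner_Integration.integral_cong) (use X_01 in \<open>force simp: indicator_def\<close>)+
  also have "\<dots> = expectation (\<lambda>\<omega>. U \<omega> * success_prob n \<omega> a)"
    by (rule expectation_cond[OF U UC]) (use X_cond_prob[of n a] in \<open>simp_all add: history_def success_prob_def\<close>)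
  finally show ?thesis .
qed

lemma expectation_XX:
  assumes U: "U \<in> borel_measurable (history n)" and UC: "\<And>\<omega>. \<omega> \<in> space M \<Longrightarrow> \<bar>U \<omega>\<bar> \<le> (C :: real)"
    and ab: "a \<noteq> b"
  shows "expectation (\<lambda>\<omega>. U \<omega> * (X (Suc n) \<omega> $ a * X (Suc n) \<omega> $ b)) = expectation (\<lambda>\<omega>. U \<omega> * (success_prob n \<omega> a * success_prob n \<omega> b))"
proof -
  interpret F: finite_measure_subalgebra M "history n"
    using subalgebra_history by unfold_locales
  \<comment> \<open>Full sets at the other indices reduce the product formula over all coordinates
    to the pair a, b; their conditional probabilities are 1 almost everywhere.\<close>
  define B where "B l = (if l = a \<or> l = b then {1 :: real} else UNIV)" for l
  have [measurable]: "B l \<in> sets borel" for l by (simp add: B_def)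
  let ?A = "{\<omega>' \<in> space M. \<forall>l. X (Suc n) \<omega>' $ l \<in> B l}"
  let ?c = "\<lambda>l. real_cond_exp M (history n) (indicator {\<omega>' \<in> space M. X (Suc n) \<omega>' $ l \<in> B l})"
  have A: "?A = {\<omega>' \<in> space M. X (Suc n) \<omega>' $ a = 1 \<and> X (Suc n) \<omega>' $ b = 1}" by (auto simp: B_def)
  have ae1: "AE \<omega> in M. real_cond_exp M (history n) (indicator ?A) \<omega> = (\<Prod>l\<in>UNIV. ?c l \<omega>)"
    using X_cond_indep[of n] unfolding cond_indep_vars_def history_def[symmetric] by (simp add: B_def)
  have ae2: "AE \<omega> in M. ?c l \<omega> = (if l = a \<or> l = b then success_prob n \<omega> l else 1)" for l
  proof (cases "l = a \<or> l = b")
    case True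
    then show ?thesis using X_cond_prob[of n l] by (auto simp: history_def success_prob_def B_def)
  next
    case False
    have "AE \<omega> in M. real_cond_exp M (history n) (indicator (space M)) \<omega> = indicator (space M) \<omega>"
      by (intro F.real_cond_exp_F_meas integrable_real_indicator)
        (auto intro!: borel_measurable_indicator simp: emeasure_space_1 sets.top[of "history n", simplified])
    then have "AE \<omega> in M. real_cond_exp M (history n) (indicator (space M)) \<omega> = 1"
      using AE_space by eventually_elim simp
    then show ?thesis using False by (simp add: B_def)
  qed
  have "AE \<omega> in M. \<forall>l. ?c l \<omega> = (if l = a \<or> l = b then success_prob n \<omega> l else 1)"
    using ae2 by (subst AE_all_countable) auto
  then have ae: "AE \<omega> in M. real_cond_exp M (history n) (indicator ?A) \<omega> = success_prob n \<omega> a * success_prob n \<omega> b"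
    using ae1
  proof eventually_elim
    case (elim \<omega>)
    have "(\<Prod>l\<in>UNIV. ?c l \<omega>) = (\<Prod>l\<in>UNIV. if l \<in> {a, b} then success_prob n \<omega> l else 1)"
      using elim(1) by (intro prod.cong) auto
    also have "\<dots> = (\<Prod>l\<in>{a, b}. success_prob n \<omega> l)" by (subst prod.If_cases) (auto intro!: prod.cong)
    finally show ?case using elim(2) ab by simp
  qed
  have "expectation (\<lambda>\<omega>. U \<omega> * (X (Suc n) \<omega> $ a * X (Suc n) \<omega> $ b)) = expectation (\<lambda>\<omega>. U \<omega> * indicator ?A \<omega>)"
    unfolding A using X_01 by (intro Bochner_Integration.integral_cong) (force simp: indicator_def)+
  also have "\<dots> = expectation (\<lambda>\<omega>. U \<omega> * (success_prob n \<omega> a * success_prob n \<omega> b))"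
    by (rule expectation_cond[OF U UC _ ae]) (simp_all add: A)
  finally show ?thesis .
qed

lemma bounded_integrable:
  assumes "f \<in> borel_measurable M" "\<And>\<omega>. \<omega> \<in> space M \<Longrightarrow> \<bar>f \<omega>\<bar> \<le> (C :: real)"
  shows "integrable M f"
  using assms by (intro integrable_const_bound[where B = C]) auto

lemma abs_mult_le_bound:
  assumes "\<bar>x\<bar> \<le> C" "\<bar>y\<bar> \<le> (1::real)"
  shows "\<bar>x * y\<bar> \<le> C"
  using mult_mono[OF assms] assms by (simp add: abs_mult)

lemma expectation_innovation:
  assumes U: "U \<in> borel_measurable (history n)" and UC: "\<And>\<omega>. \<omega> \<in> space M \<Longrightarrow> \<bar>U \<omega>\<bar> \<le> (C :: real)"
  shows "expectation (\<lambda>\<omega>. U \<omega> * innovation n \<omega> a) = 0"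
proof -
  have [measurable]: "U \<in> borel_measurable M" using measurable_from_subalg[OF subalgebra_history U] .
  have x1: "\<bar>X (Suc n) \<omega> $ a\<bar> \<le> 1" and q1: "\<bar>success_prob n \<omega> a\<bar> \<le> 1" if "\<omega> \<in> space M" for \<omega>
    using X_01[OF that, of n a] success_prob_range[OF that, of n a] by auto
  have "integrable M (\<lambda>\<omega>. U \<omega> * X (Suc n) \<omega> $ a)" "integrable M (\<lambda>\<omega>. U \<omega> * success_prob n \<omega> a)"
    by (rule bounded_integrable[where C = C], simp, rule abs_mult_le_bound[OF UC], assumption, erule x1 q1)+
  then show ?thesis
    using expectation_X[OF U UC, of a] by (simp add: innovation_def right_diff_distrib)
qed

text \<open>Given the history, the innovations are centred Bernoulli variables, uncorrelated across
  coordinates: on the diagonal the square of X is X itself, off it conditional independence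
  factorises the mixed moment.\<close>

lemma expectation_innovation_mult:
  assumes U: "U \<in> borel_measurable (history n)" and UC: "\<And>\<omega>. \<omega> \<in> space M \<Longrightarrow> \<bar>U \<omega>\<bar> \<le> (C :: real)"
  shows "expectation (\<lambda>\<omega>. U \<omega> * (innovation n \<omega> a * innovation n \<omega> b)) =
    expectation (\<lambda>\<omega>. U \<omega> * (if a = b then success_prob n \<omega> a * (1 - success_prob n \<omega> a) else 0))"
proof -
  have [measurable]: "U \<in> borel_measurable M" using measurable_from_subalg[OF subalgebra_history U] .
  have x1: "\<bar>X (Suc n) \<omega> $ a\<bar> \<le> 1" and q1: "\<bar>success_prob n \<omega> a\<bar> \<le> 1" if "\<omega> \<in> space M" for \<omega> a
    using X_01[OF that, of n a] success_prob_range[OF that, of n a] by auto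
  have Uq: "(\<lambda>\<omega>. U \<omega> * success_prob n \<omega> a) \<in> borel_measurable (history n)" for a
    using U success_prob_history by (rule borel_measurable_times)
  have UqC: "\<bar>U \<omega> * success_prob n \<omega> a\<bar> \<le> C" if "\<omega> \<in> space M" for \<omega> a
    using abs_mult_le_bound[OF UC q1] that by blast
  have UxC: "\<bar>U \<omega> * X (Suc n) \<omega> $ a\<bar> \<le> C" if "\<omega> \<in> space M" for \<omega> a
    using abs_mult_le_bound[OF UC x1] that by blast
  have i1: "integrable M (\<lambda>\<omega>. U \<omega> * success_prob n \<omega> a * X (Suc n) \<omega> $ b)"
    and i2: "integrable M (\<lambda>\<omega>. U \<omega> * success_prob n \<omega> a * success_prob n \<omega> b)"
    and i3: "integrable M (\<lambda>\<omega>. U \<omega> * X (Suc n) \<omega> $ a * X (Suc n) \<omega> $ b)"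
    and i4: "integrable M (\<lambda>\<omega>. U \<omega> * success_prob n \<omega> a)"
    and i5: "integrable M (\<lambda>\<omega>. U \<omega> * X (Suc n) \<omega> $ a)" for a b
    by (rule bounded_integrable[where C = C], simp,
      (erule UqC UxC | rule abs_mult_le_bound, erule UqC UxC, erule x1 q1))+
  have eqX: "expectation (\<lambda>\<omega>. U \<omega> * success_prob n \<omega> a * X (Suc n) \<omega> $ b) = expectation (\<lambda>\<omega>. U \<omega> * success_prob n \<omega> a * success_prob n \<omega> b)" for a b
    by (rule expectation_X[OF Uq UqC])
  have "expectation (\<lambda>\<omega>. U \<omega> * (innovation n \<omega> a * innovation n \<omega> b)) =
    expectation (\<lambda>\<omega>. U \<omega> * X (Suc n) \<omega> $ a * X (Suc n) \<omega> $ b - U \<omega> * success_prob n \<omega> a * X (Suc n) \<omega> $ b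
       - U \<omega> * success_prob n \<omega> b * X (Suc n) \<omega> $ a + U \<omega> * success_prob n \<omega> a * success_prob n \<omega> b)"
    by (rule Bochner_Integration.integral_cong) (auto simp: innovation_def algebra_simps)
  also have "\<dots> = expectation (\<lambda>\<omega>. U \<omega> * X (Suc n) \<omega> $ a * X (Suc n) \<omega> $ b)
       - expectation (\<lambda>\<omega>. U \<omega> * success_prob n \<omega> b * success_prob n \<omega> a)"
    using i1 i2 i3 by (simp add: eqX)
  finally have eq: "expectation (\<lambda>\<omega>. U \<omega> * (innovation n \<omega> a * innovation n \<omega> b)) = expectation (\<lambda>\<omega>. U \<omega> * X (Suc n) \<omega> $ a * X (Suc n) \<omega> $ b)
       - expectation (\<lambda>\<omega>. U \<omega> * success_prob n \<omega> b * success_prob n \<omega> a)" .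
  show ?thesis
  proof (cases "a = b")
    case True
    have "expectation (\<lambda>\<omega>. U \<omega> * X (Suc n) \<omega> $ a * X (Suc n) \<omega> $ a) = expectation (\<lambda>\<omega>. U \<omega> * X (Suc n) \<omega> $ a)"
      by (rule Bochner_Integration.integral_cong) (use X_01 in force)+
    also have "\<dots> = expectation (\<lambda>\<omega>. U \<omega> * success_prob n \<omega> a)" by (rule expectation_X[OF U UC])
    finally show ?thesis using eq True i4 i2 by (simp add: right_diff_distrib mult.assoc[symmetric])
  next
    case False
    then show ?thesis using eq expectation_XX[OF U UC False] by (simp add: mult_ac)
  qed
qed

end

section \<open>Reduction of the difference of two coordinates to a martingale array\<close>

text \<open>The left side is a quadratic form at the difference of two unit vectors. Symmetry of S
  enters because \<open>diff_var\<close> counts the entry (j, k) twice instead of (j, k) and (k,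
  j).\<close>

lemma diff_var_U_S_UT:
  fixes u :: "nat \<Rightarrow> complex ^ 'n"
  assumes sym: "\<And>h l. S h l = S l h"
  shows "diff_var (U_S_UT u S) j k =
    (\<Sum>h=2..CARD('n). \<Sum>l=2..CARD('n). (u h $ j - u h $ k) * (u l $ j - u l $ k) * S h l)"
proof -
  let ?s = "\<lambda>a b. \<Sum>h=2..CARD('n). \<Sum>l=2..CARD('n). u h $ a * S h l * u l $ b"
  have "?s k j = ?s j k"
    by (subst sum.swap) (intro sum.cong refl, subst sym, simp)
  then have "diff_var (U_S_UT u S) j k = ?s j j - ?s j k - ?s k j + ?s k k"
    by (simp add: diff_var_def U_S_UT_def)
  also have "\<dots> = (\<Sum>h=2..CARD('n). \<Sum>l=2..CARD('n). (u h $ j - u h $ k) * (u l $ j - u l $ k) * S h l)"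
    unfolding sum_subtractf[symmetric] sum.distrib[symmetric]
    by (intro sum.cong refl) (simp add: algebra_simps)
  finally show ?thesis .
qed

context interacting_rsp
begin

text \<open>The kernel applied to a real vector. Passing to real parts at once keeps the sums below
  over the reals, and it respects the recursion, whose coefficients are real.\<close>

definition propagate :: "(nat \<Rightarrow> complex) \<Rightarrow> (nat \<Rightarrow> complex ^ 'n) \<Rightarrow> (nat \<Rightarrow> complex ^ 'n) \<Rightarrow>
    nat \<Rightarrow> nat \<Rightarrow> 'n \<Rightarrow> ('n \<Rightarrow> real) \<Rightarrow> real" where
  "propagate lam u v m n a y = (\<Sum>i\<in>UNIV. Re (kern r lam u v m n a i) * y i)"

lemma propagate_same:
  assumes "spectral_system W lam u v"
  shows "propagate lam u v n n a y = y a"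
  unfolding propagate_def kern_same[OF assms] by (simp add: if_distrib[of Re] if_distrib[of "\<lambda>x. x * _"] cong: if_cong)

lemma propagate_Suc:
  assumes "spectral_system W lam u v" "m \<le> n"
  shows "propagate lam u v m (Suc n) a y = (1 - r n) * propagate lam u v m n a y +
    r n * (\<Sum>b\<in>UNIV. W $ b $ a * propagate lam u v m n b y)"
proof -
  have "(\<Sum>b\<in>UNIV. W $ b $ a * propagate lam u v m n b y) =
    (\<Sum>i\<in>UNIV. \<Sum>b\<in>UNIV. W $ b $ a * Re (kern r lam u v m n b i) * y i)"
    unfolding propagate_def sum_distrib_left by (subst sum.swap) (simp add: mult.assoc)
  then show ?thesis
    unfolding propagate_def kern_Suc[OF assms]
    by (simp add: sum_distrib_left sum_distrib_right sum.distrib[symmetric] algebra_simps)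
qed

text \<open>Variation of constants: X is \<open>W\<^sup>T Z\<close> plus the innovation, so Z solves
  a linear recursion with forcing \<open>r m * innovation m\<close>, and each forcing term is
  propagated from the step after it.\<close>

lemma Z_decomposition:
  assumes "spectral_system W lam u v" "\<omega> \<in> space M"
  shows "Z n \<omega> $ a = propagate lam u v 0 n a (\<lambda>i. Z 0 \<omega> $ i) +
    (\<Sum>m<n. r m * propagate lam u v (Suc m) n a (innovation m \<omega>))"
proof (induction n arbitrary: a)
  case 0
  show ?case by (simp add: propagate_same[OF assms(1)])
next
  case (Suc n)
  let ?L = "propagate lam u v"
  have "Z (Suc n) \<omega> $ a = (1 - r n) * Z n \<omega> $ a + r n * (\<Sum>b\<in>UNIV. W $ b $ a * Z n \<omega> $ b) + r n * innovation n \<omega> a"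
    using assms(2) by (simp add: Z_step innovation_def success_prob_def algebra_simps)
  also have "\<dots> = ?L 0 (Suc n) a (\<lambda>i. Z 0 \<omega> $ i) +
    (\<Sum>m<n. r m * ?L (Suc m) (Suc n) a (innovation m \<omega>)) + r n * innovation n \<omega> a"
  proof -
    have "(\<Sum>m<n. r m * ?L (Suc m) (Suc n) a (innovation m \<omega>)) =
      (1 - r n) * (\<Sum>m<n. r m * ?L (Suc m) n a (innovation m \<omega>)) +
      r n * (\<Sum>b\<in>UNIV. W $ b $ a * (\<Sum>m<n. r m * ?L (Suc m) n b (innovation m \<omega>)))"
    proof -
      have "(\<Sum>b\<in>UNIV. W $ b $ a * (\<Sum>m<n. r m * ?L (Suc m) n b (innovation m \<omega>))) =
        (\<Sum>m<n. r m * (\<Sum>b\<in>UNIV. W $ b $ a * ?L (Suc m) n b (innovation m \<omega>)))"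
        unfolding sum_distrib_left by (subst sum.swap) (simp add: mult_ac)
      moreover have "(\<Sum>m<n. r m * ?L (Suc m) (Suc n) a (innovation m \<omega>)) = (\<Sum>m<n. (1 - r n) * (r m * ?L (Suc m) n a (innovation m \<omega>)) +
        r n * (r m * (\<Sum>b\<in>UNIV. W $ b $ a * ?L (Suc m) n b (innovation m \<omega>))))"
        by (intro sum.cong refl) (simp add: propagate_Suc[OF assms(1)] Suc_le_eq distrib_left mult_ac)
      ultimately show ?thesis by (simp add: sum.distrib sum_distrib_left)
    qed
    moreover have "?L 0 (Suc n) a (\<lambda>i. Z 0 \<omega> $ i) = (1 - r n) * ?L 0 n a (\<lambda>i. Z 0 \<omega> $ i) +
      r n * (\<Sum>b\<in>UNIV. W $ b $ a * ?L 0 n b (\<lambda>i. Z 0 \<omega> $ i))"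
      by (rule propagate_Suc[OF assms(1)]) simp
    moreover have "(\<Sum>b\<in>UNIV. W $ b $ a * Z n \<omega> $ b) = (\<Sum>b\<in>UNIV. W $ b $ a * ?L 0 n b (\<lambda>i. Z 0 \<omega> $ i)) +
      (\<Sum>b\<in>UNIV. W $ b $ a * (\<Sum>m<n. r m * ?L (Suc m) n b (innovation m \<omega>)))"
      unfolding Suc.IH by (simp add: distrib_left sum.distrib)
    ultimately show ?thesis unfolding Suc.IH[of a] by (simp add: algebra_simps)
  qed
  finally show ?case by (simp add: propagate_same[OF assms(1)])
qed

text \<open>All three regimes pass through this lemma: a is the normalisation and
  \<open>\<sigma> h l\<close> the limit of the normalised \<open>prod_sum2\<close>. The fourth-power
  condition serves twice, bounding the largest weight in a row and the influence of
  \<open>Z 0\<close>.\<close>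

lemma stable_clt_difference:
  fixes a :: "nat \<Rightarrow> real" and \<sigma> :: "nat \<Rightarrow> nat \<Rightarrow> complex" and Zinf :: "'w \<Rightarrow> real" and j k :: 'n
  assumes spectral: "spectral_system W lam u v"
    and Zinf[measurable]: "Zinf \<in> borel_measurable M"
    and Zinf_range: "\<And>\<omega>. \<omega> \<in> space M \<Longrightarrow> Zinf \<omega> \<in> {0..1}"
    and Zinf_limit: "AE \<omega> in M. (\<lambda>n. Z n \<omega>) \<longlonglongrightarrow> Zinf \<omega> *\<^sub>R 1"
    and a0: "\<And>n. 0 \<le> a n" and \<sigma>_sym: "\<And>h l. \<sigma> h l = \<sigma> l h"
    and lim4: "\<And>h. h \<in> {2..CARD('n)} \<Longrightarrow> (\<lambda>n. (a n) ^ 4 * prod_sum4 r (1 - lam h) n) \<longlonglongrightarrow> 0"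
    and lim2: "\<And>h l. h \<in> {2..CARD('n)} \<Longrightarrow> l \<in> {2..CARD('n)} \<Longrightarrow>
      (\<lambda>n. of_real ((a n)\<^sup>2) * prod_sum2 r (1 - lam h) (1 - lam l) n) \<longlonglongrightarrow> \<sigma> h l"
  defines "V \<equiv> diff_var (U_S_UT u (\<lambda>h l. \<sigma> h l * scalar_product (v h) (v l))) j k"
  shows "V \<in> \<real> \<and> stably_converges_normal M (\<lambda>n \<omega>. a n * (Z n \<omega> $ j - Z n \<omega> $ k))
     (\<lambda>\<omega>. Zinf \<omega> * (1 - Zinf \<omega>) * Re V)"
proof -
  define g where "g h = u h $ j - u h $ k" for h
  define d where "d m n i = Re (kern r lam u v m n j i) - Re (kern r lam u v m n k i)" for m n i
  define b where "b n m i = a n * r m * d (Suc m) n i" for n m i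
  define G where "G h = (\<Sum>i\<in>UNIV. cmod (g h) * cmod (v h $ i))" for h
  \<comment> \<open>One fourth power is at most the sum of all, so fourth roots of
    \<open>prod_sum4\<close> dominate each weight; its extra summand lets the same sequence dominate
    the initial term.\<close>
  define \<beta> where "\<beta> n = (\<Sum>h=2..CARD('n). G h * root 4 ((a n) ^ 4 * prod_sum4 r (1 - lam h) n))" for n
  define B where B: "B n m = (\<Sum>i\<in>UNIV. \<bar>b n m i\<bar>)" for n m
  have r0: "0 \<le> r n" for n using r_range by blast
  \<comment> \<open>Only \<open>kern_real\<close> identifies the real parts taken in d with the full
    complex difference.\<close>
  have d_complex: "complex_of_real (d m n i) = (\<Sum>h=2..CARD('n). g h * recursion_prod r (1 - lam h) m n * v h $ i)"
    if "m \<le> n" for m n i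
    using kern_diff[OF spectral, of r m n j i k] kern_real[OF spectral that, of r] unfolding d_def g_def
    by simp
  have d_bound: "(\<Sum>i\<in>UNIV. \<bar>d m n i\<bar>) \<le> (\<Sum>h=2..CARD('n). G h * cmod (recursion_prod r (1 - lam h) m n))"
    if "m \<le> n" for m n
  proof -
    have "\<bar>d m n i\<bar> \<le> (\<Sum>h=2..CARD('n). cmod (g h) * cmod (v h $ i) * cmod (recursion_prod r (1 - lam h) m n))" for i
      unfolding norm_of_real[of "d m n i", where 'a = complex, symmetric] d_complex[OF that]
      by (rule order_trans[OF norm_sum]) (simp add: norm_mult mult_ac)
    then have "(\<Sum>i\<in>UNIV. \<bar>d m n i\<bar>) \<le> (\<Sum>i\<in>UNIV. \<Sum>h=2..CARD('n). cmod (g h) * cmod (v h $ i) * cmod (recursion_prod r (1 - lam h) m n))"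
      by (rule sum_mono)
    also have "\<dots> = (\<Sum>h=2..CARD('n). G h * cmod (recursion_prod r (1 - lam h) m n))"
      unfolding G_def sum_distrib_right by (rule sum.swap)
    finally show ?thesis .
  qed
  have G0: "0 \<le> G h" for h unfolding G_def by (intro sum_nonneg) auto
  have root_le: "x \<le> root 4 y" if "0 \<le> x" "x ^ 4 \<le> y" for x y :: real
    using real_root_le_mono[of 4 "x ^ 4" y] that by (simp add: real_root_power_cancel)
  have \<beta>: "\<beta> \<longlonglongrightarrow> 0"
  proof -
    have "\<beta> \<longlonglongrightarrow> (\<Sum>h=2..CARD('n). G h * root 4 0)"
      unfolding \<beta>_def by (intro tendsto_intros lim4)
    then show ?thesis by simp
  qed
  have B_le: "B n m \<le> \<beta> n" if "m < n" for n m
  proof -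
    have "B n m = a n * r m * (\<Sum>i\<in>UNIV. \<bar>d (Suc m) n i\<bar>)"
      unfolding B b_def by (simp add: abs_mult a0 r0 sum_distrib_left)
    also have "\<dots> \<le> a n * r m * (\<Sum>h=2..CARD('n). G h * cmod (recursion_prod r (1 - lam h) (Suc m) n))"
      using that by (intro mult_left_mono d_bound mult_nonneg_nonneg a0 r0) auto
    also have "\<dots> = (\<Sum>h=2..CARD('n). G h * (a n * (r m * cmod (recursion_prod r (1 - lam h) (Suc m) n))))"
      by (simp add: sum_distrib_left mult_ac)
    also have "\<dots> \<le> \<beta> n"
      unfolding \<beta>_def
    proof (intro sum_mono mult_left_mono G0 root_le)
      fix h
      have "(r m * cmod (recursion_prod r (1 - lam h) (Suc m) n)) ^ 4 \<le>
        (\<Sum>m<n. (r m * cmod (recursion_prod r (1 - lam h) (Suc m) n)) ^ 4)"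
        using that by (intro member_le_sum) auto
      then have "(r m * cmod (recursion_prod r (1 - lam h) (Suc m) n)) ^ 4 \<le> prod_sum4 r (1 - lam h) n"
        unfolding prod_sum4_def by (simp add: add_increasing)
      then show "(a n * (r m * cmod (recursion_prod r (1 - lam h) (Suc m) n))) ^ 4 \<le> (a n) ^ 4 * prod_sum4 r (1 - lam h) n"
        unfolding power_mult_distrib[of "a n"] by (intro mult_left_mono) auto
    qed (intro mult_nonneg_nonneg a0 r0 norm_ge_zero)
    finally show ?thesis .
  qed
  have init_le: "\<bar>a n * (\<Sum>i\<in>UNIV. d 0 n i * Z 0 \<omega> $ i)\<bar> \<le> \<beta> n" if \<omega>: "\<omega> \<in> space M" for n \<omega>
  proof -
    have "\<bar>\<Sum>i\<in>UNIV. d 0 n i * Z 0 \<omega> $ i\<bar> \<le> (\<Sum>i\<in>UNIV. \<bar>d 0 n i\<bar> * 1)"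
      using Z0_range[OF \<omega>] by (intro order_trans[OF sum_abs] sum_mono) (auto simp: abs_mult intro!: mult_left_le)
    then have "\<bar>a n * (\<Sum>i\<in>UNIV. d 0 n i * Z 0 \<omega> $ i)\<bar> \<le> a n * (\<Sum>i\<in>UNIV. \<bar>d 0 n i\<bar>)"
      unfolding abs_mult using a0[of n] by (intro mult_mono) auto
    also have "\<dots> \<le> a n * (\<Sum>h=2..CARD('n). G h * cmod (recursion_prod r (1 - lam h) 0 n))"
      by (intro mult_left_mono d_bound a0) simp
    also have "\<dots> = (\<Sum>h=2..CARD('n). G h * (a n * cmod (recursion_prod r (1 - lam h) 0 n)))"
      by (simp add: sum_distrib_left mult_ac)
    also have "\<dots> \<le> \<beta> n"
      unfolding \<beta>_def
    proof (intro sum_mono mult_left_mono G0 root_le)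
      fix h
      have "cmod (recursion_prod r (1 - lam h) 0 n) ^ 4 \<le> prod_sum4 r (1 - lam h) n"
        unfolding prod_sum4_def by (simp add: sum_nonneg)
      then show "(a n * cmod (recursion_prod r (1 - lam h) 0 n)) ^ 4 \<le> (a n) ^ 4 * prod_sum4 r (1 - lam h) n"
        unfolding power_mult_distrib[of "a n"] by (intro mult_left_mono) auto
    qed (intro mult_nonneg_nonneg a0 norm_ge_zero)
    finally show ?thesis .
  qed
  \<comment> \<open>The total squared weight of row n; apart from the Bernoulli variances it is the
    conditional variance of the row.\<close>
  define s where "s n = (\<Sum>m<n. \<Sum>i\<in>UNIV. (b n m i)\<^sup>2)" for n
  have s_complex: "complex_of_real (s n) = (\<Sum>h=2..CARD('n). \<Sum>l=2..CARD('n).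
     g h * g l * ((of_real ((a n)\<^sup>2) * prod_sum2 r (1 - lam h) (1 - lam l) n) * scalar_product (v h) (v l)))" for n
  proof -
    let ?p = "\<lambda>m h. recursion_prod r (1 - lam h) (Suc m) n"
    have sq: "complex_of_real ((d (Suc m) n i)\<^sup>2) = (\<Sum>h=2..CARD('n). \<Sum>l=2..CARD('n).
       (g h * ?p m h * v h $ i) * (g l * ?p m l * v l $ i))" if "m < n" for m i
      using that by (simp add: power2_eq_square d_complex sum_product)
    have "(\<Sum>i\<in>UNIV. complex_of_real ((b n m i)\<^sup>2)) = (\<Sum>h=2..CARD('n). \<Sum>l=2..CARD('n).
        g h * g l * (of_real ((a n)\<^sup>2) * (of_real ((r m)\<^sup>2) * (?p m h * ?p m l)) * scalar_product (v h) (v l)))"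
      (is "?lhs = ?rhs") if m: "m < n" for m
    proof -
      have "?lhs = (\<Sum>i\<in>UNIV. \<Sum>h=2..CARD('n). \<Sum>l=2..CARD('n).
        g h * g l * (of_real ((a n)\<^sup>2) * (of_real ((r m)\<^sup>2) * (?p m h * ?p m l)) * (v h $ i * v l $ i)))"
        unfolding b_def power_mult_distrib of_real_mult sq[OF m] sum_distrib_left
        by (intro sum.cong refl) (simp add: mult_ac)
      also have "\<dots> = (\<Sum>h=2..CARD('n). \<Sum>l=2..CARD('n). \<Sum>i\<in>UNIV.
        g h * g l * (of_real ((a n)\<^sup>2) * (of_real ((r m)\<^sup>2) * (?p m h * ?p m l)) * (v h $ i * v l $ i)))"
        by (rule trans[OF sum.swap], rule sum.cong[OF refl], rule sum.swap)
      also have "\<dots> = ?rhs" unfolding scalar_product_def sum_distrib_left ..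
      finally show ?thesis .
    qed
    then have "complex_of_real (s n) = (\<Sum>m<n. \<Sum>h=2..CARD('n). \<Sum>l=2..CARD('n).
        g h * g l * (of_real ((a n)\<^sup>2) * (of_real ((r m)\<^sup>2) * (?p m h * ?p m l)) * scalar_product (v h) (v l)))"
      unfolding s_def of_real_sum by (intro sum.cong refl) simp
    also have "\<dots> = (\<Sum>h=2..CARD('n). \<Sum>l=2..CARD('n). \<Sum>m<n.
        g h * g l * (of_real ((a n)\<^sup>2) * (of_real ((r m)\<^sup>2) * (?p m h * ?p m l)) * scalar_product (v h) (v l)))"
      by (rule trans[OF sum.swap], rule sum.cong[OF refl], rule sum.swap)
    also have "\<dots> = (\<Sum>h=2..CARD('n). \<Sum>l=2..CARD('n).
     g h * g l * ((of_real ((a n)\<^sup>2) * prod_sum2 r (1 - lam h) (1 - lam l) n) * scalar_product (v h) (v l)))"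
      unfolding prod_sum2_def sum_distrib_left sum_distrib_right ..
    finally show ?thesis .
  qed
  have V: "V = (\<Sum>h=2..CARD('n). \<Sum>l=2..CARD('n). g h * g l * (\<sigma> h l * scalar_product (v h) (v l)))"
    unfolding V_def g_def
    by (rule diff_var_U_S_UT) (simp add: \<sigma>_sym scalar_product_def mult.commute)
  have s_V: "(\<lambda>n. complex_of_real (s n)) \<longlonglongrightarrow> V"
    unfolding s_complex V by (intro tendsto_intros lim2)
  \<comment> \<open>The formula for V is complex. As a limit of the real nonnegative
    \<open>s n\<close> it is real and nonnegative, without any computation with
    eigenvectors.\<close>
  have "(\<lambda>n. Im (complex_of_real (s n))) \<longlonglongrightarrow> Im V" by (intro tendsto_intros s_V)
  then have "Im V = 0" by (simp add: LIMSEQ_const_iff)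
  then have V_real: "V \<in> \<real>" by (simp add: complex_is_Real_iff)
  have "(\<lambda>n. Re (complex_of_real (s n))) \<longlonglongrightarrow> Re V" by (intro tendsto_intros s_V)
  then have s_lim: "s \<longlonglongrightarrow> Re V" by simp
  have s0: "0 \<le> s n" for n unfolding s_def by (intro sum_nonneg) auto
  have V0: "0 \<le> Re V" using s_lim s0 by (intro LIMSEQ_le_const) auto
  obtain K where K: "\<And>n. s n \<le> K"
    using convergent_imp_Bseq[OF convergentI[OF s_lim]] s0 by (auto simp: Bseq_def)
  define \<xi> where "\<xi> n m \<omega> = (\<Sum>i\<in>UNIV. b n m i * innovation m \<omega> i)" for n m \<omega>
  define cv where "cv n m \<omega> = (\<Sum>i\<in>UNIV. (b n m i)\<^sup>2 * (success_prob m \<omega> i * (1 - success_prob m \<omega> i)))" for n m \<omega>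
  have bB: "(\<Sum>i\<in>UNIV. (b n m i)\<^sup>2) \<le> (B n m)\<^sup>2" for n m
  proof -
    have "(\<Sum>i\<in>UNIV. (b n m i)\<^sup>2) = (\<Sum>i\<in>UNIV. \<bar>b n m i\<bar> * \<bar>b n m i\<bar>)" by (simp add: power2_eq_square)
    also have "\<dots> \<le> (\<Sum>i\<in>UNIV. \<bar>b n m i\<bar> * B n m)"
      unfolding B by (intro sum_mono mult_left_mono member_le_sum) auto
    also have "\<dots> = (B n m)\<^sup>2" by (simp add: B sum_distrib_right power2_eq_square)
    finally show ?thesis .
  qed
  have qq: "success_prob m \<omega> i * (1 - success_prob m \<omega> i) \<in> {0..1}" if "\<omega> \<in> space M" for m \<omega> i
    using success_prob_range[OF that, of m i] by (auto intro: mult_le_one)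
  \<comment> \<open>The factor \<open>CARD('n)\<close> is the price of passing from the sum of
    squares over the coordinates to the square of the sum of moduli that bounds
    \<open>\<xi>\<close>.\<close>
  interpret bounded_martingale_array M history \<xi> cv B \<beta> "of_nat CARD('n) * K"
  proof
    show "\<xi> n m \<in> borel_measurable (history (Suc m))" for n m
      unfolding \<xi>_def by (intro borel_measurable_sum borel_measurable_times borel_measurable_const innovation_history)
    show "cv n m \<in> borel_measurable (history m)" for n m
      unfolding cv_def
      by (intro borel_measurable_sum borel_measurable_times borel_measurable_diff borel_measurable_const success_prob_history)
    show "\<bar>\<xi> n m \<omega>\<bar> \<le> B n m" if "\<omega> \<in> space M" for n m \<omega>
      unfolding \<xi>_def B using innovation_bound[OF that]
      by (intro order_trans[OF sum_abs] sum_mono) (auto simp: abs_mult intro!: mult_left_le)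
    show "cv n m \<omega> \<in> {0..(B n m)\<^sup>2}" if "\<omega> \<in> space M" for n m \<omega>
    proof -
      have "cv n m \<omega> \<le> (\<Sum>i\<in>UNIV. (b n m i)\<^sup>2)"
        unfolding cv_def using qq[OF that] by (intro sum_mono mult_left_le) auto
      moreover have "0 \<le> cv n m \<omega>"
        unfolding cv_def using success_prob_range[OF that] by (intro sum_nonneg mult_nonneg_nonneg) auto
      ultimately show ?thesis using bB[of n m] by simp
    qed
    fix n m U and C :: real
    assume U: "U \<in> borel_measurable (history m)" and UC: "\<And>\<omega>. \<omega> \<in> space M \<Longrightarrow> \<bar>U \<omega>\<bar> \<le> C"
    have Um[measurable]: "U \<in> borel_measurable M" using measurable_from_subalg[OF subalgebra_history U] .
    have \<Delta>m[measurable]: "(\<lambda>\<omega>. innovation m \<omega> i) \<in> borel_measurable M" for i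
      using measurable_from_subalg[OF subalgebra_history innovation_history] .
    have i1: "integrable M (\<lambda>\<omega>. U \<omega> * innovation m \<omega> i)" for i
      by (rule bounded_integrable[where C = C], simp, rule abs_mult_le_bound[OF UC innovation_bound])
    have \<Delta>\<Delta>: "\<bar>innovation m \<omega> i * innovation m \<omega> l\<bar> \<le> 1" if "\<omega> \<in> space M" for \<omega> i l
      using abs_mult_le_bound[OF innovation_bound[OF that] innovation_bound[OF that]] .
    have i2: "integrable M (\<lambda>\<omega>. U \<omega> * (innovation m \<omega> i * innovation m \<omega> l))" for i l
      by (rule bounded_integrable[where C = C], simp, rule abs_mult_le_bound[OF UC \<Delta>\<Delta>])
    have qq1: "\<bar>success_prob m \<omega> i * (1 - success_prob m \<omega> i)\<bar> \<le> 1" if "\<omega> \<in> space M" for \<omega> i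
      using qq[OF that, of m i] by (simp add: abs_le_iff)
    have i3: "integrable M (\<lambda>\<omega>. U \<omega> * (success_prob m \<omega> i * (1 - success_prob m \<omega> i)))" for i
      by (rule bounded_integrable[where C = C], simp, rule abs_mult_le_bound[OF UC qq1])
    have "expectation (\<lambda>\<omega>. U \<omega> * \<xi> n m \<omega>) = expectation (\<lambda>\<omega>. \<Sum>i\<in>UNIV. b n m i * (U \<omega> * innovation m \<omega> i))"
      by (simp add: \<xi>_def sum_distrib_left mult_ac)
    also have "\<dots> = (\<Sum>i\<in>UNIV. b n m i * expectation (\<lambda>\<omega>. U \<omega> * innovation m \<omega> i))"
      using i1 by (subst Bochner_Integration.integral_sum) auto
    also have "\<dots> = 0" by (simp add: expectation_innovation[OF U UC])
    finally show "expectation (\<lambda>\<omega>. U \<omega> * \<xi> n m \<omega>) = 0" .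
    have e2: "expectation (\<lambda>\<omega>. U \<omega> * (innovation m \<omega> i * innovation m \<omega> l)) =
      expectation (\<lambda>\<omega>. U \<omega> * (if i = l then success_prob m \<omega> i * (1 - success_prob m \<omega> i) else 0))" for i l
      by (rule expectation_innovation_mult[OF U UC])
    have "expectation (\<lambda>\<omega>. U \<omega> * (\<xi> n m \<omega>)\<^sup>2) =
       expectation (\<lambda>\<omega>. \<Sum>i\<in>UNIV. \<Sum>l\<in>UNIV. b n m i * b n m l * (U \<omega> * (innovation m \<omega> i * innovation m \<omega> l)))"
      by (simp add: \<xi>_def power2_eq_square sum_product sum_distrib_left mult_ac)
    also have "\<dots> = (\<Sum>i\<in>UNIV. \<Sum>l\<in>UNIV. b n m i * b n m l * expectation (\<lambda>\<omega>. U \<omega> * (innovation m \<omega> i * innovation m \<omega> l)))"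
      using i2 by (subst Bochner_Integration.integral_sum, simp)+ simp
    also have "\<dots> = (\<Sum>i\<in>UNIV. \<Sum>l\<in>UNIV. if l = i then (b n m i)\<^sup>2 * expectation (\<lambda>\<omega>. U \<omega> * (success_prob m \<omega> i * (1 - success_prob m \<omega> i))) else 0)"
      unfolding e2 by (intro sum.cong refl) (auto simp: power2_eq_square)
    also have "\<dots> = (\<Sum>i\<in>UNIV. (b n m i)\<^sup>2 * expectation (\<lambda>\<omega>. U \<omega> * (success_prob m \<omega> i * (1 - success_prob m \<omega> i))))" by simp
    also have "\<dots> = expectation (\<lambda>\<omega>. \<Sum>i\<in>UNIV. (b n m i)\<^sup>2 * (U \<omega> * (success_prob m \<omega> i * (1 - success_prob m \<omega> i))))"
      using i3 by (subst Bochner_Integration.integral_sum) auto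
    also have "\<dots> = expectation (\<lambda>\<omega>. U \<omega> * cv n m \<omega>)"
      by (simp add: cv_def sum_distrib_left mult_ac)
    finally have eq: "expectation (\<lambda>\<omega>. U \<omega> * (\<xi> n m \<omega>)\<^sup>2) = expectation (\<lambda>\<omega>. U \<omega> * cv n m \<omega>)" .
    have "integrable M (\<lambda>\<omega>. \<Sum>i\<in>UNIV. \<Sum>l\<in>UNIV. b n m i * b n m l * (U \<omega> * (innovation m \<omega> i * innovation m \<omega> l)))"
      using i2 by auto
    then have j1: "integrable M (\<lambda>\<omega>. U \<omega> * (\<xi> n m \<omega>)\<^sup>2)"
      by (simp add: \<xi>_def power2_eq_square sum_product sum_distrib_left mult_ac)
    have "integrable M (\<lambda>\<omega>. \<Sum>i\<in>UNIV. (b n m i)\<^sup>2 * (U \<omega> * (success_prob m \<omega> i * (1 - success_prob m \<omega> i))))"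
      using i3 by auto
    then have j2: "integrable M (\<lambda>\<omega>. U \<omega> * cv n m \<omega>)"
      by (simp add: cv_def sum_distrib_left mult_ac)
    show "expectation (\<lambda>\<omega>. U \<omega> * ((\<xi> n m \<omega>)\<^sup>2 - cv n m \<omega>)) = 0"
      unfolding right_diff_distrib using j1 j2 eq by simp
  next
    fix n
    have "(B n m)\<^sup>2 \<le> of_nat CARD('n) * (\<Sum>i\<in>UNIV. (b n m i)\<^sup>2)" for m
      unfolding B using sum_squared_le_sum_of_squares[of "\<lambda>i. \<bar>b n m i\<bar>" UNIV] by (simp add: mult.commute)
    then have "(\<Sum>m<n. (B n m)\<^sup>2) \<le> of_nat CARD('n) * s n"
      unfolding s_def sum_distrib_left[of "of_nat CARD('n)"] by (intro sum_mono)
    also have "\<dots> \<le> of_nat CARD('n) * K" using K by (intro mult_left_mono) auto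
    finally show "(\<Sum>m<n. (B n m)\<^sup>2) \<le> of_nat CARD('n) * K" .
  qed (use subalgebra_history history_mono B_le \<beta> in auto)
  have "stably_converges_normal M (\<lambda>n \<omega>. a n * (Z n \<omega> $ j - Z n \<omega> $ k)) (\<lambda>\<omega>. Zinf \<omega> * (1 - Zinf \<omega>) * Re V)"
  proof (rule stable_clt[OF _ _ \<beta>])
    show "\<bar>a n * (Z n \<omega> $ j - Z n \<omega> $ k) - (\<Sum>m<n. \<xi> n m \<omega>)\<bar> \<le> \<beta> n" if \<omega>: "\<omega> \<in> space M" for n \<omega>
    proof -
      have pd: "propagate lam u v m n j y - propagate lam u v m n k y = (\<Sum>i\<in>UNIV. d m n i * y i)" for m y
        by (simp add: propagate_def d_def sum_subtractf[symmetric] left_diff_distrib)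
      have "Z n \<omega> $ j - Z n \<omega> $ k = (\<Sum>i\<in>UNIV. d 0 n i * Z 0 \<omega> $ i) + (\<Sum>m<n. r m * (\<Sum>i\<in>UNIV. d (Suc m) n i * innovation m \<omega> i))"
        unfolding Z_decomposition[OF spectral \<omega>, of n] pd[symmetric]
        by (simp add: sum_subtractf right_diff_distrib)
      then have "a n * (Z n \<omega> $ j - Z n \<omega> $ k) - (\<Sum>m<n. \<xi> n m \<omega>) = a n * (\<Sum>i\<in>UNIV. d 0 n i * Z 0 \<omega> $ i)"
        by (simp add: \<xi>_def b_def distrib_left sum_distrib_left mult_ac)
      then show ?thesis using init_le[OF \<omega>] by simp
    qed
    show "0 \<le> Zinf \<omega> * (1 - Zinf \<omega>) * Re V" if "\<omega> \<in> space M" for \<omega>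
      using Zinf_range[OF that] V0 by simp
    show "AE \<omega> in M. (\<lambda>n. \<Sum>m<n. cv n m \<omega>) \<longlonglongrightarrow> Zinf \<omega> * (1 - Zinf \<omega>) * Re V"
      using Zinf_limit
    proof eventually_elim
      case (elim \<omega>)
      let ?x = "Zinf \<omega> * (1 - Zinf \<omega>)"
      have Zl: "(\<lambda>n. Z n \<omega> $ i) \<longlonglongrightarrow> Zinf \<omega>" for i
        using tendsto_vec_nth[OF elim, of i] by simp
      have "(\<lambda>n. success_prob n \<omega> i) \<longlonglongrightarrow> (\<Sum>b\<in>UNIV. W $ b $ i * Zinf \<omega>)" for i
        unfolding success_prob_def by (intro tendsto_intros Zl)
      then have ql: "(\<lambda>n. success_prob n \<omega> i) \<longlonglongrightarrow> Zinf \<omega>" for i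
        by (simp add: sum_distrib_right[symmetric] W_column_sum)
      \<comment> \<open>All Bernoulli variances share one limit, and y adds up the deviations from
        it. The weights of any fixed step vanish as n grows, so weighted sums of y tend to 0 along
        with y.\<close>
      define y where "y m = (\<Sum>i\<in>UNIV. \<bar>success_prob m \<omega> i * (1 - success_prob m \<omega> i) - ?x\<bar>)" for m
      have "y \<longlonglongrightarrow> (\<Sum>i\<in>(UNIV :: 'n set). \<bar>?x - ?x\<bar>)"
        unfolding y_def by (intro tendsto_intros ql)
      then have y: "y \<longlonglongrightarrow> 0" by simp
      have "(\<lambda>n. \<Sum>m<n. (\<Sum>i\<in>UNIV. (b n m i)\<^sup>2) * y m) \<longlonglongrightarrow> 0"
      proof (rule toeplitz_tendsto_0[where \<beta> = "\<lambda>n. (\<beta> n)\<^sup>2" and K = K])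
        show "(\<Sum>i\<in>UNIV. (b n m i)\<^sup>2) \<le> (\<beta> n)\<^sup>2" if "m < n" for n m
          using bB[of n m] power_mono[OF B_le[OF that] B_nonneg, of 2] by simp
        show "(\<lambda>n. (\<beta> n)\<^sup>2) \<longlonglongrightarrow> 0" using tendsto_power[OF \<beta>, of 2] by simp
        show "(\<Sum>m<n. \<Sum>i\<in>UNIV. (b n m i)\<^sup>2) \<le> K" for n using K[of n] by (simp add: s_def)
      qed (auto intro: sum_nonneg y)
      then have "(\<lambda>n. (\<Sum>m<n. cv n m \<omega>) - ?x * s n) \<longlonglongrightarrow> 0"
      proof (rule Lim_null_comparison[rotated], intro eventuallyI)
        fix n
        have "(\<Sum>m<n. cv n m \<omega>) - ?x * s n = (\<Sum>m<n. \<Sum>i\<in>UNIV. (b n m i)\<^sup>2 * (success_prob m \<omega> i * (1 - success_prob m \<omega> i) - ?x))"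
          by (simp add: cv_def s_def sum_distrib_left sum_subtractf[symmetric] right_diff_distrib mult_ac)
        also have "norm \<dots> \<le> (\<Sum>m<n. (\<Sum>i\<in>UNIV. (b n m i)\<^sup>2) * y m)"
          unfolding sum_distrib_right
        proof (intro order_trans[OF norm_sum] sum_mono)
          fix m i
          have "\<bar>success_prob m \<omega> i * (1 - success_prob m \<omega> i) - ?x\<bar> \<le> y m" unfolding y_def by (intro member_le_sum) auto
          then show "norm ((b n m i)\<^sup>2 * (success_prob m \<omega> i * (1 - success_prob m \<omega> i) - ?x)) \<le> (b n m i)\<^sup>2 * y m"
            by (simp add: abs_mult mult_left_mono)
        qed
        finally show "norm ((\<Sum>m<n. cv n m \<omega>) - ?x * s n) \<le> (\<Sum>m<n. (\<Sum>i\<in>UNIV. (b n m i)\<^sup>2) * y m)" .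
      qed
      from tendsto_add[OF this tendsto_mult_left[OF s_lim, of ?x]] show ?case by simp
    qed
  qed measurable
  with V_real show ?thesis by blast
qed

end

section \<open>The three regimes\<close>

text \<open>The matrices have complex entries, which is why each regime also asserts that the
  variance constant is real: its real part then loses nothing.\<close>

theorem theorem3p3:
  fixes M :: "'w measure" and W :: "real ^ 'n ^ 'n" and r :: "nat \<Rightarrow> real" and \<gamma> c :: real
    and X Z :: "nat \<Rightarrow> 'w \<Rightarrow> real ^ 'n" and Zinf :: "'w \<Rightarrow> real"
    and lam :: "nat \<Rightarrow> complex" and u v :: "nat \<Rightarrow> complex ^ 'n" and lam_star :: complex
    and j k :: 'n
  assumes model: "interacting_rsp M W r \<gamma> c X Z"
    and Zinf_measurable: "Zinf \<in> borel_measurable M"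
    and Zinf_range: "\<And>\<omega>. \<omega> \<in> space M \<Longrightarrow> Zinf \<omega> \<in> {0..1}"
    and Zinf_limit: "AE \<omega> in M. (\<lambda>n. Z n \<omega>) \<longlonglongrightarrow> Zinf \<omega> *\<^sub>R 1"
    and spectral: "spectral_system W lam u v"
    and lam_star: "is_arg_max Re (\<lambda>z. z \<in> lam ` {2..CARD('n)}) lam_star"
    and jk: "j \<noteq> k"
  shows
    "(1/2 < \<gamma> \<and> \<gamma> < 1 \<longrightarrow>
        diff_var (U_S_UT u (S_gamma c lam v)) j k \<in> \<real> \<and>
        stably_converges_normal M
          (\<lambda>n \<omega>. real n powr (\<gamma> / 2) * (Z n \<omega> $ j - Z n \<omega> $ k))
          (\<lambda>\<omega>. Zinf \<omega> * (1 - Zinf \<omega>) * Re (diff_var (U_S_UT u (S_gamma c lam v)) j k)))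
   \<and> (\<gamma> = 1 \<and> Re lam_star < 1 - 1 / (2 * c) \<longrightarrow>
        diff_var (U_S_UT u (S_one c lam v)) j k \<in> \<real> \<and>
        stably_converges_normal M
          (\<lambda>n \<omega>. sqrt (real n) * (Z n \<omega> $ j - Z n \<omega> $ k))
          (\<lambda>\<omega>. Zinf \<omega> * (1 - Zinf \<omega>) * Re (diff_var (U_S_UT u (S_one c lam v)) j k)))
   \<and> (\<gamma> = 1 \<and> Re lam_star = 1 - 1 / (2 * c) \<and>
        (\<lambda>n. real n * r n - c) \<in> O(\<lambda>n. 1 / real n) \<longrightarrow>
        diff_var (U_S_UT u (S_one_star c lam v)) j k \<in> \<real> \<and>
        stably_converges_normal M
          (\<lambda>n \<omega>. sqrt (real n) / sqrt (ln (real n)) * (Z n \<omega> $ j - Z n \<omega> $ k))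
          (\<lambda>\<omega>. Zinf \<omega> * (1 - Zinf \<omega>) * Re (diff_var (U_S_UT u (S_one_star c lam v)) j k)))"
proof -
  interpret interacting_rsp M W r \<gamma> c X Z by (rule model)
  note clt = stable_clt_difference[OF spectral Zinf_measurable Zinf_range Zinf_limit]
  have star: "Re (lam h) \<le> Re lam_star" if "h \<in> {2..CARD('n)}" for h
    using lam_star that by (auto simp: is_arg_max_def not_less)
  have c0: "complex_of_real c \<noteq> 0" using c_pos by simp
  have four: "x ^ 4 = (x\<^sup>2)\<^sup>2" for x :: real by simp
  show ?thesis
  proof (intro conjI[of "_ \<longrightarrow> _"] impI)
    assume \<gamma>: "1/2 < \<gamma> \<and> \<gamma> < 1"
    define \<sigma> where "\<sigma> h l = complex_of_real c / (2 - (lam h + lam l))" for h l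
    have S: "S_gamma c lam v = (\<lambda>h l. \<sigma> h l * scalar_product (v h) (v l))"
      by (simp add: fun_eq_iff S_gamma_def \<sigma>_def)
    \<comment> \<open>For \<open>\<gamma> < 1\<close> the growth of the normalisation is of lower
      order than the contraction, so any positive rate suffices and irreducibility supplies
      it.\<close>
    have re: "Re (lam h) < 1" if "h \<in> {2..CARD('n)}" for h
      by (rule Re_eigenvalue_less_1[OF spectral W_nonneg W_column_sum W_irreducible that])
    have a2: "(real n powr (\<gamma> / 2))\<^sup>2 = real n powr \<gamma>" for n
      by (simp add: power2_eq_square powr_add[symmetric])
    show "diff_var (U_S_UT u (S_gamma c lam v)) j k \<in> \<real> \<and>
        stably_converges_normal M
          (\<lambda>n \<omega>. real n powr (\<gamma> / 2) * (Z n \<omega> $ j - Z n \<omega> $ k))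
          (\<lambda>\<omega>. Zinf \<omega> * (1 - Zinf \<omega>) * Re (diff_var (U_S_UT u (S_gamma c lam v)) j k))"
      unfolding S
    proof (rule clt)
      fix h assume h: "h \<in> {2..CARD('n)}"
      have "(\<lambda>n. (real n powr \<gamma>)\<^sup>2 * prod_sum4 r (1 - lam h) n) \<longlonglongrightarrow> 0"
        using re[OF h] c_pos \<gamma> by (intro prod_sum4_tendsto_0[OF _ _ r_limit]) auto
      then show "(\<lambda>n. (real n powr (\<gamma> / 2)) ^ 4 * prod_sum4 r (1 - lam h) n) \<longlonglongrightarrow> 0"
        unfolding four a2 .
      fix l assume l: "l \<in> {2..CARD('n)}"
      have w: "(1 - lam h) + (1 - lam l) = 2 - (lam h + lam l)" by simp
      have "0 < c * Re ((1 - lam h) + (1 - lam l))"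
        using re[OF h] re[OF l] c_pos by (intro mult_pos_pos) auto
      then have "(\<lambda>n. of_real (real n powr \<gamma>) * prod_sum2 r (1 - lam h) (1 - lam l) n) \<longlonglongrightarrow>
        of_real (c\<^sup>2) / (of_real c * ((1 - lam h) + (1 - lam l)) - of_real (if \<gamma> = 1 then 1 else 0))"
        using \<gamma> by (intro prod_sum2_tendsto[OF _ _ r_limit]) auto
      also have "of_real (c\<^sup>2) / (of_real c * ((1 - lam h) + (1 - lam l)) - of_real (if \<gamma> = 1 then 1 else 0)) = \<sigma> h l"
        unfolding \<sigma>_def w using \<gamma> c0 by (simp add: power2_eq_square)
      finally show "(\<lambda>n. of_real ((real n powr (\<gamma> / 2))\<^sup>2) * prod_sum2 r (1 - lam h) (1 - lam l) n) \<longlonglongrightarrow> \<sigma> h l"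
        unfolding a2 .
    qed (auto simp: \<sigma>_def add.commute)
  next
    assume \<gamma>: "\<gamma> = 1 \<and> Re lam_star < 1 - 1 / (2 * c)"
    define \<sigma> where "\<sigma> h l = complex_of_real (c\<^sup>2) / (2 * complex_of_real c - complex_of_real c * (lam h + lam l) - 1)" for h l
    have S: "S_one c lam v = (\<lambda>h l. \<sigma> h l * scalar_product (v h) (v l))"
      by (simp add: fun_eq_iff S_one_def \<sigma>_def)
    \<comment> \<open>For \<open>\<gamma> = 1\<close> the growth of the normalisation costs exactly
      1, and the eigenvalue condition says that the net rate stays positive for every
      component.\<close>
    have re: "1 < 2 * c * Re (1 - lam h)" if "h \<in> {2..CARD('n)}" for h
    proof -
      have "Re (lam h) < 1 - 1 / (2 * c)" using star[OF that] \<gamma> by linarith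
      then show ?thesis using c_pos by (simp add: field_simps)
    qed
    have r1: "(\<lambda>n. real n powr 1 * r n) \<longlonglongrightarrow> c" using r_limit \<gamma> by simp
    show "diff_var (U_S_UT u (S_one c lam v)) j k \<in> \<real> \<and>
        stably_converges_normal M
          (\<lambda>n \<omega>. sqrt (real n) * (Z n \<omega> $ j - Z n \<omega> $ k))
          (\<lambda>\<omega>. Zinf \<omega> * (1 - Zinf \<omega>) * Re (diff_var (U_S_UT u (S_one c lam v)) j k))"
      unfolding S
    proof (rule clt)
      fix h assume h: "h \<in> {2..CARD('n)}"
      have "(\<lambda>n. (real n powr 1)\<^sup>2 * prod_sum4 r (1 - lam h) n) \<longlonglongrightarrow> 0"
        using re[OF h] by (intro prod_sum4_tendsto_0[OF _ _ r1]) auto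
      then show "(\<lambda>n. (sqrt (real n)) ^ 4 * prod_sum4 r (1 - lam h) n) \<longlonglongrightarrow> 0"
        unfolding four by simp
      fix l assume l: "l \<in> {2..CARD('n)}"
      have "1 < c * Re ((1 - lam h) + (1 - lam l))"
        using re[OF h] re[OF l] by (simp add: algebra_simps)
      then have "(\<lambda>n. of_real (real n powr 1) * prod_sum2 r (1 - lam h) (1 - lam l) n) \<longlonglongrightarrow>
        of_real (c\<^sup>2) / (of_real c * ((1 - lam h) + (1 - lam l)) - of_real (if (1::real) = 1 then 1 else 0))"
        by (intro prod_sum2_tendsto[OF _ _ r1]) auto
      also have "of_real (c\<^sup>2) / (of_real c * ((1 - lam h) + (1 - lam l)) - of_real (if (1::real) = 1 then 1 else 0)) = \<sigma> h l"
        by (simp add: \<sigma>_def algebra_simps)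
      finally show "(\<lambda>n. of_real ((sqrt (real n))\<^sup>2) * prod_sum2 r (1 - lam h) (1 - lam l) n) \<longlonglongrightarrow> \<sigma> h l"
        by simp
    qed (auto simp: \<sigma>_def add.commute)
  next
    assume \<gamma>: "\<gamma> = 1 \<and> Re lam_star = 1 - 1 / (2 * c) \<and> (\<lambda>n. real n * r n - c) \<in> O(\<lambda>n. 1 / real n)"
    then have rO: "(\<lambda>n. real n * r n - c) \<in> O(\<lambda>n. 1 / real n)" by simp
    define \<sigma> where "\<sigma> h l = (if of_real c * ((1 - lam h) + (1 - lam l)) = 1 then complex_of_real (c\<^sup>2) else 0)" for h l
    \<comment> \<open>This is the case of zero net drift, in which the normalised covariance grows
      like \<open>ln n\<close>; the other entries stay bounded and disappear after division by the
      logarithm.\<close>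
    have "of_real c * ((1 - lam h) + (1 - lam l)) = 1 \<longleftrightarrow> lam h + lam l = 2 - 1 / complex_of_real c" for h l
      using c0 by (auto simp: field_simps)
    then have S: "S_one_star c lam v = (\<lambda>h l. \<sigma> h l * scalar_product (v h) (v l))"
      by (simp add: fun_eq_iff S_one_star_def \<sigma>_def)
    have re: "1 \<le> 2 * c * Re (1 - lam h)" if "h \<in> {2..CARD('n)}" for h
    proof -
      have "Re (lam h) \<le> 1 - 1 / (2 * c)" using star[OF that] \<gamma> by linarith
      then show ?thesis using c_pos by (simp add: field_simps)
    qed
    \<comment> \<open>Nonnegativity for every n makes the square of the square root valid
      throughout, including n = 0 with the value of the total function \<open>ln\<close> there. At n
      = 1 the normalisation is 0 by division by zero.\<close>
    have ln0: "0 \<le> ln (real n)" for n by (cases "n = 0") auto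
    have a2: "(sqrt (real n) / sqrt (ln (real n)))\<^sup>2 = real n / ln (real n)" for n
      using ln0[of n] by (simp add: power_divide)
    show "diff_var (U_S_UT u (S_one_star c lam v)) j k \<in> \<real> \<and>
        stably_converges_normal M
          (\<lambda>n \<omega>. sqrt (real n) / sqrt (ln (real n)) * (Z n \<omega> $ j - Z n \<omega> $ k))
          (\<lambda>\<omega>. Zinf \<omega> * (1 - Zinf \<omega>) * Re (diff_var (U_S_UT u (S_one_star c lam v)) j k))"
      unfolding S
    proof (rule clt)
      fix h assume h: "h \<in> {2..CARD('n)}"
      show "(\<lambda>n. (sqrt (real n) / sqrt (ln (real n))) ^ 4 * prod_sum4 r (1 - lam h) n) \<longlonglongrightarrow> 0"
        unfolding four a2 by (rule prod_sum4_log_tendsto_0[OF rO re[OF h]])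
      fix l assume l: "l \<in> {2..CARD('n)}"
      have "1 \<le> c * Re ((1 - lam h) + (1 - lam l))"
        using re[OF h] re[OF l] by (simp add: algebra_simps)
      then show "(\<lambda>n. of_real ((sqrt (real n) / sqrt (ln (real n)))\<^sup>2) * prod_sum2 r (1 - lam h) (1 - lam l) n) \<longlonglongrightarrow> \<sigma> h l"
        unfolding a2 \<sigma>_def by (rule prod_sum2_log_tendsto[OF rO])
    qed (auto simp: \<sigma>_def add.commute ln0)
  qed
qed

end
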